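(* For each $\beta\in Q^+$, the restriction of the pairing $\langle\,,\,\rangle_{\mathbf q}$ to $(U^-_{\mathbf q})_{-\beta}\times(U^+_{\mathbf q})_{\beta}$ is nondegenerate.
   Context: Let $A=(a_{ij})_{i,j\in I}$ be a symmetrizable generalized Cartan matrix ($I$ finite); $Q=\bigoplus_i\mathbb Z\alpha_i$, $Q^+=\bigoplus_i\mathbb Z_{\ge0}\alpha_i$. Let $q_{ij}$ ($i,j\in I$) be indeterminates over $\mathbb Q$ subject to $q_{ij}q_{ji}=q_{ii}^{a_{ij}}$, and $\mathbb K\supset\mathbb Q(q_{ij}\mid i,j\in I)$ a field containing $q_{ii}^{1/m}$ for all positive integers $m$. The $q_{ii}$ are not roots of unity. Notation: $(n)_v=\frac{v^n-1}{v-1}$, $(n)_v!=(n)_v\cdots(1)_v$, $(0)_v!=1$, $\binom nk_v=\frac{(n)_v!}{(k)_v!(n-k)_v!}$. $U_{\mathbf q}=U_{\mathbf q}(\mathfrak g_A)$ is the associative unital $\mathbb K$-algebra generated by $e_i,f_i,\omega_i^{\pm1},\omega_i'^{\pm1}$ ($i\in I$) with relations: all $\omega_i^{\pm1},\omega_j'^{\pm1}$ commute with each other, $\omega_i\omega_i^{-1}=\omega_i'\omega_i'^{-1}=1$; $\omega_ie_j\omega_i^{-1}=q_{ij}e_j$, $\omega_i'e_j\omega_i'^{-1}=q_{ji}^{-1}e_j$; $\omega_if_j\omega_i^{-1}=q_{ij}^{-1}f_j$, $\omega_i'f_j\omega_i'^{-1}=q_{ji}f_j$; $e_if_j-f_je_i=\delta_{ij}\frac{q_{ii}}{q_{ii}-1}(\omega_i-\omega_i')$;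 and for $i\neq j$ $$\sum_{k=0}^{1-a_{ij}}(-1)^k\tbinom{1-a_{ij}}{k}_{q_{ii}}q_{ii}^{k(k-1)/2}q_{ij}^k e_i^{1-a_{ij}-k}e_je_i^k=0,\qquad \sum_{k=0}^{1-a_{ij}}(-1)^k\tbinom{1-a_{ij}}{k}_{q_{ii}}q_{ii}^{k(k-1)/2}q_{ij}^k f_i^kf_jf_i^{1-a_{ij}-k}=0.$$ It is a Hopf algebra with $\omega_i^{\pm1},\omega_i'^{\pm1}$ group-like, $\Delta(e_i)=e_i\otimes1+\omega_i\otimes e_i$, $\Delta(f_i)=1\otimes f_i+f_i\otimes\omega_i'$, $\varepsilon(e_i)=\varepsilon(f_i)=0$. $U^+_{\mathbf q}$ (resp. $U^-_{\mathbf q}$) is the subalgebra generated by all $e_i$ (resp. all $f_i$), graded by $\deg e_i=\alpha_i$, $\deg f_i=-\alpha_i$; $(U^\pm_{\mathbf q})_{\pm\beta}$ is the component of degree $\pm\beta$. $U_{\mathbf q}^{\ge0}$ (resp. $U_{\mathbf q}^{\le0}$) is the Hopf subalgebra generated by all $e_i,\omega_i^{\pm1}$ (resp. all $f_i,\omega_i'^{\pm1}$). For $\mu=\sum\mu_i\alpha_i$, $\nu=\sum\nu_j\alpha_j\in Q$: $\omega_\mu=\prod\omega_i^{\mu_i}$, $\omega'_\mu=\prod\omega_i'^{\mu_i}$, $q_{\mu\nu}=\prod q_{ij}^{\mu_i\nu_j}$. The pairing $\langle\,,\,\rangle_{\mathbf q}:U_{\mathbf q}^{\le0}\times U_{\mathbf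 q}^{\ge0}\to\mathbb K$ is the unique bilinear pairing with $\langle y,xx'\rangle_{\mathbf q}=\langle\Delta(y),x'\otimes x\rangle_{\mathbf q}$, $\langle yy',x\rangle_{\mathbf q}=\langle y\otimes y',\Delta(x)\rangle_{\mathbf q}$, $\langle f_i,e_j\rangle_{\mathbf q}=\delta_{ij}\frac{q_{ii}}{1-q_{ii}}$, $\langle\omega'_\mu,\omega_\nu\rangle_{\mathbf q}=q_{\nu\mu}$, $\langle\omega'_\mu,e_i\rangle_{\mathbf q}=0=\langle f_i,\omega_\mu\rangle_{\mathbf q}$. *)

theory Defs
  imports
    "HOL-Algebra.Algebraic_Closure_Type"
    "HOL-Algebra.Generated_Rings"
    "HOL-Library.Poly_Mapping"
    "HOL-Library.Product_Plus"
begin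

section \<open>Cartan matrices and parameters\<close>

definition generalized_cartan_matrix :: "('i \<Rightarrow> 'i \<Rightarrow> int) \<Rightarrow> bool" where
  "generalized_cartan_matrix a \<longleftrightarrow>
     (\<forall>i. a i i = 2) \<and>
     (\<forall>i j. i \<noteq> j \<longrightarrow> a i j \<le> 0) \<and>
     (\<forall>i j. a i j = 0 \<longleftrightarrow> a j i = 0)"

definition symmetrizable :: "('i \<Rightarrow> 'i \<Rightarrow> int) \<Rightarrow> bool" where
  "symmetrizable a \<longleftrightarrow> (\<exists>d :: 'i \<Rightarrow> int. (\<forall>i. d i > 0) \<and> (\<forall>i j. d i * a i j = d j * a j i))"

text \<open>Laurent polynomials over the rationals in variables \<open>x\<^sub>i\<^sub>j\<close>:
  a monomial is its finitely supported integer exponent vector.\<close>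

type_synonym 'i laurent = "('i \<times> 'i \<Rightarrow>\<^sub>0 int) \<Rightarrow>\<^sub>0 rat"

definition laurent_eval :: "('i \<Rightarrow> 'i \<Rightarrow> 'k :: field_char_0) \<Rightarrow> 'i laurent \<Rightarrow> 'k" where
  "laurent_eval q p =
     (\<Sum>m \<in> Poly_Mapping.keys p. of_rat (Poly_Mapping.lookup p m) *
        (\<Prod>(i, j) \<in> Poly_Mapping.keys m. q i j powi Poly_Mapping.lookup m (i, j)))"

definition laurent_relations :: "('i \<Rightarrow> 'i \<Rightarrow> int) \<Rightarrow> 'i laurent set" where
  "laurent_relations a =
     {Poly_Mapping.single (Poly_Mapping.single (i, j) 1 + Poly_Mapping.single (j, i) 1) 1
        - Poly_Mapping.single (Poly_Mapping.single (i, i) (a i j)) 1 | i j. True}"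

text \<open>The \<open>q i j\<close> are indeterminates subject to \<open>q i j * q j i = q i i powi a i j\<close>: besides the
  imposed relations there are no algebraic relations over the rationals that could be avoided.
  That is, the kernel of the evaluation of Laurent polynomials at \<open>q\<close> is a minimal prime ideal
  over the ideal generated by the imposed relations.  If that ideal is prime, this says that the
  kernel is equal to it, so that the subfield generated by the \<open>q i j\<close> is the fraction field of the
  Laurent polynomial ring modulo the relations.  The ideal need not be prime: for
  \<open>a i j = a j i = -2\<close> the relations force \<open>(q i i)\<^sup>2 = (q j j)\<^sup>2\<close>, and each of
  \<open>q i i = q j j\<close>, \<open>q i i = - q j j\<close> is allowed.\<close>

definition indeterminates_subject_to_cartan ::
    "('i \<Rightarrow> 'i \<Rightarrow> int) \<Rightarrow> ('i \<Rightarrow> 'i \<Rightarrow> 'k :: field_char_0) \<Rightarrow> bool" where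
  "indeterminates_subject_to_cartan a q \<longleftrightarrow>
     (\<forall>i j. q i j \<noteq> 0) \<and>
     (\<forall>i j. q i j * q j i = q i i powi a i j) \<and>
     (\<forall>P. primeideal P (ring_of_type_algebra :: 'i laurent ring) \<longrightarrow>
          laurent_relations a \<subseteq> P \<longrightarrow>
          P \<subseteq> {p. laurent_eval q p = 0} \<longrightarrow>
          P = {p. laurent_eval q p = 0})"

section \<open>Quantum integers\<close>

definition qint :: "'k :: field \<Rightarrow> nat \<Rightarrow> 'k" where
  "qint v n = (v ^ n - 1) / (v - 1)"

definition qfact :: "'k :: field \<Rightarrow> nat \<Rightarrow> 'k" where
  "qfact v n = (\<Prod>k = 1..n. qint v k)"

definition qbinom :: "'k :: field \<Rightarrow> nat \<Rightarrow> nat \<Rightarrow> 'k" where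
  "qbinom v n k = qfact v n / (qfact v k * qfact v (n - k))"

section \<open>Free algebras\<close>

text \<open>Words form the free monoid, written additively so that \<open>'g word \<Rightarrow>\<^sub>0 'k\<close> carries the
  convolution product of \<open>Poly_Mapping\<close> and thus is the free associative unital algebra over \<open>'k\<close>.
  Likewise \<open>('g word \<times> 'g word) \<Rightarrow>\<^sub>0 'k\<close> is the tensor square of the free algebra, with the
  componentwise product.\<close>

datatype 'g word = Word (letters: "'g list")

instantiation word :: (type) monoid_add
begin

definition zero_word :: "'g word" where
  "zero_word = Word []"

definition plus_word :: "'g word \<Rightarrow> 'g word \<Rightarrow> 'g word" where
  "plus_word u v = Word (letters u @ letters v)"

instance
  by standard (simp_all add: zero_word_def plus_word_def)

end

text \<open>\<open>Om\<close>, \<open>OmI\<close>, \<open>Om'\<close>, \<open>OmI'\<close> stand for \<open>\<omega>\<^sub>i\<close>, its inverse, \<open>\<omega>'\<^sub>i\<close>, and its inverse.\<close>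

datatype 'i gen = E 'i | F 'i | Om 'i | OmI 'i | Om' 'i | OmI' 'i

type_synonym ('i, 'k) free_alg = "'i gen word \<Rightarrow>\<^sub>0 'k"

type_synonym ('i, 'k) free_alg2 = "('i gen word \<times> 'i gen word) \<Rightarrow>\<^sub>0 'k"

definition fgen :: "'i gen \<Rightarrow> ('i, 'k :: field) free_alg" where
  "fgen g = Poly_Mapping.single (Word [g]) 1"

definition fconst :: "'k :: field \<Rightarrow> ('i, 'k) free_alg" where
  "fconst c = Poly_Mapping.single 0 c"

definition ftensor ::
    "('i, 'k :: field) free_alg \<Rightarrow> ('i, 'k) free_alg \<Rightarrow> ('i, 'k) free_alg2" where
  "ftensor p r =
     (\<Sum>u \<in> Poly_Mapping.keys p. \<Sum>v \<in> Poly_Mapping.keys r.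
        Poly_Mapping.single (u, v) (Poly_Mapping.lookup p u * Poly_Mapping.lookup r v))"

section \<open>The multiparameter quantum group\<close>

definition torus_gens :: "'i gen set" where
  "torus_gens = range Om \<union> range OmI \<union> range Om' \<union> range OmI'"

definition serre_coeff ::
    "('i \<Rightarrow> 'i \<Rightarrow> int) \<Rightarrow> ('i \<Rightarrow> 'i \<Rightarrow> 'k :: field) \<Rightarrow> 'i \<Rightarrow> 'i \<Rightarrow> nat \<Rightarrow> 'k" where
  "serre_coeff a q i j k =
     (-1) ^ k * qbinom (q i i) (nat (1 - a i j)) k * q i i ^ (k * (k - 1) div 2) * q i j ^ k"

inductive_set Uq_relations ::
    "('i \<Rightarrow> 'i \<Rightarrow> int) \<Rightarrow> ('i \<Rightarrow> 'i \<Rightarrow> 'k :: field) \<Rightarrow> ('i, 'k) free_alg set"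
  for a :: "'i \<Rightarrow> 'i \<Rightarrow> int" and q :: "'i \<Rightarrow> 'i \<Rightarrow> 'k :: field" where
  torus_comm: "g \<in> torus_gens \<Longrightarrow> h \<in> torus_gens \<Longrightarrow>
    fgen g * fgen h - fgen h * fgen g \<in> Uq_relations a q"
| Om_inv: "fgen (Om i) * fgen (OmI i) - 1 \<in> Uq_relations a q"
| Om'_inv: "fgen (Om' i) * fgen (OmI' i) - 1 \<in> Uq_relations a q"
| Om_E: "fgen (Om i) * fgen (E j) * fgen (OmI i) - fconst (q i j) * fgen (E j)
    \<in> Uq_relations a q"
| Om'_E: "fgen (Om' i) * fgen (E j) * fgen (OmI' i) - fconst (inverse (q j i)) * fgen (E j)
    \<in> Uq_relations a q"
| Om_F: "fgen (Om i) * fgen (F j) * fgen (OmI i) - fconst (inverse (q i j)) * fgen (F j)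
    \<in> Uq_relations a q"
| Om'_F: "fgen (Om' i) * fgen (F j) * fgen (OmI' i) - fconst (q j i) * fgen (F j)
    \<in> Uq_relations a q"
| E_F: "fgen (E i) * fgen (F j) - fgen (F j) * fgen (E i)
      - (if i = j then fconst (q i i / (q i i - 1)) * (fgen (Om i) - fgen (Om' i)) else 0)
    \<in> Uq_relations a q"
| serre_E: "i \<noteq> j \<Longrightarrow>
    (\<Sum>k \<le> nat (1 - a i j). fconst (serre_coeff a q i j k) *
       fgen (E i) ^ (nat (1 - a i j) - k) * fgen (E j) * fgen (E i) ^ k) \<in> Uq_relations a q"
| serre_F: "i \<noteq> j \<Longrightarrow>
    (\<Sum>k \<le> nat (1 - a i j). fconst (serre_coeff a q i j k) *
       fgen (F i) ^ k * fgen (F j) * fgen (F i) ^ (nat (1 - a i j) - k)) \<in> Uq_relations a q"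

text \<open>The two-sided ideal generated in the free ring with coefficients in \<open>'k\<close> is automatically a
  \<open>'k\<close>-subspace, because the coefficients sit in the free ring as central constants.\<close>

definition Uq_ideal ::
    "('i \<Rightarrow> 'i \<Rightarrow> int) \<Rightarrow> ('i \<Rightarrow> 'i \<Rightarrow> 'k :: field) \<Rightarrow> ('i, 'k) free_alg set" where
  "Uq_ideal a q = genideal ring_of_type_algebra (Uq_relations a q)"

definition Uq ::
    "('i \<Rightarrow> 'i \<Rightarrow> int) \<Rightarrow> ('i \<Rightarrow> 'i \<Rightarrow> 'k :: field) \<Rightarrow> ('i, 'k) free_alg set ring" where
  "Uq a q = ring_of_type_algebra Quot Uq_ideal a q"

lemma ring_type_algebra: "ring (ring_of_type_algebra :: 'a :: ring_1 ring)"
proof -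
  have "\<exists>y. y + x = 0" for x :: 'a
    by (rule exI [of _ "- x"]) simp
  then show ?thesis
    unfolding ring_of_type_algebra_def
    by (intro ringI abelian_groupI monoidI) (auto simp: algebra_simps)
qed

lemma Uq_ring: "ring (Uq a q)"
  unfolding Uq_def Uq_ideal_def
  by (intro ideal.quotient_is_ring ring.genideal_ideal ring_type_algebra)
     (simp add: ring_of_type_algebra_def)

definition Uq_class ::
    "('i \<Rightarrow> 'i \<Rightarrow> int) \<Rightarrow> ('i \<Rightarrow> 'i \<Rightarrow> 'k :: field) \<Rightarrow> ('i, 'k) free_alg \<Rightarrow> ('i, 'k) free_alg set" where
  "Uq_class a q p = Uq_ideal a q +>\<^bsub>ring_of_type_algebra\<^esub> p"

definition ugen ::
    "('i \<Rightarrow> 'i \<Rightarrow> int) \<Rightarrow> ('i \<Rightarrow> 'i \<Rightarrow> 'k :: field) \<Rightarrow> 'i gen \<Rightarrow> ('i, 'k) free_alg set" where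
  "ugen a q g = Uq_class a q (fgen g)"

definition uconst ::
    "('i \<Rightarrow> 'i \<Rightarrow> int) \<Rightarrow> ('i \<Rightarrow> 'i \<Rightarrow> 'k :: field) \<Rightarrow> 'k \<Rightarrow> ('i, 'k) free_alg set" where
  "uconst a q c = Uq_class a q (fconst c)"

definition subalgebra_gen ::
    "('i \<Rightarrow> 'i \<Rightarrow> int) \<Rightarrow> ('i \<Rightarrow> 'i \<Rightarrow> 'k :: field) \<Rightarrow> 'i gen set \<Rightarrow> ('i, 'k) free_alg set set" where
  "subalgebra_gen a q G = generate_ring (Uq a q) (range (uconst a q) \<union> ugen a q ` G)"

definition Uq_ge0 ::
    "('i \<Rightarrow> 'i \<Rightarrow> int) \<Rightarrow> ('i \<Rightarrow> 'i \<Rightarrow> 'k :: field) \<Rightarrow> ('i, 'k) free_alg set set" where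
  "Uq_ge0 a q = subalgebra_gen a q (range E \<union> range Om \<union> range OmI)"

definition Uq_le0 ::
    "('i \<Rightarrow> 'i \<Rightarrow> int) \<Rightarrow> ('i \<Rightarrow> 'i \<Rightarrow> 'k :: field) \<Rightarrow> ('i, 'k) free_alg set set" where
  "Uq_le0 a q = subalgebra_gen a q (range F \<union> range Om' \<union> range OmI')"

text \<open>The subalgebra generated by the family \<open>x i\<close> is spanned by the monomials in the \<open>x i\<close>; its
  component of degree \<open>\<beta>\<close> (where \<open>x i\<close> has degree the \<open>i\<close>-th simple root) is spanned by
  those of the finitely many words that contain each letter \<open>i\<close> exactly \<open>\<beta> i\<close> times.\<close>

definition words_of_degree :: "('i \<Rightarrow> nat) \<Rightarrow> 'i list set" where
  "words_of_degree \<beta> = {w. \<forall>i. count_list w i = \<beta> i}"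

definition graded_component ::
    "('i \<Rightarrow> 'i \<Rightarrow> int) \<Rightarrow> ('i \<Rightarrow> 'i \<Rightarrow> 'k :: field) \<Rightarrow> ('i \<Rightarrow> 'i gen) \<Rightarrow> ('i \<Rightarrow> nat)
      \<Rightarrow> ('i, 'k) free_alg set set" where
  "graded_component a q x \<beta> =
     {(\<Oplus>\<^bsub>Uq a q\<^esub>w \<in> words_of_degree \<beta>.
         uconst a q (c w) \<otimes>\<^bsub>Uq a q\<^esub>
         foldr (\<lambda>i u. ugen a q (x i) \<otimes>\<^bsub>Uq a q\<^esub> u) w \<one>\<^bsub>Uq a q\<^esub>) | c :: 'i list \<Rightarrow> 'k. True}"

text \<open>The components \<open>(U\<^sup>+)\<^sub>\<beta>\<close> and \<open>(U\<^sup>-)\<^sub>-\<^sub>\<beta>\<close>.\<close>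

definition Uq_plus ::
    "('i \<Rightarrow> 'i \<Rightarrow> int) \<Rightarrow> ('i \<Rightarrow> 'i \<Rightarrow> 'k :: field) \<Rightarrow> ('i \<Rightarrow> nat) \<Rightarrow> ('i, 'k) free_alg set set" where
  "Uq_plus a q \<beta> = graded_component a q E \<beta>"

definition Uq_minus ::
    "('i \<Rightarrow> 'i \<Rightarrow> int) \<Rightarrow> ('i \<Rightarrow> 'i \<Rightarrow> 'k :: field) \<Rightarrow> ('i \<Rightarrow> nat) \<Rightarrow> ('i, 'k) free_alg set set" where
  "Uq_minus a q \<beta> = graded_component a q F \<beta>"

section \<open>The comultiplication\<close>

text \<open>If \<open>U\<close> is the quotient of the free algebra \<open>A\<close> by \<open>J\<close>, the tensor square of \<open>U\<close> is the
  quotient of the tensor square of \<open>A\<close> by \<open>J \<otimes> A + A \<otimes> J\<close>.\<close>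

definition Uq2_ideal ::
    "('i \<Rightarrow> 'i \<Rightarrow> int) \<Rightarrow> ('i \<Rightarrow> 'i \<Rightarrow> 'k :: field) \<Rightarrow> ('i, 'k) free_alg2 set" where
  "Uq2_ideal a q = genideal ring_of_type_algebra
     {ftensor p r | p r. p \<in> Uq_ideal a q \<or> r \<in> Uq_ideal a q}"

definition Uq2 ::
    "('i \<Rightarrow> 'i \<Rightarrow> int) \<Rightarrow> ('i \<Rightarrow> 'i \<Rightarrow> 'k :: field) \<Rightarrow> ('i, 'k) free_alg2 set ring" where
  "Uq2 a q = ring_of_type_algebra Quot Uq2_ideal a q"

lemma Uq2_ring: "ring (Uq2 a q)"
  unfolding Uq2_def Uq2_ideal_def
  by (intro ideal.quotient_is_ring ring.genideal_ideal ring_type_algebra)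
     (simp add: ring_of_type_algebra_def)

text \<open>The union runs over all representatives and, as in \<^const>\<open>rcoset_mult\<close>, all cosets
  occurring in it are equal.\<close>

definition utensor ::
    "('i \<Rightarrow> 'i \<Rightarrow> int) \<Rightarrow> ('i \<Rightarrow> 'i \<Rightarrow> 'k :: field) \<Rightarrow>
     ('i, 'k) free_alg set \<Rightarrow> ('i, 'k) free_alg set \<Rightarrow> ('i, 'k) free_alg2 set" where
  "utensor a q u v =
     (\<Union>p\<in>u. \<Union>r\<in>v. Uq2_ideal a q +>\<^bsub>ring_of_type_algebra\<^esub> ftensor p r)"

text \<open>The comultiplication is the unique homomorphism of unital algebras with the prescribed
  values on generators.\<close>

definition is_comultiplication ::
    "('i \<Rightarrow> 'i \<Rightarrow> int) \<Rightarrow> ('i \<Rightarrow> 'i \<Rightarrow> 'k :: field) \<Rightarrow>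
     (('i, 'k) free_alg set \<Rightarrow> ('i, 'k) free_alg2 set) \<Rightarrow> bool" where
  "is_comultiplication a q \<Delta> \<longleftrightarrow>
     \<Delta> \<in> ring_hom (Uq a q) (Uq2 a q) \<and>
     (\<forall>c. \<Delta> (uconst a q c) = utensor a q (uconst a q c) \<one>\<^bsub>Uq a q\<^esub>) \<and>
     (\<forall>g \<in> torus_gens. \<Delta> (ugen a q g) = utensor a q (ugen a q g) (ugen a q g)) \<and>
     (\<forall>i. \<Delta> (ugen a q (E i)) =
        utensor a q (ugen a q (E i)) \<one>\<^bsub>Uq a q\<^esub>
        \<oplus>\<^bsub>Uq2 a q\<^esub> utensor a q (ugen a q (Om i)) (ugen a q (E i))) \<and>
     (\<forall>i. \<Delta> (ugen a q (F i)) =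
        utensor a q \<one>\<^bsub>Uq a q\<^esub> (ugen a q (F i))
        \<oplus>\<^bsub>Uq2 a q\<^esub> utensor a q (ugen a q (F i)) (ugen a q (Om' i)))"

section \<open>The pairing\<close>

text \<open>\<open>torus_monomial a q Om \<mu>\<close> and \<open>torus_monomial a q Om' \<mu>\<close> are \<open>\<omega>\<^sub>\<mu>\<close> and \<open>\<omega>'\<^sub>\<mu>\<close>.  The carrier is
  cut down to the commutative subalgebra generated by the torus generators because \<^const>\<open>finprod\<close>
  is only meaningful in commutative monoids.\<close>

definition torus_monomial ::
    "('i \<Rightarrow> 'i \<Rightarrow> int) \<Rightarrow> ('i \<Rightarrow> 'i \<Rightarrow> 'k :: field) \<Rightarrow> ('i \<Rightarrow> 'i gen) \<Rightarrow> ('i \<Rightarrow> int)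
      \<Rightarrow> ('i, 'k) free_alg set" where
  "torus_monomial a q x \<mu> =
     finprod (Uq a q \<lparr> carrier := subalgebra_gen a q torus_gens \<rparr>)
       (\<lambda>i. ugen a q (x i) [^]\<^bsub>Uq a q\<^esub> \<mu> i) UNIV"

definition qbichar ::
    "('i :: finite \<Rightarrow> 'i \<Rightarrow> 'k :: field) \<Rightarrow> ('i \<Rightarrow> int) \<Rightarrow> ('i \<Rightarrow> int) \<Rightarrow> 'k" where
  "qbichar q \<mu> \<nu> = (\<Prod>i\<in>UNIV. \<Prod>j\<in>UNIV. q i j powi (\<mu> i * \<nu> j))"

text \<open>The two Hopf conditions evaluate the pairing of tensor squares on an arbitrary finite
  decomposition of \<open>\<Delta> y\<close> (resp. \<open>\<Delta> x\<close>) into pure tensors from \<^const>\<open>Uq_le0\<close>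
  (resp. \<^const>\<open>Uq_ge0\<close>).  Only the values of \<open>B\<close> on \<open>Uq_le0 a q \<times> Uq_ge0 a q\<close> are constrained.\<close>

definition is_hopf_pairing ::
    "('i :: finite \<Rightarrow> 'i \<Rightarrow> int) \<Rightarrow> ('i \<Rightarrow> 'i \<Rightarrow> 'k :: field) \<Rightarrow>
     (('i, 'k) free_alg set \<Rightarrow> ('i, 'k) free_alg2 set) \<Rightarrow>
     (('i, 'k) free_alg set \<Rightarrow> ('i, 'k) free_alg set \<Rightarrow> 'k) \<Rightarrow> bool" where
  "is_hopf_pairing a q \<Delta> B \<longleftrightarrow>
     (\<forall>y\<in>Uq_le0 a q. \<forall>y'\<in>Uq_le0 a q. \<forall>x\<in>Uq_ge0 a q.
        B (y \<oplus>\<^bsub>Uq a q\<^esub> y') x = B y x + B y' x) \<and>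
     (\<forall>y\<in>Uq_le0 a q. \<forall>x\<in>Uq_ge0 a q. \<forall>x'\<in>Uq_ge0 a q.
        B y (x \<oplus>\<^bsub>Uq a q\<^esub> x') = B y x + B y x') \<and>
     (\<forall>c. \<forall>y\<in>Uq_le0 a q. \<forall>x\<in>Uq_ge0 a q. B (uconst a q c \<otimes>\<^bsub>Uq a q\<^esub> y) x = c * B y x) \<and>
     (\<forall>c. \<forall>y\<in>Uq_le0 a q. \<forall>x\<in>Uq_ge0 a q. B y (uconst a q c \<otimes>\<^bsub>Uq a q\<^esub> x) = c * B y x) \<and>
     (\<forall>y\<in>Uq_le0 a q. \<forall>x\<in>Uq_ge0 a q. \<forall>x'\<in>Uq_ge0 a q. \<forall>n::nat. \<forall>u v.
        (\<forall>k<n. u k \<in> Uq_le0 a q \<and> v k \<in> Uq_le0 a q) \<longrightarrow>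
        \<Delta> y = (\<Oplus>\<^bsub>Uq2 a q\<^esub>k\<in>{..<n}. utensor a q (u k) (v k)) \<longrightarrow>
        B y (x \<otimes>\<^bsub>Uq a q\<^esub> x') = (\<Sum>k<n. B (u k) x' * B (v k) x)) \<and>
     (\<forall>y\<in>Uq_le0 a q. \<forall>y'\<in>Uq_le0 a q. \<forall>x\<in>Uq_ge0 a q. \<forall>n::nat. \<forall>u v.
        (\<forall>k<n. u k \<in> Uq_ge0 a q \<and> v k \<in> Uq_ge0 a q) \<longrightarrow>
        \<Delta> x = (\<Oplus>\<^bsub>Uq2 a q\<^esub>k\<in>{..<n}. utensor a q (u k) (v k)) \<longrightarrow>
        B (y \<otimes>\<^bsub>Uq a q\<^esub> y') x = (\<Sum>k<n. B y (u k) * B y' (v k))) \<and>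
     (\<forall>i j. B (ugen a q (F i)) (ugen a q (E j)) = (if i = j then q i i / (1 - q i i) else 0)) \<and>
     (\<forall>\<mu> \<nu>. B (torus_monomial a q Om' \<mu>) (torus_monomial a q Om \<nu>) = qbichar q \<nu> \<mu>) \<and>
     (\<forall>\<mu> i. B (torus_monomial a q Om' \<mu>) (ugen a q (E i)) = 0) \<and>
     (\<forall>\<mu> i. B (ugen a q (F i)) (torus_monomial a q Om \<mu>) = 0)"

definition nondegenerate_on ::
    "('y, 'b) ring_scheme \<Rightarrow> ('y \<Rightarrow> 'y \<Rightarrow> 'k :: zero) \<Rightarrow> 'y set \<Rightarrow> 'y set \<Rightarrow> bool" where
  "nondegenerate_on R B V W \<longleftrightarrow>
     (\<forall>v\<in>V. (\<forall>w\<in>W. B v w = 0) \<longrightarrow> v = \<zero>\<^bsub>R\<^esub>) \<and>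
     (\<forall>w\<in>W. (\<forall>v\<in>V. B v w = 0) \<longrightarrow> w = \<zero>\<^bsub>R\<^esub>)"

end

theory Submission
  imports Defs
begin

text \<open>Let \<open>x\<close> be a nonzero homogeneous element of minimal height in the radical of the pairing,
  of degree \<open>\<beta>\<close>.  It is primitive in the braided Hopf algebra defined by the Serre relations, so the
  braided antipode maps \<open>x\<close> to \<open>- x\<close>.  The square of the antipode acts on degree \<open>\<beta>\<close> by the
  full twist, which is the scalar \<open>\<Prod>\<^sub>k\<^sub>\<noteq>\<^sub>l q\<^sub>i\<^sub>k\<^sub>i\<^sub>l\<close> over pairs of positions in a word
  of degree \<open>\<beta>\<close>; hence this scalar is \<open>1\<close>.  On the other hand, \<open>x\<close> is a lowest weight vector on
  which each \<open>e\<^sub>i\<close> acts nilpotently by the braided adjoint action, so \<open>n\<^sub>i = \<Sum>\<^sub>j a\<^sub>i\<^sub>j \<beta>\<^sub>j \<le> 0\<close>.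
  Squaring the full twist and using \<open>q\<^sub>i\<^sub>j q\<^sub>j\<^sub>i = q\<^sub>i\<^sub>i\<^bsup>a\<^sub>i\<^sub>j\<^esup>\<close>
  gives \<open>\<Prod>\<^sub>i q\<^sub>i\<^sub>i\<^bsup>\<beta>\<^sub>i (2 - n\<^sub>i)\<^esup> = 1\<close> with nonnegative exponents that are not all zero.
  The support of \<open>\<beta>\<close> is connected, and along a connected component all \<open>q\<^sub>i\<^sub>i\<close> are, up to
  roots of unity, positive powers of one element, so some \<open>q\<^sub>i\<^sub>i\<close> would be a root of unity.
  Transposing \<open>q\<close> exchanges the two sides of the pairing.\<close>

section \<open>Free algebras\<close>

text \<open>All computations take place in the free algebra on the letters, where membership in an
  ideal replaces equations in a quotient; the quantum group enters only once the pairing of two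
  words has been identified with an iterated skew derivative. Two obstacles shape the argument. The
  adjoint action of a letter is not nilpotent on that letter itself: \<open>ad i (mon [i])\<close>
  is \<open>1 - q i i\<close> times its square. So an element is split into a part built from the
  strings \<open>(ad i ^^ m) (mon [j])\<close>, with j different from i, and a right multiple of the
  letter i. A right skew derivation kills the first part, and this shows that a radical element of
  minimal degree is congruent to its first part. Moreover, that no \<open>q i i\<close> is a root of
  unity does not prevent a product of powers of several of them from being 1. The contradiction
  needs one common base, which a connected support provides; a disconnected support is excluded by
  commuting the letters of its two pieces past each other.\<close>

definition cst :: "'k :: field \<Rightarrow> 'g word \<Rightarrow>\<^sub>0 'k" where
  "cst c = Poly_Mapping.single 0 c"

definition mon :: "'g list \<Rightarrow> 'g word \<Rightarrow>\<^sub>0 'k :: field" where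
  "mon w = Poly_Mapping.single (Word w) 1"

definition lift :: "('i list \<Rightarrow> 'g word \<Rightarrow>\<^sub>0 'k) \<Rightarrow> ('i word \<Rightarrow>\<^sub>0 'k :: field) \<Rightarrow> 'g word \<Rightarrow>\<^sub>0 'k" where
  "lift f p = (\<Sum>w\<in>Poly_Mapping.keys p. cst (Poly_Mapping.lookup p w) * f (letters w))"

text \<open>Scalars act through the central constants \<open>cst c\<close>, so linearity is stated
  inside the ring.\<close>

definition lin :: "(('i word \<Rightarrow>\<^sub>0 'k) \<Rightarrow> 'g word \<Rightarrow>\<^sub>0 'k :: field) \<Rightarrow> bool" where
  "lin A \<longleftrightarrow> (\<forall>p r. A (p + r) = A p + A r) \<and> (\<forall>c p. A (cst c * p) = cst c * A p)"

lemma letters_0 [simp]: "letters 0 = []"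
  by (simp add: zero_word_def)

lemma cst_0 [simp]: "cst 0 = 0"
  and cst_1 [simp]: "cst 1 = 1"
  and cst_add: "cst (c + d) = cst c + cst d"
  and cst_diff: "cst (c - d) = cst c - cst d"
  and cst_uminus: "cst (- c) = - cst c"
  and cst_mult: "cst (c * d) = cst c * cst d"
  by (simp_all add: cst_def single_add single_diff single_uminus mult_single)

lemma lookup_cst_mult [simp]: "Poly_Mapping.lookup (cst c * p) w = c * Poly_Mapping.lookup p w"
  unfolding cst_def mult_map_scale_conv_mult [symmetric]
  by transfer (simp add: when_def)

lemma lookup_cst: "Poly_Mapping.lookup (cst c) w = (if w = 0 then c else 0)"
  by (simp add: cst_def lookup_single when_def)

lemma lookup_mult_cst: "Poly_Mapping.lookup (p * cst c) w = c * Poly_Mapping.lookup p w"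
proof (induction p rule: update_induct)
  case const
  then show ?case by simp
next
  case (update p w' b)
  have "Poly_Mapping.update w' b p = p + Poly_Mapping.single w' b"
    using update(1) by (intro poly_mapping_eqI)
      (auto simp: lookup_add lookup_update lookup_single in_keys_iff)
  then show ?case
    using update by (simp add: distrib_right lookup_add cst_def mult_single lookup_single
        algebra_simps when_def)
qed

lemma cst_commute: "p * cst c = cst c * p"
  by (rule poly_mapping_eqI) (simp add: lookup_mult_cst)

lemma cst_left_commute: "p * (cst c * r) = cst c * (p * r)"
  by (metis cst_commute mult.assoc)

lemma cst_cst_mult: "cst c * (cst d * p) = cst (c * d) * p"
  by (simp add: cst_mult mult.assoc)

lemma mon_Nil [simp]: "mon [] = 1"
  by (simp add: mon_def zero_word_def [symmetric])

lemma mon_append: "mon (u @ v) = mon u * mon v"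
  by (simp add: mon_def mult_single plus_word_def)

lemma mon_Cons: "mon (i # v) = mon [i] * mon v"
  using mon_append [of "[i]" v] by simp

lemmas cst_simps = mult.assoc cst_cst_mult cst_left_commute [of "mon w" for w]
  cst_commute [of "mon w" for w]

lemma lookup_mon: "Poly_Mapping.lookup (mon w) u = (if letters u = w then 1 else 0)"
  by (cases u) (auto simp: mon_def lookup_single)

lemma keys_mon [simp]: "Poly_Mapping.keys (mon w :: 'g word \<Rightarrow>\<^sub>0 'k :: field) = {Word w}"
  by (simp add: mon_def)

lemma linD: "lin A \<Longrightarrow> A (p + r) = A p + A r" "lin A \<Longrightarrow> A (cst c * p) = cst c * A p"
  by (simp_all add: lin_def)

lemma lin_0: "lin A \<Longrightarrow> A 0 = 0"
  using linD(2) [of A 0 0] by simp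

lemma lin_uminus: "lin A \<Longrightarrow> A (- p) = - A p"
  using linD(2) [of A "- 1" p] by (simp add: cst_uminus)

lemma lin_diff: "lin A \<Longrightarrow> A (p - r) = A p - A r"
  using linD(1) [of A p "- r"] by (simp add: lin_uminus)

lemma lin_sum: "lin A \<Longrightarrow> A (\<Sum>u\<in>U. f u) = (\<Sum>u\<in>U. A (f u))"
  by (induction U rule: infinite_finite_induct) (simp_all add: lin_0 linD)

lemma lift_superset:
  assumes "finite W" "Poly_Mapping.keys p \<subseteq> W"
  shows "lift f p = (\<Sum>w\<in>W. cst (Poly_Mapping.lookup p w) * f (letters w))"
  unfolding lift_def
  by (rule sum.mono_neutral_left) (use assms in \<open>auto simp: in_keys_iff\<close>)

lemma lin_lift [simp]: "lin (lift f)"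
  unfolding lin_def
proof (intro conjI allI)
  fix p r :: "'a word \<Rightarrow>\<^sub>0 'b"
  let ?W = "Poly_Mapping.keys p \<union> Poly_Mapping.keys r"
  have "lift f (p + r) = (\<Sum>w\<in>?W. cst (Poly_Mapping.lookup (p + r) w) * f (letters w))"
    by (rule lift_superset) (auto simp: keys_add)
  also have "\<dots> = (\<Sum>w\<in>?W. cst (Poly_Mapping.lookup p w) * f (letters w))
      + (\<Sum>w\<in>?W. cst (Poly_Mapping.lookup r w) * f (letters w))"
    by (simp add: lookup_add cst_add distrib_right sum.distrib)
  also have "\<dots> = lift f p + lift f r"
    by (subst (1 2) lift_superset [where W = ?W]) auto
  finally show "lift f (p + r) = lift f p + lift f r" .
next
  fix c :: 'b and p :: "'a word \<Rightarrow>\<^sub>0 'b"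
  have "lift f (cst c * p) =
      (\<Sum>w\<in>Poly_Mapping.keys p. cst (Poly_Mapping.lookup (cst c * p) w) * f (letters w))"
    by (rule lift_superset) (auto simp: in_keys_iff)
  then show "lift f (cst c * p) = cst c * lift f p"
    by (simp add: lift_def sum_distrib_left cst_cst_mult)
qed

lemma lift_mon [simp]: "lift f (mon w) = f w"
  by (simp add: lift_def lookup_mon)

lemma lift_1 [simp]: "lift f 1 = f []"
  using lift_mon [of f "[]"] by simp

lemma lift_mon_self: "lift mon p = p"
proof (rule poly_mapping_eqI)
  fix u :: "'a word"
  have "Poly_Mapping.lookup (lift mon p) u = (\<Sum>w\<in>Poly_Mapping.keys p.
      if w = u then Poly_Mapping.lookup p u else 0)"
    unfolding lift_def lookup_sum by (intro sum.cong) (auto simp: lookup_mon dest: word.expand)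
  also have "\<dots> = Poly_Mapping.lookup p u"
    by (simp add: in_keys_iff)
  finally show "Poly_Mapping.lookup (lift mon p) u = Poly_Mapping.lookup p u" .
qed

lemma lin_eq_lift: "lin A \<Longrightarrow> A p = lift (\<lambda>w. A (mon w)) p"
  by (subst lift_mon_self [of p, symmetric]) (simp add: lift_def lin_sum linD)

text \<open>Words form a basis. Most operator identities below combine this rule with an induction
  over words.\<close>

lemma lin_eqI:
  assumes "lin A" "lin A'" "\<And>w. A (mon w) = A' (mon w)"
  shows "A p = A' p"
  by (subst (1 2) lin_eq_lift) (simp_all add: assms)

lemma lin_intros [simp, intro]:
  "lin (\<lambda>p. p)" "lin (\<lambda>p. 0)"
  "lin A \<Longrightarrow> lin A' \<Longrightarrow> lin (\<lambda>p. A p + A' p)"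
  "lin A \<Longrightarrow> lin A' \<Longrightarrow> lin (\<lambda>p. A p - A' p)"
  "lin A \<Longrightarrow> lin (\<lambda>p. - A p)"
  "lin A \<Longrightarrow> lin (\<lambda>p. u * A p)"
  "lin A \<Longrightarrow> lin (\<lambda>p. A p * u)"
  "lin A \<Longrightarrow> lin (\<lambda>p. lift f (A p))"
  "lin A \<Longrightarrow> lin A' \<Longrightarrow> lin (\<lambda>p. if b then A p else A' p)"
  by (auto simp: lin_def distrib_left distrib_right cst_left_commute mult.assoc
      linD(1) [OF lin_lift] linD(2) [OF lin_lift] algebra_simps)

lemma lin_sum_fun: "(\<And>x. x \<in> U \<Longrightarrow> lin (f x)) \<Longrightarrow> lin (\<lambda>p. \<Sum>x\<in>U. f x p)"
  by (induction U rule: infinite_finite_induct) auto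

lemma lin_comp: "lin A' \<Longrightarrow> lin A \<Longrightarrow> lin (\<lambda>p. A' (A p))"
  by (simp add: lin_def)

lemma lin_funpow: "lin A \<Longrightarrow> lin (A ^^ n)"
  for A :: "('i word \<Rightarrow>\<^sub>0 'k) \<Rightarrow> 'i word \<Rightarrow>\<^sub>0 'k :: field"
  by (induction n) (auto simp: lin_def)

section \<open>Homogeneous elements\<close>

text \<open>A degree in Q+ is encoded as a multiset of letters; zero is homogeneous of every
  degree.\<close>

definition homog :: "'i multiset \<Rightarrow> ('i word \<Rightarrow>\<^sub>0 'k :: field) \<Rightarrow> bool" where
  "homog M p \<longleftrightarrow> (\<forall>w\<in>Poly_Mapping.keys p. mset (letters w) = M)"

lemma homog_0 [simp]: "homog M 0"
  by (simp add: homog_def)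

lemma homog_add: "homog M p \<Longrightarrow> homog M r \<Longrightarrow> homog M (p + r)"
  unfolding homog_def using keys_add by fastforce

lemma homog_cst_mult: "homog M p \<Longrightarrow> homog M (cst c * p)"
  by (auto simp: homog_def in_keys_iff)

lemma homog_uminus: "homog M p \<Longrightarrow> homog M (- p)"
  using homog_cst_mult [of M p "- 1"] by (simp add: cst_uminus)

lemma homog_diff: "homog M p \<Longrightarrow> homog M r \<Longrightarrow> homog M (p - r)"
  using homog_add [of M p "- r"] homog_uminus by fastforce

lemma homog_sum: "(\<And>x. x \<in> U \<Longrightarrow> homog M (f x)) \<Longrightarrow> homog M (\<Sum>x\<in>U. f x)"
  by (induction U rule: infinite_finite_induct) (auto intro: homog_add)

lemma homog_mon [simp]: "homog M (mon w) \<longleftrightarrow> mset w = M"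
  by (simp add: homog_def)

lemma homog_induct [consumes 1, case_names zero mon add]:
  assumes "homog M p" "P 0" "\<And>c w. mset w = M \<Longrightarrow> P (cst c * mon w)"
    "\<And>p r. homog M p \<Longrightarrow> homog M r \<Longrightarrow> P p \<Longrightarrow> P r \<Longrightarrow> P (p + r)"
  shows "P p"
proof -
  have "P (\<Sum>w\<in>W. cst (Poly_Mapping.lookup p w) * mon (letters w))
      \<and> homog M (\<Sum>w\<in>W. cst (Poly_Mapping.lookup p w) * mon (letters w))"
    if "finite W" "W \<subseteq> Poly_Mapping.keys p" for W
    using that
  proof (induction W rule: finite_induct)
    case empty
    then show ?case using assms(2) by simp
  next
    case (insert w W)
    then have "mset (letters w) = M"
      using assms(1) by (auto simp: homog_def)
    moreover from this have "homog M (cst (Poly_Mapping.lookup p w) * mon (letters w))"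
      by (simp add: homog_cst_mult)
    ultimately show ?case
      using insert by (auto simp: homog_add assms(3) assms(4))
  qed
  from this [of "Poly_Mapping.keys p"] show ?thesis
    using lift_mon_self [of p] by (simp add: lift_def)
qed

lemma falg_induct [case_names mon add]:
  assumes "\<And>c w. P (cst c * mon w)" "\<And>p r. P p \<Longrightarrow> P r \<Longrightarrow> P (p + r)"
  shows "P p"
proof -
  have P0: "P 0" using assms(1) [of 0] by simp
  have "P (\<Sum>w\<in>W. cst (Poly_Mapping.lookup p w) * mon (letters w))" if "finite W" for W
    using that by (induction W rule: finite_induct) (auto simp: assms P0)
  from this [of "Poly_Mapping.keys p"] show ?thesis
    using lift_mon_self [of p] by (simp add: lift_def)
qed

lemma homog_lin:
  assumes "homog M p" "lin A" "\<And>w. mset w = M \<Longrightarrow> homog N (A (mon w))"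
  shows "homog N (A p)"
  using assms(1)
  by (induction rule: homog_induct) (auto simp: assms lin_0 linD homog_cst_mult homog_add)

lemma homog_lin_eqI:
  assumes "homog M p" "lin A" "lin A'" "\<And>w. mset w = M \<Longrightarrow> A (mon w) = A' (mon w)"
  shows "A p = A' p"
  using assms(1) by (induction rule: homog_induct) (auto simp: assms lin_0 linD)

lemma homog_mult:
  assumes "homog M p" "homog N r"
  shows "homog (M + N) (p * r)"
proof (rule homog_lin [OF assms(1), of "\<lambda>p. p * r"])
  fix w :: "'a list" assume w: "mset w = M"
  show "homog (M + N) (mon w * r)"
    by (rule homog_lin [OF assms(2)]) (simp_all flip: mon_append add: w)
qed simp

lemma homog_1 [simp]: "homog M 1 \<longleftrightarrow> M = {#}"
  using homog_mon [of M "[]"] by simp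

lemma homog_empty: "homog {#} p \<Longrightarrow> p = cst (Poly_Mapping.lookup p 0)"
proof (induction p rule: homog_induct)
  case (mon c w)
  then show ?case by (simp add: lookup_cst)
qed (simp_all add: lookup_add cst_add)

definition eps :: "('i word \<Rightarrow>\<^sub>0 'k :: field) \<Rightarrow> 'k" where
  "eps p = Poly_Mapping.lookup p 0"

lemma eps_simps [simp]:
  "eps 0 = 0" "eps 1 = 1" "eps (p + r) = eps p + eps r" "eps (p - r) = eps p - eps r"
  "eps (- p) = - eps p" "eps (cst c) = c" "eps (cst c * p) = c * eps p"
  "eps (mon w) = (if w = [] then 1 else 0)"
  by (auto simp: eps_def lookup_add lookup_minus lookup_mon lookup_cst lookup_one)

lemma eps_sum: "eps (\<Sum>x\<in>U. f x) = (\<Sum>x\<in>U. eps (f x))"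
  by (simp add: eps_def lookup_sum)

lemma eps_homog: "homog M p \<Longrightarrow> M \<noteq> {#} \<Longrightarrow> eps p = 0"
  by (metis eps_def homog_def in_keys_iff letters_0 mset.simps(1))

lemma cst_eps: "homog {#} p \<Longrightarrow> p = cst (eps p)"
  using homog_empty by (auto simp: eps_def)

lemma lin_cst_eps [simp]: "lin A \<Longrightarrow> lin (\<lambda>p. cst (eps (A p)))"
  by (auto simp: lin_def cst_add cst_mult)

lemma eps_mult [simp]: "eps (p * r) = eps p * eps r"
proof -
  have "cst (eps (p * r)) = cst (eps p) * cst (eps r)"
  proof (rule lin_eqI [of "\<lambda>p. cst (eps (p * r))"])
    fix w
    show "cst (eps (mon w * r)) = cst (eps (mon w)) * cst (eps r)"
      by (rule lin_eqI [of "\<lambda>r. cst (eps (mon w * r))"]) (simp_all flip: mon_append)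
  qed simp_all
  then show ?thesis
    by (metis cst_mult eps_simps(6))
qed

section \<open>Skew derivations\<close>

locale braiding =
  fixes q :: "'i \<Rightarrow> 'i \<Rightarrow> 'k :: field"
begin

text \<open>The bicharacter extending \<open>q\<close>, taken at the pair (\<alpha>_i, M) and, for
  \<open>chr\<close>, at (M, \<alpha>_i).\<close>

definition chi :: "'i \<Rightarrow> 'i multiset \<Rightarrow> 'k" where
  "chi i M = (\<Prod>j\<in>#M. q i j)"

definition chr :: "'i multiset \<Rightarrow> 'i \<Rightarrow> 'k" where
  "chr M i = (\<Prod>j\<in>#M. q j i)"

lemma chi_simps [simp]:
  "chi i {#} = 1" "chi i (add_mset j M) = q i j * chi i M" "chi i (M + N) = chi i M * chi i N"
  by (simp_all add: chi_def)

lemma chr_simps [simp]: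
  "chr {#} i = 1" "chr (add_mset j M) i = q j i * chr M i" "chr (M + N) i = chr M i * chr N i"
  by (simp_all add: chr_def)

definition sigma :: "'i \<Rightarrow> ('i word \<Rightarrow>\<^sub>0 'k) \<Rightarrow> 'i word \<Rightarrow>\<^sub>0 'k" where
  "sigma i = lift (\<lambda>w. cst (chi i (mset w)) * mon w)"

definition tau :: "'i \<Rightarrow> ('i word \<Rightarrow>\<^sub>0 'k) \<Rightarrow> 'i word \<Rightarrow>\<^sub>0 'k" where
  "tau i = lift (\<lambda>w. cst (chr (mset w) i) * mon w)"

text \<open>An occurrence of \<open>i\<close> is moved to the front and removed; each letter
  \<open>j\<close> that it passes costs \<open>q j i\<close>. Under the pairing this is adjoint to
  left multiplication by f_i, up to a scalar.\<close>

primrec DLw :: "'i \<Rightarrow> 'i list \<Rightarrow> 'i word \<Rightarrow>\<^sub>0 'k" where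
  "DLw i [] = 0"
| "DLw i (j # w) = (if i = j then mon w else 0) + cst (q j i) * (mon [j] * DLw i w)"

definition DL :: "'i \<Rightarrow> ('i word \<Rightarrow>\<^sub>0 'k) \<Rightarrow> 'i word \<Rightarrow>\<^sub>0 'k" where
  "DL i = lift (DLw i)"

text \<open>Mirror image of \<open>DLw\<close>: the removed letter leaves at the right end, past the
  letters behind it.\<close>

primrec DRw :: "'i \<Rightarrow> 'i list \<Rightarrow> 'i word \<Rightarrow>\<^sub>0 'k" where
  "DRw i [] = 0"
| "DRw i (j # w) = (if i = j then cst (chi i (mset w)) * mon w else 0) + mon [j] * DRw i w"

definition DR :: "'i \<Rightarrow> ('i word \<Rightarrow>\<^sub>0 'k) \<Rightarrow> 'i word \<Rightarrow>\<^sub>0 'k" where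
  "DR i = lift (DRw i)"

lemma lin_ops [simp]: "lin (sigma i)" "lin (tau i)" "lin (DL i)" "lin (DR i)"
  by (simp_all add: sigma_def tau_def DL_def DR_def)

lemma lin_ops_intros [simp, intro]:
  "lin A \<Longrightarrow> lin (\<lambda>p. sigma i (A p))" "lin A \<Longrightarrow> lin (\<lambda>p. tau i (A p))"
  "lin A \<Longrightarrow> lin (\<lambda>p. DL i (A p))" "lin A \<Longrightarrow> lin (\<lambda>p. DR i (A p))"
  by (rule lin_comp; simp)+

lemmas ops_linear [simp] =
  linD [OF lin_ops(1)] linD [OF lin_ops(2)] linD [OF lin_ops(3)] linD [OF lin_ops(4)]
  lin_0 [OF lin_ops(1)] lin_0 [OF lin_ops(2)] lin_0 [OF lin_ops(3)] lin_0 [OF lin_ops(4)]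
  lin_diff [OF lin_ops(1)] lin_diff [OF lin_ops(2)] lin_diff [OF lin_ops(3)] lin_diff [OF lin_ops(4)]
  lin_uminus [OF lin_ops(1)] lin_uminus [OF lin_ops(2)] lin_uminus [OF lin_ops(3)] lin_uminus [OF lin_ops(4)]

lemma ops_1 [simp]: "sigma i 1 = 1" "tau i 1 = 1" "DL i 1 = 0" "DR i 1 = 0"
  by (simp_all add: sigma_def tau_def DL_def DR_def)

lemma ops_cst [simp]: "sigma i (cst c) = cst c" "tau i (cst c) = cst c"
    "DL i (cst c) = 0" "DR i (cst c) = 0"
  using linD(2) [OF lin_ops(1), of i c 1] linD(2) [OF lin_ops(2), of i c 1]
    linD(2) [OF lin_ops(3), of i c 1] linD(2) [OF lin_ops(4), of i c 1] by simp_all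

lemma sigma_mon: "sigma i (mon w) = cst (chi i (mset w)) * mon w"
  and tau_mon: "tau i (mon w) = cst (chr (mset w) i) * mon w"
  and DL_mon: "DL i (mon w) = DLw i w"
  and DR_mon: "DR i (mon w) = DRw i w"
  by (simp_all add: sigma_def tau_def DL_def DR_def)

lemma ops_letter [simp]:
  "sigma i (mon [j]) = cst (q i j) * mon [j]" "tau i (mon [j]) = cst (q j i) * mon [j]"
  "DL i (mon [j]) = (if i = j then 1 else 0)" "DR i (mon [j]) = (if i = j then 1 else 0)"
  by (simp_all add: sigma_mon tau_mon DL_mon DR_mon)

lemma sigma_homog: "homog M p \<Longrightarrow> sigma i p = cst (chi i M) * p"
  by (rule homog_lin_eqI [of M p "sigma i"]) (auto simp: sigma_mon)

lemma tau_homog: "homog M p \<Longrightarrow> tau i p = cst (chr M i) * p"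
  by (rule homog_lin_eqI [of M p "tau i"]) (auto simp: tau_mon)

lemma sigma_mult: "sigma i (p * r) = sigma i p * sigma i r"
proof (rule lin_eqI [of "\<lambda>p. sigma i (p * r)"])
  fix w
  show "sigma i (mon w * r) = sigma i (mon w) * sigma i r"
    by (rule lin_eqI [of "\<lambda>r. sigma i (mon w * r)"])
      (simp_all add: sigma_mon cst_simps flip: mon_append)
qed simp_all

lemma tau_mult: "tau i (p * r) = tau i p * tau i r"
proof (rule lin_eqI [of "\<lambda>p. tau i (p * r)"])
  fix w
  show "tau i (mon w * r) = tau i (mon w) * tau i r"
    by (rule lin_eqI [of "\<lambda>r. tau i (mon w * r)"])
      (simp_all add: tau_mon cst_simps flip: mon_append)
qed simp_all

lemma DL_letter_mult:
  "DL i (mon [j] * p) = (if i = j then p else 0) + cst (q j i) * (mon [j] * DL i p)"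
  by (rule lin_eqI [of "\<lambda>p. DL i (mon [j] * p)"]) (simp_all flip: mon_Cons add: DL_mon)

lemma DR_letter_mult:
  "DR i (mon [j] * p) = mon [j] * DR i p + (if i = j then sigma i p else 0)"
  by (rule lin_eqI [of "\<lambda>p. DR i (mon [j] * p)"])
    (simp_all flip: mon_Cons add: DR_mon sigma_mon)

lemma DL_mult: "DL i (p * r) = DL i p * r + tau i p * DL i r"
proof (rule lin_eqI [of "\<lambda>p. DL i (p * r)"])
  show "DL i (mon w * r) = DL i (mon w) * r + tau i (mon w) * DL i r" for w
  proof (induction w)
    case (Cons j w)
    then show ?case
      by (simp add: mon_Cons [of j w] mult.assoc DL_letter_mult tau_mult distrib_left distrib_right)
  qed simp
qed auto

lemma DR_mult: "DR i (p * r) = p * DR i r + DR i p * sigma i r"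
proof (rule lin_eqI [of "\<lambda>p. DR i (p * r)"])
  show "DR i (mon w * r) = mon w * DR i r + DR i (mon w) * sigma i r" for w
  proof (induction w)
    case (Cons j w)
    then show ?case
      by (simp add: mon_Cons [of j w] mult.assoc DR_letter_mult sigma_mult distrib_left distrib_right)
  qed simp
qed auto

lemma sigma_sigma: "sigma i (sigma j p) = sigma j (sigma i p)"
  by (rule lin_eqI [of "\<lambda>p. sigma i (sigma j p)"]) (auto simp: sigma_mon cst_simps mult_ac)

lemma sigma_tau: "sigma i (tau j p) = tau j (sigma i p)"
  by (rule lin_eqI [of "\<lambda>p. sigma i (tau j p)"])
    (auto simp: sigma_mon tau_mon cst_simps mult_ac)

lemma DL_sigma: "DL i (sigma j p) = cst (q j i) * sigma j (DL i p)"
proof (rule lin_eqI [of "\<lambda>p. DL i (sigma j p)"])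
  show "DL i (sigma j (mon w)) = cst (q j i) * sigma j (DL i (mon w))" for w
  proof (induction w)
    case (Cons k w)
    then show ?case
      by (simp add: mon_Cons [of k w] mult.assoc DL_letter_mult sigma_mult distrib_left
          cst_simps mult_ac)
  qed simp
qed auto

lemma DL_tau: "DL i (tau j p) = cst (q i j) * tau j (DL i p)"
proof (rule lin_eqI [of "\<lambda>p. DL i (tau j p)"])
  show "DL i (tau j (mon w)) = cst (q i j) * tau j (DL i (mon w))" for w
  proof (induction w)
    case (Cons k w)
    then show ?case
      by (simp add: mon_Cons [of k w] mult.assoc DL_letter_mult tau_mult distrib_left
          cst_simps mult_ac)
  qed simp
qed auto

lemma DR_sigma: "DR i (sigma j p) = cst (q j i) * sigma j (DR i p)"
proof (rule lin_eqI [of "\<lambda>p. DR i (sigma j p)"])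
  show "DR i (sigma j (mon w)) = cst (q j i) * sigma j (DR i (mon w))" for w
  proof (induction w)
    case (Cons k w)
    then show ?case
      by (simp add: mon_Cons [of k w] mult.assoc DR_letter_mult sigma_mult distrib_left
          cst_simps mult_ac sigma_sigma)
  qed simp
qed auto

text \<open>Letters are removed at opposite ends, so the order does not matter. This is what makes
  the radical, defined through \<open>DL\<close>, stable under \<open>DR\<close>.\<close>

lemma DL_DR: "DL i (DR j p) = DR j (DL i p)"
proof (rule lin_eqI [of "\<lambda>p. DL i (DR j p)"])
  show "DL i (DR j (mon w)) = DR j (DL i (mon w))" for w
  proof (induction w)
    case (Cons k w)
    then show ?case
      by (simp add: mon_Cons [of k w] mult.assoc DL_letter_mult DR_letter_mult distrib_left
          cst_simps mult_ac DL_sigma)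
  qed simp
qed auto

lemma eps_DR: "eps (DR i p) = eps (DL i p)"
proof -
  have "cst (eps (DR i p)) = cst (eps (DL i p))"
  proof (rule lin_eqI [of "\<lambda>p. cst (eps (DR i p))"])
    show "cst (eps (DR i (mon w))) = cst (eps (DL i (mon w)))" for w
      by (cases w) (simp_all add: DL_mon DR_mon)
  qed auto
  then show ?thesis by (metis eps_simps(6))
qed

lemma DL_eq_0: "i \<notin> set w \<Longrightarrow> DL i (mon w) = 0"
  by (induction w) (auto simp: DL_mon)

lemma DR_eq_0: "i \<notin> set w \<Longrightarrow> DR i (mon w) = 0"
  by (induction w) (auto simp: DR_mon)

lemma DL_homog_eq_0: "homog M p \<Longrightarrow> i \<notin># M \<Longrightarrow> DL i p = 0"
  by (rule homog_lin_eqI [of M p "DL i" "\<lambda>_. 0"]) (auto simp: DL_eq_0)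

lemma homog_DL: "homog (add_mset i M) p \<Longrightarrow> homog M (DL i p)"
proof (erule homog_lin)
  show "homog M (DL i (mon w))" if "mset w = add_mset i M" for w
    using that
  proof (induction w arbitrary: M)
    case (Cons j w)
    show ?case
    proof (cases "i \<in> set w")
      case True
      then obtain N where N: "mset w = add_mset i N"
        by (metis mset_add set_mset_mset)
      then have M: "M = {#j#} + N"
        using Cons.prems by simp
      have "homog M (mon [j] * DL i (mon w))"
        unfolding M by (intro homog_mult Cons.IH N) simp
      then show ?thesis
        using Cons.prems N M
        by (auto simp: mon_Cons [of j w] DL_letter_mult intro!: homog_add homog_cst_mult)
    next
      case False
      then have "i = j"
        using Cons.prems by (metis in_multiset_in_set list.set_intros(1) set_ConsD set_mset_mset
            union_single_eq_member)
      then show ?thesis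
        using Cons.prems False
        by (simp add: mon_Cons [of j w] DL_letter_mult DL_eq_0)
    qed
  qed simp
qed simp

lemma homog_DR: "homog (add_mset i M) p \<Longrightarrow> homog M (DR i p)"
proof (erule homog_lin)
  show "homog M (DR i (mon w))" if "mset w = add_mset i M" for w
    using that
  proof (induction w arbitrary: M)
    case (Cons j w)
    show ?case
    proof (cases "i \<in> set w")
      case True
      then obtain N where N: "mset w = add_mset i N"
        by (metis mset_add set_mset_mset)
      then have M: "M = {#j#} + N"
        using Cons.prems by simp
      have "homog M (mon [j] * DR i (mon w))"
        unfolding M by (intro homog_mult Cons.IH N) simp
      then show ?thesis
        using Cons.prems N M
        by (auto simp: mon_Cons [of j w] DR_letter_mult sigma_mon intro!: homog_add homog_cst_mult)
    next
      case False
      then have "i = j"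
        using Cons.prems by (metis in_multiset_in_set list.set_intros(1) set_ConsD set_mset_mset
            union_single_eq_member)
      then show ?thesis
        using Cons.prems False
        by (simp add: mon_Cons [of j w] DR_letter_mult DR_eq_0 sigma_mon homog_cst_mult)
    qed
  qed simp
qed simp

lemma homog_sigma: "homog M p \<Longrightarrow> homog M (sigma i p)"
  by (simp add: sigma_homog homog_cst_mult)

section \<open>The radical\<close>

primrec DW :: "'i list \<Rightarrow> ('i word \<Rightarrow>\<^sub>0 'k) \<Rightarrow> 'i word \<Rightarrow>\<^sub>0 'k" where
  "DW [] p = p"
| "DW (i # w) p = DW w (DL i p)"

lemma DW_append: "DW (u @ w) p = DW w (DW u p)"
  by (induction u arbitrary: p) auto

lemma lin_DW [simp]: "lin (DW w)"
  by (induction w) (auto simp: lin_def)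

lemma lin_DW_intro [simp, intro]: "lin A \<Longrightarrow> lin (\<lambda>p. DW w (A p))"
  by (rule lin_comp) simp_all

lemmas DW_linear [simp] = linD [OF lin_DW] lin_0 [OF lin_DW] lin_diff [OF lin_DW]
  lin_uminus [OF lin_DW]

lemma homog_DW: "homog (mset w + M) p \<Longrightarrow> homog M (DW w p)"
  by (induction w arbitrary: p) (auto simp: homog_DL)

lemma DW_homog_eq_0: "homog M p \<Longrightarrow> \<not> mset w \<subseteq># M \<Longrightarrow> DW w p = 0"
proof (induction w arbitrary: p M)
  case (Cons i w)
  show ?case
  proof (cases "i \<in># M")
    case True
    then obtain N where N: "M = add_mset i N" by (metis mset_add)
    then show ?thesis
      using Cons.prems by (auto intro!: Cons.IH [of N] homog_DL)
  next
    case False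
    then show ?thesis
      using Cons.prems by (simp add: DL_homog_eq_0)
  qed
qed simp

text \<open>Up to nonzero scalars this is the pairing of f_w with e_v, see
  \<open>pair_words\<close>.\<close>

definition gram :: "'i list \<Rightarrow> 'i list \<Rightarrow> 'k" where
  "gram w v = eps (DW w (mon v))"

lemma gram_eq_0: "mset w \<noteq> mset v \<Longrightarrow> gram w v = 0"
proof (cases "mset w \<subseteq># mset v")
  case True
  assume "mset w \<noteq> mset v"
  moreover obtain N where "mset v = mset w + N"
    using True by (metis subset_mset.le_iff_add)
  ultimately show ?thesis
    unfolding gram_def by (intro eps_homog [of N] homog_DW) auto
qed (simp add: gram_def DW_homog_eq_0)

text \<open>The right kernel of the form \<open>gram\<close>; by \<open>radical_coinduct\<close> it
  is also the largest subset of the kernel of \<open>eps\<close> that is stable under all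
  \<open>DL i\<close>.\<close>

definition radical :: "('i word \<Rightarrow>\<^sub>0 'k) set" where
  "radical = {p. \<forall>w. eps (DW w p) = 0}"

lemma radical_0 [simp]: "0 \<in> radical"
  by (simp add: radical_def)

lemma radical_add: "p \<in> radical \<Longrightarrow> r \<in> radical \<Longrightarrow> p + r \<in> radical"
  by (simp add: radical_def)

lemma radical_diff: "p \<in> radical \<Longrightarrow> r \<in> radical \<Longrightarrow> p - r \<in> radical"
  by (simp add: radical_def)

lemma radical_cst_mult: "p \<in> radical \<Longrightarrow> cst c * p \<in> radical"
  by (simp add: radical_def)

lemma radical_uminus: "p \<in> radical \<Longrightarrow> - p \<in> radical"
  by (simp add: radical_def)

lemma radical_DL: "p \<in> radical \<Longrightarrow> DL i p \<in> radical"
  unfolding radical_def by (auto simp flip: DW.simps(2))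

lemma radical_DW: "p \<in> radical \<Longrightarrow> DW w p \<in> radical"
  by (induction w arbitrary: p) (auto simp: radical_DL)

lemma radical_eps: "p \<in> radical \<Longrightarrow> eps p = 0"
  unfolding radical_def by (metis (mono_tags) DW.simps(1) mem_Collect_eq)

lemma radical_coinduct:
  assumes "p \<in> R" "\<And>p. p \<in> R \<Longrightarrow> eps p = 0" "\<And>p i. p \<in> R \<Longrightarrow> DL i p \<in> R"
  shows "p \<in> radical"
proof -
  have "eps (DW w p) = 0" for w
    using assms(1) by (induction w arbitrary: p) (auto simp: assms(2,3))
  then show ?thesis by (simp add: radical_def)
qed

lemma radical_tau: "p \<in> radical \<Longrightarrow> tau i p \<in> radical"
proof (rule radical_coinduct [of _ "{tau i r | r. r \<in> radical}"])
  have eps_tau: "eps (tau i r) = eps r" for r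
  proof -
    have "cst (eps (tau i r)) = cst (eps r)"
      by (rule lin_eqI [of "\<lambda>r. cst (eps (tau i r))"]) (auto simp: tau_mon)
    then show ?thesis by (metis eps_simps(6))
  qed
  show "eps r = 0" if "r \<in> {tau i r | r. r \<in> radical}" for r
    using that eps_tau radical_eps by auto
  show "DL j r \<in> {tau i r | r. r \<in> radical}" if r: "r \<in> {tau i r | r. r \<in> radical}" for j r
  proof -
    obtain s where "r = tau i s" "s \<in> radical" using r by auto
    then show ?thesis
      by (auto simp: DL_tau radical_cst_mult radical_DL
          intro!: exI [of _ "cst (q j i) * DL j s"])
  qed
qed auto

text \<open>By the product rule, \<open>DL i (mon [j] * s)\<close> is a radical element plus
  \<open>mon [j]\<close> times a radical element. Sums of these two kinds therefore form a set to
  which \<open>radical_coinduct\<close> applies.\<close>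

lemma radical_letter_mult: "p \<in> radical \<Longrightarrow> mon [j] * p \<in> radical"
proof (rule radical_coinduct [of _ "{r + mon [j] * s | r s. r \<in> radical \<and> s \<in> radical}"])
  let ?R = "{r + mon [j] * s | r s. r \<in> radical \<and> s \<in> radical}"
  show "mon [j] * p \<in> ?R" if "p \<in> radical"
    using that by (intro CollectI exI [of _ 0] exI [of _ p]) simp
  show "eps r = 0" if "r \<in> ?R" for r
    using that by (auto simp: radical_eps)
  show "DL i r \<in> ?R" if r: "r \<in> ?R" for i r
  proof -
    obtain s t where "r = s + mon [j] * t" "s \<in> radical" "t \<in> radical" using r by auto
    then show ?thesis
      by (intro CollectI exI [of _ "DL i s + (if i = j then t else 0)"]
          exI [of _ "cst (q j i) * DL i t"])
        (auto simp: DL_letter_mult radical_add radical_cst_mult radical_DL cst_simps mult_ac)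
  qed
qed

text \<open>As for left multiples, except that the product rule now produces \<open>tau i t\<close>;
  hence \<open>radical_tau\<close> is needed.\<close>

lemma radical_mult_letter: "p \<in> radical \<Longrightarrow> p * mon [j] \<in> radical"
proof (rule radical_coinduct [of _ "{r + s * mon [j] | r s. r \<in> radical \<and> s \<in> radical}"])
  let ?R = "{r + s * mon [j] | r s. r \<in> radical \<and> s \<in> radical}"
  show "p * mon [j] \<in> ?R" if "p \<in> radical"
    using that by (intro CollectI exI [of _ 0] exI [of _ p]) simp
  show "eps r = 0" if "r \<in> ?R" for r
    using that by (auto simp: radical_eps)
  show "DL i r \<in> ?R" if r: "r \<in> ?R" for i r
  proof -
    obtain s t where "r = s + t * mon [j]" "s \<in> radical" "t \<in> radical" using r by auto
    then show ?thesis
      by (intro CollectI exI [of _ "DL i s + (if i = j then tau i t else 0)"]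
          exI [of _ "DL i t"])
        (auto simp: DL_mult radical_add radical_tau radical_DL)
  qed
qed

lemma radical_mult_left: "p \<in> radical \<Longrightarrow> u * p \<in> radical"
proof (induction u rule: falg_induct)
  case (mon c w)
  have "mon w * p \<in> radical"
  proof (induction w)
    case (Cons j w)
    then show ?case
      by (simp add: mon_Cons [of j w] mult.assoc radical_letter_mult)
  qed (simp add: mon)
  then show ?case by (simp add: mult.assoc radical_cst_mult)
qed (simp add: distrib_right radical_add)

lemma radical_mult_right: "p \<in> radical \<Longrightarrow> p * u \<in> radical"
proof (induction u rule: falg_induct)
  case (mon c w)
  have "p * mon w \<in> radical"
  proof (induction w rule: rev_induct)
    case (snoc j w)
    then show ?case
      by (simp add: mon_append radical_mult_letter flip: mult.assoc)
  qed (simp add: mon)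
  then show ?case by (simp add: cst_left_commute radical_cst_mult)
qed (simp add: distrib_left radical_add)

lemma DW_DR: "DW w (DR i p) = DR i (DW w p)"
  by (induction w arbitrary: p) (auto simp: DL_DR)

text \<open>\<open>DR i\<close> commutes with \<open>DW w\<close>, and after \<open>eps\<close> it
  agrees with \<open>DL i\<close>, as both then read off the coefficient of the word
  \<open>[i]\<close>.\<close>

lemma radical_DR:
  assumes "p \<in> radical"
  shows "DR i p \<in> radical"
proof -
  have "eps (DW w (DR i p)) = eps (DW (w @ [i]) p)" for w
    by (simp add: DW_DR eps_DR DW_append)
  then show ?thesis using assms by (simp add: radical_def)
qed

section \<open>The braided antipode\<close>

text \<open>In the braided tensor algebra letters are primitive, so the antipode negates them; it
  reverses products through the braiding, whence the factor \<open>chi j\<close>.\<close>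

primrec antipode_word :: "'i list \<Rightarrow> 'i word \<Rightarrow>\<^sub>0 'k" where
  "antipode_word [] = 1"
| "antipode_word (j # w) = - (cst (chi j (mset w)) * (antipode_word w * mon [j]))"

definition antipode :: "('i word \<Rightarrow>\<^sub>0 'k) \<Rightarrow> 'i word \<Rightarrow>\<^sub>0 'k" where
  "antipode = lift antipode_word"

lemma lin_antipode [simp]: "lin antipode"
  by (simp add: antipode_def)

lemma lin_antipode_intro [simp, intro]: "lin A \<Longrightarrow> lin (\<lambda>p. antipode (A p))"
  by (rule lin_comp) simp_all

lemmas antipode_linear [simp] = linD [OF lin_antipode] lin_0 [OF lin_antipode] lin_diff [OF lin_antipode] lin_uminus [OF lin_antipode]

lemma antipode_mon: "antipode (mon w) = antipode_word w"
  by (simp add: antipode_def)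

lemma antipode_1 [simp]: "antipode 1 = 1"
  using antipode_mon [of "[]"] by simp

lemma antipode_letter_mult: "antipode (mon [j] * p) = - (antipode (sigma j p) * mon [j])"
  by (rule lin_eqI [of "\<lambda>p. antipode (mon [j] * p)"])
    (auto simp: antipode_mon sigma_mon mult.assoc simp flip: mon_Cons)

lemma antipode_tau: "antipode (tau i p) = tau i (antipode p)"
proof (rule lin_eqI [of "\<lambda>p. antipode (tau i p)"])
  show "antipode (tau i (mon w)) = tau i (antipode (mon w))" for w
  proof (induction w)
    case (Cons j w)
    then show ?case
      by (simp add: mon_Cons [of j w] tau_mult antipode_letter_mult sigma_tau sigma_mon
          cst_simps cst_left_commute [of "tau i p" for p] mult_ac)
  qed simp
qed auto

text \<open>Reversal of words turns removal at the left end into removal at the right end. With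
  \<open>radical_DR\<close> and \<open>radical_tau\<close> this makes the radical stable under the
  antipode.\<close>

lemma DL_antipode: "DL i (antipode p) = antipode (- tau i (DR i p))"
proof (rule lin_eqI [of "\<lambda>p. DL i (antipode p)"])
  show "DL i (antipode (mon w)) = antipode (- tau i (DR i (mon w)))" for w
  proof (induction w)
    case (Cons j w)
    then have "DL i (antipode (sigma j (mon w))) = antipode (- tau i (DR i (sigma j (mon w))))"
      by (simp add: sigma_mon)
    then show ?case
      by (simp add: mon_Cons [of j w] DR_letter_mult antipode_letter_mult DL_mult tau_mult sigma_tau
          DR_sigma cst_simps antipode_tau)
  qed simp
qed auto

lemma eps_antipode: "eps (antipode p) = eps p"
proof -
  have "cst (eps (antipode p)) = cst (eps p)"
  proof (rule lin_eqI [of "\<lambda>p. cst (eps (antipode p))"])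
    show "cst (eps (antipode (mon w))) = cst (eps (mon w))" for w
      by (cases w) (simp_all add: antipode_mon)
  qed auto
  then show ?thesis by (metis eps_simps(6))
qed

lemma radical_antipode: "p \<in> radical \<Longrightarrow> antipode p \<in> radical"
proof (rule radical_coinduct [of _ "antipode ` radical"])
  show "eps r = 0" if "r \<in> antipode ` radical" for r
    using that by (auto simp: eps_antipode radical_eps)
  show "DL i r \<in> antipode ` radical" if "r \<in> antipode ` radical" for i r
    using that by (auto simp: DL_antipode radical_uminus radical_tau radical_DR simp del: antipode_linear)
qed auto

text \<open>The product of \<open>q\<close> over all pairs of positions k < l, that is, the braiding
  scalar for reversing the word.\<close>

primrec pairs_prod :: "'i list \<Rightarrow> 'k" where
  "pairs_prod [] = 1"
| "pairs_prod (j # w) = chi j (mset w) * pairs_prod w"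

lemma pairs_prod_append1: "pairs_prod (w @ [j]) = pairs_prod w * chr (mset w) j"
  by (induction w) (auto simp: algebra_simps)

lemma antipode_word_rev: "antipode_word w = cst ((- 1) ^ length w * pairs_prod w) * mon (rev w)"
  by (induction w) (auto simp: mon_append cst_uminus cst_simps mult_ac)

lemma homog_antipode: "homog M p \<Longrightarrow> homog M (antipode p)"
  by (erule homog_lin) (auto simp: antipode_mon antipode_word_rev homog_cst_mult)

definition full_twist :: "'i list \<Rightarrow> 'k" where
  "full_twist w = pairs_prod w * pairs_prod (rev w)"

lemma full_twist_simps [simp]:
  "full_twist [] = 1" "full_twist (j # w) = chi j (mset w) * chr (mset w) j * full_twist w"
  by (simp_all add: full_twist_def pairs_prod_append1)

lemma antipode_antipode_mon: "antipode (antipode (mon w)) = cst (full_twist w) * mon w"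
proof -
  have "(- 1 :: 'k) ^ length w * (- 1) ^ length w = 1"
    by (simp flip: power_mult_distrib)
  then show ?thesis
    by (simp add: antipode_mon antipode_word_rev full_twist_def cst_cst_mult algebra_simps)
qed

text \<open>Both sides multiply \<open>q k l * q l k\<close> over all ordered pairs of positions;
  the diagonal pairs, absent from the twist, come from the second factor on the left. The right side
  consists of weights, which the Cartan relation evaluates.\<close>

lemma full_twist_square:
  "full_twist w ^ 2 * (\<Prod>j\<in>#mset w. q j j) ^ 2 = (\<Prod>j\<in>#mset w. chi j (mset w) * chr (mset w) j)"
proof (induction w)
  case (Cons j w)
  have "(\<Prod>l\<in>#mset w. chi l (mset w) * (q l j * (chr (mset w) l * q j l)))
    = (\<Prod>l\<in>#mset w. (chi l (mset w) * chr (mset w) l) * (q l j * q j l))"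
    by (intro arg_cong [of _ _ prod_mset] image_mset_cong) (simp add: algebra_simps)
  also have "\<dots> = (\<Prod>l\<in>#mset w. chi l (mset w) * chr (mset w) l) * (chr (mset w) j * chi j (mset w))"
    unfolding prod_mset.distrib chr_def chi_def by simp
  finally show ?case
    using Cons by (simp add: power_mult_distrib power2_eq_square algebra_simps)
qed simp

text \<open>The right side depends on the degree alone, and therefore so does the twist when the
  \<open>q j j\<close> are nonzero.\<close>

lemma full_twist_mult:
  "full_twist w * (\<Prod>j\<in>#mset w. q j j) = (\<Prod>j\<in>#mset w. chi j (mset w))"
  by (induction w) (auto simp: prod_mset.distrib chr_def algebra_simps)

end

section \<open>Two-sided ideals of the free algebra\<close>

definition two_sided_ideal :: "('i word \<Rightarrow>\<^sub>0 'k :: field) set \<Rightarrow> bool" where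
  "two_sided_ideal I \<longleftrightarrow> 0 \<in> I \<and> (\<forall>p\<in>I. \<forall>r\<in>I. p + r \<in> I) \<and> (\<forall>p\<in>I. \<forall>u. u * p \<in> I \<and> p * u \<in> I)"

lemma two_sided_idealD:
  assumes "two_sided_ideal I"
  shows "0 \<in> I" "p \<in> I \<Longrightarrow> r \<in> I \<Longrightarrow> p + r \<in> I" "p \<in> I \<Longrightarrow> u * p \<in> I" "p \<in> I \<Longrightarrow> p * u \<in> I"
    "p \<in> I \<Longrightarrow> - p \<in> I" "p \<in> I \<Longrightarrow> r \<in> I \<Longrightarrow> p - r \<in> I"
proof -
  show *: "0 \<in> I" "p \<in> I \<Longrightarrow> r \<in> I \<Longrightarrow> p + r \<in> I" "p \<in> I \<Longrightarrow> u * p \<in> I" "p \<in> I \<Longrightarrow> p * u \<in> I"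
    for p r u
    using assms by (auto simp: two_sided_ideal_def)
  show uminus: "p \<in> I \<Longrightarrow> - p \<in> I" for p
    using *(3) [of p "- 1"] by simp
  show "p \<in> I \<Longrightarrow> r \<in> I \<Longrightarrow> p - r \<in> I"
    using *(2) [of p "- r"] uminus by simp
qed

lemma two_sided_ideal_sum:
  assumes "two_sided_ideal I" "\<And>x. x \<in> U \<Longrightarrow> f x \<in> I"
  shows "(\<Sum>x\<in>U. f x) \<in> I"
  using assms(2)
  by (induction U rule: infinite_finite_induct) (auto simp: two_sided_idealD [OF assms(1)])

lemma two_sided_ideal_cst_cancel:
  assumes "two_sided_ideal I" "cst c * p \<in> I" "c \<noteq> 0"
  shows "p \<in> I"
proof -
  have "cst (inverse c) * (cst c * p) \<in> I"
    by (rule two_sided_idealD(3) [OF assms(1,2)])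
  then show ?thesis using assms(3) by (simp add: cst_cst_mult)
qed

section \<open>Generalized inverses of finite matrices\<close>

text \<open>A linear map has a linear right inverse on its image; in matrices,
  \<open>G H G = G\<close>. A true inverse of the Gram matrix does not exist in degrees containing
  nonzero radical elements.\<close>

lemma generalized_inverse_exists:
  fixes G :: "'a \<Rightarrow> 'a \<Rightarrow> 'k :: field"
  assumes fin: "finite A"
  obtains H where "\<And>w u. w \<in> A \<Longrightarrow> u \<in> A \<Longrightarrow> (\<Sum>v\<in>A. G w v * (\<Sum>w'\<in>A. H v w' * G w' u)) = G w u"
proof -
  define sc where "sc = (\<lambda>(c :: 'k) (x :: 'a \<Rightarrow>\<^sub>0 'k). Poly_Mapping.map ((*) c) x)"
  have lookup_sc [simp]: "Poly_Mapping.lookup (sc c x) a = c * Poly_Mapping.lookup x a" for c x a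
    unfolding sc_def by transfer (simp add: when_def)
  interpret V: vector_space_pair sc sc
    by unfold_locales (auto intro!: poly_mapping_eqI simp: lookup_add algebra_simps)
  define f where "f = (\<lambda>x. \<Sum>w\<in>A. Poly_Mapping.single w (\<Sum>u\<in>A. G w u * Poly_Mapping.lookup x u))"
  define d where "d = (\<lambda>u. Poly_Mapping.single u (1 :: 'k) :: 'a \<Rightarrow>\<^sub>0 'k)"
  have lookup_d: "Poly_Mapping.lookup (d u) v = (if u = v then 1 else 0)" for u v
    by (simp add: d_def lookup_single when_def)
  have lookup_f: "Poly_Mapping.lookup (f x) w =
      (if w \<in> A then \<Sum>u\<in>A. G w u * Poly_Mapping.lookup x u else 0)" for x w
    using fin by (simp add: f_def lookup_sum lookup_single when_def)
  have f_lin: "Vector_Spaces.linear sc sc f"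
    by unfold_locales
      (auto intro!: poly_mapping_eqI simp: lookup_f lookup_add algebra_simps sum.distrib sum_distrib_left)
  have "\<exists>g. range g \<subseteq> UNIV \<and> Vector_Spaces.linear sc sc g \<and> (\<forall>v\<in>f ` UNIV. f (g v) = v)"
    by (rule V.linear_exists_right_inverse_on [OF f_lin]) (simp add: V.vs1.subspace_def)
  then obtain g where g: "Vector_Spaces.linear sc sc g" "\<And>x. f (g (f x)) = f x"
    by auto
  interpret g: Vector_Spaces.linear sc sc g by (rule g(1))
  have f_d: "Poly_Mapping.lookup (f (d u)) w = (if w \<in> A then G w u else 0)" if "u \<in> A" for u w
    using that fin by (simp add: lookup_f lookup_d if_distrib [of "\<lambda>x. _ * x"] cong: if_cong)
  have "Poly_Mapping.lookup (g (f (d u))) v = (\<Sum>w'\<in>A. Poly_Mapping.lookup (g (d w')) v * G w' u)"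
    if u: "u \<in> A" for u v
  proof -
    have "f (d u) = (\<Sum>w'\<in>A. sc (G w' u) (d w'))"
      using fin u
      by (intro poly_mapping_eqI) (simp add: f_d lookup_sum lookup_d
          if_distrib [of "\<lambda>x. _ * x"] cong: if_cong)
    then have "g (f (d u)) = (\<Sum>w'\<in>A. sc (G w' u) (g (d w')))"
      by (simp add: g.sum g.scale)
    then show ?thesis
      by (simp add: lookup_sum mult.commute)
  qed
  note gfd = this
  show ?thesis
  proof (rule that)
    fix w u assume wu: "w \<in> A" "u \<in> A"
    have "(\<Sum>v\<in>A. G w v * (\<Sum>w'\<in>A. Poly_Mapping.lookup (g (d w')) v * G w' u)) =
        Poly_Mapping.lookup (f (g (f (d u)))) w"
      using wu by (simp add: lookup_f [of "g (f (d u))"] gfd)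
    also have "\<dots> = G w u"
      using wu by (simp add: g(2) f_d)
    finally show "(\<Sum>v\<in>A. G w v * (\<Sum>w'\<in>A. Poly_Mapping.lookup (g (d w')) v * G w' u)) = G w u" .
  qed
qed

lemma finite_mset_eq: "finite {w. mset w = M}"
  by (metis ex_mset mset_eq_finite)

section \<open>The coproduct and primitive elements\<close>

context braiding
begin

text \<open>\<open>cop v h\<close> applies the bilinear map \<open>h\<close> to the braided coproduct of the monomial \<open>v\<close>.\<close>

primrec cop :: "'i list \<Rightarrow> ('i list \<Rightarrow> 'i list \<Rightarrow> 'i word \<Rightarrow>\<^sub>0 'k) \<Rightarrow> 'i word \<Rightarrow>\<^sub>0 'k" where
  "cop [] h = h [] []"
| "cop (j # v) h = cop v (\<lambda>u z. h (j # u) z) + cop v (\<lambda>u z. cst (chi j (mset u)) * h u (j # z))"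

lemma cop_add: "cop v (\<lambda>u z. h u z + h' u z) = cop v h + cop v h'"
  by (induction v arbitrary: h h') (auto simp: distrib_left algebra_simps)

lemma cop_mult: "cop v (\<lambda>u z. p * h u z) = p * cop v h"
  by (induction v arbitrary: h) (auto simp: cst_left_commute [of p, symmetric] distrib_left)

lemma cop_0: "cop v (\<lambda>u z. 0) = 0"
  using cop_mult [of v 0] by simp

lemma cop_sum: "cop v (\<lambda>u z. \<Sum>x\<in>U. h x u z) = (\<Sum>x\<in>U. cop v (h x))"
  by (induction U rule: infinite_finite_induct) (auto simp: cop_add cop_0)

lemma cop_diff: "cop v (\<lambda>u z. h u z - h' u z) = cop v h - cop v h'"
  using cop_add [of v h "\<lambda>u z. - 1 * h' u z"] cop_mult [of v "- 1" h'] by simp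

lemma cop_cong:
  assumes "\<And>u z. mset u + mset z = mset v \<Longrightarrow> h u z = h' u z"
  shows "cop v h = cop v h'"
  using assms
proof (induction v arbitrary: h h')
  case (Cons j v)
  show ?case
    by (auto intro!: arg_cong2 [of _ _ _ _ "(+)"] Cons.IH simp: Cons.prems)
qed simp

lemma cop_mem:
  assumes I: "two_sided_ideal I" and "\<And>u z. mset u + mset z = mset v \<Longrightarrow> h u z \<in> I"
  shows "cop v h \<in> I"
  using assms(2)
proof (induction v arbitrary: h)
  case (Cons j v)
  show ?case
    by (auto intro!: two_sided_idealD(2,3) [OF I] Cons.IH simp: Cons.prems)
qed simp

lemma lin_cop: "(\<And>u z. lin (\<lambda>p. h p u z)) \<Longrightarrow> lin (\<lambda>p. cop v (h p))"
  by (induction v arbitrary: h) auto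

lemma cop_counit_left: "cop v (\<lambda>u z. if u = [] then g z else 0) = g v"
  by (induction v arbitrary: g) (auto simp: cop_0 if_distrib [of "\<lambda>x. _ * x"] cong: if_cong)

lemma cop_counit_right: "cop v (\<lambda>u z. if z = [] then g u else 0) = g v"
  by (induction v arbitrary: g) (auto simp: cop_0)

text \<open>The antipode axiom. The coproduct of \<open>j # v\<close> arises from that of
  \<open>v\<close> by adding \<open>j\<close> to either factor, and the two contributions cancel by
  the recursion of \<open>antipode_word\<close>.\<close>

lemma cop_antipode: "v \<noteq> [] \<Longrightarrow> cop v (\<lambda>u z. antipode_word u * mon z) = 0"
proof (induction v)
  case (Cons j v)
  have "cop (j # v) (\<lambda>u z. antipode_word u * mon z) =
      cop v (\<lambda>u z. antipode_word (j # u) * mon z + cst (chi j (mset u)) * (antipode_word u * mon (j # z)))"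
    by (subst cop_add) simp
  also have "\<dots> = cop v (\<lambda>u z. 0)"
  proof (rule cop_cong)
    fix u z
    show "antipode_word (j # u) * mon z + cst (chi j (mset u)) * (antipode_word u * mon (j # z)) = 0"
      by (simp add: mon_Cons [of j z] mult.assoc)
  qed
  finally show ?case by (simp add: cop_0)
qed simp

section \<open>Contractions of the coproduct and transposed parameters\<close>

lemma DW_1: "DW w 1 = (if w = [] then 1 else 0)"
  by (cases w) auto

abbreviation DLTw :: "'i \<Rightarrow> 'i list \<Rightarrow> 'i word \<Rightarrow>\<^sub>0 'k" where
  "DLTw \<equiv> braiding.DLw (\<lambda>i j. q j i)"

text \<open>Either \<open>j\<close> survives and is passed by all of \<open>w\<close>, or an
  occurrence of \<open>j\<close> in \<open>w\<close> removes it. In the second case \<open>w\<close>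
  loses that occurrence, and the scalar for the letters before it is that of a skew derivation of
  \<open>w\<close> with \<open>q\<close> transposed.\<close>

lemma DW_letter_mult:
  "DW w (mon [j] * p) = cst (chi j (mset w)) * (mon [j] * DW w p) + lift (\<lambda>w. DW w p) (DLTw j w)"
proof (induction w arbitrary: p)
  case (Cons i w)
  have "lift (\<lambda>w. DW w p) (mon [i] * r) = lift (\<lambda>w. DW w (DL i p)) r" for r
    by (rule lin_eqI [of "\<lambda>r. lift (\<lambda>w. DW w p) (mon [i] * r)"]) (auto simp flip: mon_Cons)
  then show ?case
    by (auto simp: DL_letter_mult Cons braiding.DLw.simps linD [OF lin_lift] cst_cst_mult
        distrib_left mult_ac lin_0)
qed (simp add: braiding.DLw.simps lin_0)

lemma gram_Cons_right: "gram w (j # v) = eps (lift (\<lambda>w. DW w (mon v)) (DLTw j w))"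
  by (simp add: gram_def mon_Cons [of j v] DW_letter_mult)

text \<open>By \<open>DW_letter_mult\<close>, a letter at the head of \<open>v\<close> acts on
  \<open>w\<close> as a derivation for the transposed parameters. Thus the left kernel of the form
  becomes a right kernel, to which the same theory applies.\<close>

lemma gram_transpose: "gram w v = braiding.gram (\<lambda>i j. q j i) v w"
proof (induction v arbitrary: w)
  case Nil
  then show ?case
    by (simp add: gram_def braiding.gram_def DW_1 braiding.DW.simps)
next
  case (Cons j v)
  interpret T: braiding "\<lambda>i j. q j i" .
  have "cst (eps (lift (\<lambda>w. DW w (mon v)) p)) = cst (eps (T.DW v p))" for p
    by (rule lin_eqI [of "\<lambda>p. cst (eps (lift (\<lambda>w. DW w (mon v)) p))"])
      (auto simp: Cons simp flip: gram_def T.gram_def)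
  then have "eps (lift (\<lambda>w. DW w (mon v)) p) = eps (T.DW v p)" for p
    by (metis eps_simps(6))
  then show ?case
    by (simp add: gram_Cons_right T.gram_def T.DL_mon)
qed

text \<open>Deriving along \<open>w\<close> is contracting the first coproduct factor with the
  functional \<open>gram w\<close>.\<close>

lemma DW_cop: "DW w (mon v) = cop v (\<lambda>u z. cst (gram w u) * mon z)"
proof (induction v arbitrary: w)
  case Nil
  then show ?case by (simp add: gram_def DW_1)
next
  case (Cons j v)
  have "lift (\<lambda>w. DW w (mon v)) p = cop v (\<lambda>u z. cst (eps (lift (\<lambda>w. DW w (mon u)) p)) * mon z)" for p
    by (rule lin_eqI [OF _ lin_cop]) (auto simp: Cons simp flip: gram_def)
  then have 1: "lift (\<lambda>w. DW w (mon v)) (DLTw j w) = cop v (\<lambda>u z. cst (gram w (j # u)) * mon z)"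
    by (simp add: gram_Cons_right)
  \<comment> \<open>The scalar depends on \<open>u\<close>, but only factors \<open>u\<close> of the
    degree of \<open>w\<close> contribute, so it can be moved out as
    \<open>chi j (mset w)\<close>.\<close>
  have "cop v (\<lambda>u z. cst (chi j (mset u)) * (cst (gram w u) * mon (j # z))) =
      cop v (\<lambda>u z. (cst (chi j (mset w)) * mon [j]) * (cst (gram w u) * mon z))"
  proof (rule cop_cong)
    show "cst (chi j (mset u)) * (cst (gram w u) * mon (j # z)) =
        cst (chi j (mset w)) * mon [j] * (cst (gram w u) * mon z)" for u z
    proof (cases "mset w = mset u")
      case True
      then show ?thesis by (simp add: mon_Cons [of j z] cst_simps)
    qed (simp add: gram_eq_0)
  qed
  also have "\<dots> = cst (chi j (mset w)) * (mon [j] * DW w (mon v))"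
    by (simp only: cop_mult Cons mult.assoc)
  finally show ?case
    by (simp add: mon_Cons [of j v] DW_letter_mult 1)
qed

section \<open>Primitivity of radical elements of minimal degree\<close>

lemma radicalI_homog:
  assumes "homog M p" "\<And>w. mset w = M \<Longrightarrow> eps (DW w p) = 0"
  shows "p \<in> radical"
  unfolding radical_def
proof (intro CollectI allI)
  fix w
  show "eps (DW w p) = 0"
  proof (cases "mset w \<subseteq># M")
    case True
    then obtain N where N: "M = mset w + N"
      by (metis subset_mset.le_iff_add)
    then show ?thesis
      using assms eps_homog [of N "DW w p"] homog_DW [of w N p] by (cases "N = {#}") auto
  next
    case False
    then show ?thesis
      using DW_homog_eq_0 [OF assms(1)] by simp
  qed
qed

text \<open>The family \<open>h\<close> plays the role of a basis dual to the words modulo the radical.\<close>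

lemma radical_projection:
  obtains h where "\<And>w. homog (mset w) (h w)"
    "\<And>u. mon u - (\<Sum>w | mset w = mset u. cst (gram w u) * h w) \<in> radical"
proof -
  have "\<forall>M. \<exists>H. \<forall>w u. mset w = M \<longrightarrow> mset u = M \<longrightarrow>
      (\<Sum>v | mset v = M. gram w v * (\<Sum>w' | mset w' = M. H v w' * gram w' u)) = gram w u"
  proof
    fix M
    show "\<exists>H. \<forall>w u. mset w = M \<longrightarrow> mset u = M \<longrightarrow>
      (\<Sum>v | mset v = M. gram w v * (\<Sum>w' | mset w' = M. H v w' * gram w' u)) = gram w u"
      by (rule generalized_inverse_exists [OF finite_mset_eq, of M gram]) blast
  qed
  from choice [OF this] obtain H where H: "\<And>M w u. mset w = M \<Longrightarrow> mset u = M \<Longrightarrow>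
      (\<Sum>v | mset v = M. gram w v * (\<Sum>w' | mset w' = M. H M v w' * gram w' u)) = gram w u"
    by (elim exE) blast
  \<comment> \<open>\<open>h w\<close> is column \<open>w\<close> of the generalized inverse, so the
    sum in the claim has the Gram coordinates \<open>G H G = G\<close> and cannot be distinguished
    from \<open>mon u\<close> by the form.\<close>
  define h where "h = (\<lambda>w. \<Sum>v | mset v = mset w. cst (H (mset w) v w) * mon v)"
  show ?thesis
  proof (rule that)
    show h: "homog (mset w) (h w)" for w
      unfolding h_def by (intro homog_sum homog_cst_mult) simp
    show "mon u - (\<Sum>w | mset w = mset u. cst (gram w u) * h w) \<in> radical" for u
    proof (rule radicalI_homog [of "mset u"])
      show "homog (mset u) (mon u - (\<Sum>w | mset w = mset u. cst (gram w u) * h w))"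
        using h by (intro homog_diff homog_sum homog_cst_mult) (auto, metis)
      fix w assume w: "mset w = mset u"
      have "eps (DW w (\<Sum>w' | mset w' = mset u. cst (gram w' u) * h w')) =
          (\<Sum>w' | mset w' = mset u. gram w' u * (\<Sum>v | mset v = mset u. H (mset u) v w' * gram w v))"
        by (simp add: lin_sum eps_sum h_def gram_def [of w] sum_distrib_left)
      also have "\<dots> = (\<Sum>w' | mset w' = mset u. \<Sum>v | mset v = mset u.
          gram w v * (H (mset u) v w' * gram w' u))"
        by (simp add: sum_distrib_left algebra_simps)
      also have "\<dots> = (\<Sum>v | mset v = mset u. \<Sum>w' | mset w' = mset u.
          gram w v * (H (mset u) v w' * gram w' u))"
        by (rule sum.swap)
      also have "\<dots> = gram w u"
        using H [OF w refl] by (simp add: sum_distrib_left)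
      finally show "eps (DW w (mon u - (\<Sum>w | mset w = mset u. cst (gram w u) * h w))) = 0"
        by (simp add: gram_def)
    qed
  qed
qed

text \<open>The antipode axiom expresses \<open>x + antipode x\<close> by the middle terms of the
  coproduct of \<open>x\<close>. By minimality a first factor \<open>u\<close> there may be replaced
  modulo \<open>I\<close> by its combination of the \<open>h w\<close>. The middle part then becomes
  a sum of terms \<open>antipode (h w) * DW w x\<close>, whose right factors are radical elements of
  smaller degree.\<close>

lemma radical_plus_antipode_mem:
  assumes I: "two_sided_ideal I" and x: "homog M x" "x \<in> radical" and M: "M \<noteq> {#}"
    and IH: "\<And>N p. size N < size M \<Longrightarrow> homog N p \<Longrightarrow> p \<in> radical \<Longrightarrow> p \<in> I"
  shows "x + antipode x \<in> I"
proof -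
  obtain h where h: "\<And>w. homog (mset w) (h w)"
    "\<And>u. mon u - (\<Sum>w | mset w = mset u. cst (gram w u) * h w) \<in> radical"
    by (rule radical_projection) blast
  define W where "W = {w. w \<noteq> [] \<and> mset w \<subset># M}"
  have fin: "finite W"
  proof (rule finite_subset)
    show "W \<subseteq> {w. set w \<subseteq> set_mset M \<and> length w \<le> size M}"
      unfolding W_def
      by (auto dest!: subset_mset.less_imp_le)
        (metis mset_subset_eqD set_mset_mset, metis size_mset size_mset_mono)
  qed (simp add: finite_lists_length_le)
  \<comment> \<open>The antipode axiom after this replacement; \<open>A\<close> maps every element
    of degree \<open>M\<close> into \<open>I\<close>, radical or not.\<close>
  define A where "A = (\<lambda>p. p + antipode p + (\<Sum>w\<in>W. antipode (h w) * DW w p))"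
  have lin_A: "lin A"
    unfolding A_def by (intro lin_intros lin_sum_fun) auto
  have A_mon: "A (mon v) \<in> I" if v: "mset v = M" for v
  proof -
    let ?mid = "\<lambda>u z. if u = [] \<or> z = [] then 0 else antipode_word u * mon z"
    let ?mid' = "\<lambda>u z. if u = [] \<or> z = [] then 0 else \<Sum>w\<in>W. antipode (h w) * (cst (gram w u) * mon z)"
    have "v \<noteq> []" using v M by auto
    then have "0 = cop v (\<lambda>u z. antipode_word u * mon z)"
      by (simp add: cop_antipode)
    also have "\<dots> = cop v (\<lambda>u z. ((if u = [] then mon z else 0) + (if z = [] then antipode_word u else 0)) + ?mid u z)"
      using \<open>v \<noteq> []\<close> by (intro cop_cong) auto
    also have "\<dots> = mon v + antipode_word v + cop v ?mid"
      unfolding cop_add cop_counit_left cop_counit_right ..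
    finally have 1: "mon v + antipode_word v + cop v ?mid = 0" ..
    have 2: "cop v (\<lambda>u z. ?mid u z - ?mid' u z) \<in> I"
    proof (rule cop_mem [OF I])
      fix u z assume uz: "mset u + mset z = mset v"
      show "?mid u z - ?mid' u z \<in> I"
      proof (cases "u = [] \<or> z = []")
        case True
        then show ?thesis by (auto simp: two_sided_idealD(1) [OF I])
      next
        case False
        have sub: "mset u \<subset># M"
          using uz v False by (auto simp: subset_mset.less_le)
        have "(\<Sum>w\<in>W. antipode (h w) * (cst (gram w u) * mon z)) =
            (\<Sum>w | mset w = mset u. antipode (h w) * (cst (gram w u) * mon z))"
          by (rule sum.mono_neutral_right [OF fin])
            (use False sub in \<open>auto simp: W_def gram_eq_0\<close>)
        also have "\<dots> = antipode (\<Sum>w | mset w = mset u. cst (gram w u) * h w) * mon z"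
          by (simp add: lin_sum sum_distrib_right cst_left_commute mult.assoc)
        finally have "?mid u z - ?mid' u z =
            antipode (mon u - (\<Sum>w | mset w = mset u. cst (gram w u) * h w)) * mon z"
          using False by (simp add: antipode_mon left_diff_distrib)
        moreover have "antipode (mon u - (\<Sum>w | mset w = mset u. cst (gram w u) * h w)) \<in> I"
        proof (rule IH)
          show "size (mset u) < size M"
            using sub by (rule mset_subset_size)
          have "homog (mset u) (\<Sum>w | mset w = mset u. cst (gram w u) * h w)"
            by (intro homog_sum homog_cst_mult) (use h(1) in \<open>auto, metis\<close>)
          then show "homog (mset u) (antipode (mon u - (\<Sum>w | mset w = mset u. cst (gram w u) * h w)))"
            by (intro homog_antipode homog_diff) auto
          show "antipode (mon u - (\<Sum>w | mset w = mset u. cst (gram w u) * h w)) \<in> radical"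
            by (rule radical_antipode [OF h(2)])
        qed
        ultimately show ?thesis
          by (simp add: two_sided_idealD(4) [OF I])
      qed
    qed
    \<comment> \<open>Restoring the terms with an empty factor changes nothing: a word of
      \<open>W\<close> is neither empty nor of degree \<open>M\<close>, so the Gram entry is
      0.\<close>
    have "cop v ?mid' = cop v (\<lambda>u z. \<Sum>w\<in>W. antipode (h w) * (cst (gram w u) * mon z))"
    proof (rule cop_cong)
      fix u z assume uz: "mset u + mset z = mset v"
      have "gram w u = 0" if "w \<in> W" "u = [] \<or> z = []" for w
        using that uz v by (auto simp: W_def intro!: gram_eq_0)
      then show "?mid' u z = (\<Sum>w\<in>W. antipode (h w) * (cst (gram w u) * mon z))"
        by auto
    qed
    also have "\<dots> = (\<Sum>w\<in>W. antipode (h w) * DW w (mon v))"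
      by (simp add: cop_sum cop_mult DW_cop)
    finally have "A (mon v) = - (cop v ?mid - cop v ?mid')"
      using 1 by (simp add: A_def antipode_mon eq_neg_iff_add_eq_0)
    then show ?thesis
      using two_sided_idealD(5) [OF I 2] by (simp only: cop_diff)
  qed
  have "A x \<in> I"
    using x(1)
  proof (induction rule: homog_induct)
    case zero
    then show ?case using lin_A two_sided_idealD(1) [OF I] by (simp add: lin_0)
  next
    case (mon c w)
    then show ?case using A_mon lin_A two_sided_idealD(3) [OF I] by (simp add: linD)
  next
    case (add p r)
    then show ?case using lin_A two_sided_idealD(2) [OF I] by (simp add: linD)
  qed
  moreover have "(\<Sum>w\<in>W. antipode (h w) * DW w x) \<in> I"
  proof (intro two_sided_ideal_sum [OF I] two_sided_idealD(3) [OF I])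
    fix w assume w: "w \<in> W"
    then obtain N where N: "M = mset w + N"
      unfolding W_def by (metis (mono_tags, lifting) mem_Collect_eq subset_mset.le_iff_add
          subset_mset.less_imp_le)
    show "DW w x \<in> I"
    proof (rule IH)
      show "size N < size M" using w by (auto simp: N W_def)
      show "homog N (DW w x)" using x(1) by (auto simp: N homog_DW)
      show "DW w x \<in> radical" by (rule radical_DW [OF x(2)])
    qed
  qed
  ultimately show ?thesis
    using two_sided_idealD(6) [OF I, of "A x" "\<Sum>w\<in>W. antipode (h w) * DW w x"] by (simp add: A_def)
qed

text \<open>\<open>radical_plus_antipode_mem\<close> is applied to \<open>x\<close> and to
  \<open>antipode x\<close>; the difference is \<open>1 - full_twist v\<close> times
  \<open>x\<close>. Using it twice avoids showing that \<open>I\<close> is stable under the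
  antipode.\<close>

lemma full_twist_eq_1:
  assumes I: "two_sided_ideal I" and x: "homog M x" "x \<in> radical" "x \<notin> I"
    and M: "M \<noteq> {#}" "mset v = M" and nz: "\<And>j. q j j \<noteq> 0"
    and IH: "\<And>N p. size N < size M \<Longrightarrow> homog N p \<Longrightarrow> p \<in> radical \<Longrightarrow> p \<in> I"
  shows "full_twist v = 1"
proof -
  have tw: "full_twist w = full_twist v" if "mset w = M" for w
  proof -
    have "(\<Prod>j\<in>#M. q j j) \<noteq> 0" using nz by (auto simp: prod_mset_zero_iff)
    then show ?thesis
      using full_twist_mult [of w] full_twist_mult [of v] that M
      by (metis mult_right_cancel)
  qed
  have "antipode (antipode x) = cst (full_twist v) * x"
    by (rule homog_lin_eqI [OF x(1), of "\<lambda>x. antipode (antipode x)"]) (auto simp: antipode_antipode_mon tw)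
  moreover have "x + antipode x - (antipode x + antipode (antipode x)) \<in> I"
    using x by (intro two_sided_idealD(6) [OF I] radical_plus_antipode_mem [OF I _ _ M(1) IH])
      (auto simp: homog_antipode radical_antipode)
  ultimately have "cst (1 - full_twist v) * x \<in> I"
    by (simp add: cst_diff left_diff_distrib)
  then show ?thesis
    using two_sided_ideal_cst_cancel [OF I, of "1 - full_twist v" x] x(3) by auto
qed

end

section \<open>The braided adjoint action and the Serre ideal\<close>

context braiding
begin

definition ad :: "'i \<Rightarrow> ('i word \<Rightarrow>\<^sub>0 'k) \<Rightarrow> 'i word \<Rightarrow>\<^sub>0 'k" where
  "ad i p = mon [i] * p - sigma i p * mon [i]"

lemma lin_ad [simp]: "lin (ad i)"
  unfolding ad_def [abs_def] by simp

lemma lin_ad_intro [simp, intro]: "lin A \<Longrightarrow> lin (\<lambda>p. ad i (A p))"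
  by (rule lin_comp) simp_all

lemma lin_adpow [simp]: "lin (ad i ^^ n)"
  by (rule lin_funpow) simp

lemmas ad_linear [simp] = linD [OF lin_ad] lin_0 [OF lin_ad] lin_diff [OF lin_ad]
lemmas adpow_linear [simp] = linD [OF lin_adpow] lin_0 [OF lin_adpow] lin_diff [OF lin_adpow]

lemma ad_1 [simp]: "ad i 1 = 0"
  by (simp add: ad_def)

lemma adpow_1: "n > 0 \<Longrightarrow> (ad i ^^ n) 1 = 0"
  by (cases n) (simp_all add: funpow_Suc_right del: funpow.simps)

lemma ad_mult: "ad i (p * r) = ad i p * r + sigma i p * ad i r"
  by (simp add: ad_def sigma_mult algebra_simps)

lemma sigma_ad: "sigma j (ad i p) = cst (q j i) * ad i (sigma j p)"
  by (simp add: ad_def sigma_mult sigma_sigma [of j i] right_diff_distrib cst_simps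
      cst_left_commute [of "sigma i p" for p])

lemma sigma_adpow: "sigma j ((ad i ^^ n) p) = cst (q j i ^ n) * (ad i ^^ n) (sigma j p)"
  by (induction n) (simp_all add: sigma_ad cst_cst_mult)

lemma homog_ad: "homog M p \<Longrightarrow> homog (add_mset i M) (ad i p)"
  using homog_mult [of "{#i#}" "mon [i]" M p] homog_mult [of M "sigma i p" "{#i#}" "mon [i]"]
  unfolding ad_def by (intro homog_diff) (auto simp: homog_sigma)

lemma homog_adpow: "homog M p \<Longrightarrow> homog (M + replicate_mset n i) ((ad i ^^ n) p)"
  by (induction n) (auto dest: homog_ad [of _ _ i])

text \<open>For \<open>j = i\<close> this is the commutation of raising and lowering operators in
  quantum sl2; \<open>tau i (sigma i p)\<close> multiplies degree \<open>M\<close> by the weight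
  \<open>chi i M * chr M i\<close>.\<close>

lemma DL_ad:
  "DL j (ad i p) = (if j = i then p - tau i (sigma i p) else 0) + cst (q i j) * ad i (DL j p)"
  by (simp add: ad_def DL_letter_mult DL_mult DL_sigma right_diff_distrib mult.assoc)

lemma DL_adpow_other:
  "k \<noteq> i \<Longrightarrow> DL k ((ad i ^^ n) p) = cst (q i k ^ n) * (ad i ^^ n) (DL k p)"
  by (induction n) (simp_all add: DL_ad cst_cst_mult)

lemma DR_ad: "DR i p = 0 \<Longrightarrow> DR i (ad i p) = 0"
  by (simp add: ad_def DR_letter_mult DR_mult DR_sigma)

lemma DR_adpow: "DR i p = 0 \<Longrightarrow> DR i ((ad i ^^ n) p) = 0"
  by (induction n) (simp_all add: DR_ad)

text \<open>The scalar by which \<open>DL i\<close> takes the n-th raised vector back to the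
  previous one, for a start of weight \<open>t\<close> killed by \<open>DL i\<close>, with
  \<open>v = q i i\<close>. Each raising multiplies the weight by \<open>v ^ 2\<close>.\<close>

primrec string_coeff :: "'k \<Rightarrow> 'k \<Rightarrow> nat \<Rightarrow> 'k" where
  "string_coeff t v 0 = 0"
| "string_coeff t v (Suc n) = 1 - t * v ^ (2 * n) + v * string_coeff t v n"

lemma string_coeff_mult:
  "(v - 1) * v * string_coeff t v n = (v ^ n - 1) * (v - t * v ^ n)"
proof (induction n)
  case (Suc n)
  have "(v - 1) * v * string_coeff t v (Suc n) =
      (v - 1) * v * (1 - t * v ^ (2 * n)) + v * ((v - 1) * v * string_coeff t v n)"
    by (simp add: algebra_simps)
  also have "\<dots> = (v ^ Suc n - 1) * (v - t * v ^ Suc n)"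
    unfolding Suc by (simp add: algebra_simps mult_2_right power_add)
  finally show ?case .
qed simp

lemma DL_adpow_same:
  assumes "homog M p"
  shows "DL i ((ad i ^^ n) p) = cst (string_coeff (chi i M * chr M i) (q i i) n) * (ad i ^^ (n - 1)) p
    + cst (q i i ^ n) * (ad i ^^ n) (DL i p)"
proof (induction n)
  case (Suc n)
  let ?t = "chi i M * chr M i" and ?y = "(ad i ^^ n) p"
  let ?M = "M + replicate_mset n i"
  have rep: "chi i (replicate_mset n i) = q i i ^ n" "chr (replicate_mset n i) i = q i i ^ n"
    by (induction n) simp_all
  have y: "homog ?M ?y" by (rule homog_adpow [OF assms])
  then have tau: "tau i (sigma i ?y) = cst (?t * q i i ^ (2 * n)) * ?y"
    by (simp add: sigma_homog tau_homog cst_cst_mult rep mult_2_right power_add mult_ac)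
  \<comment> \<open>At \<open>n = 0\<close> the truncated \<open>n - 1\<close> does no harm, since
    the coefficient is 0.\<close>
  have ad: "cst (string_coeff ?t (q i i) n) * ad i ((ad i ^^ (n - 1)) p) =
      cst (string_coeff ?t (q i i) n) * ?y"
    by (cases n) simp_all
  have "DL i ((ad i ^^ Suc n) p) = ?y - cst (?t * q i i ^ (2 * n)) * ?y +
      cst (q i i) * ad i (DL i ?y)"
    by (simp add: DL_ad tau)
  also have "ad i (DL i ?y) = cst (string_coeff ?t (q i i) n) * ?y + cst (q i i ^ n) *
      (ad i ^^ Suc n) (DL i p)"
    unfolding Suc by (simp only: ad_linear ad) simp
  finally show ?case
    by (simp add: cst_add cst_diff distrib_right left_diff_distrib distrib_left cst_cst_mult
        del: funpow.simps(2))
qed simp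

text \<open>The subalgebra generated by the strings through letters other than \<open>i\<close>.
  \<open>DR i\<close> annihilates it, and for Cartan parameters \<open>ad i\<close> is locally
  nilpotent on it modulo the Serre elements.\<close>

inductive_set string_alg :: "'i \<Rightarrow> ('i word \<Rightarrow>\<^sub>0 'k) set" for i where
  string_alg_1: "1 \<in> string_alg i"
| string_alg_cst: "p \<in> string_alg i \<Longrightarrow> cst c * p \<in> string_alg i"
| string_alg_add: "p \<in> string_alg i \<Longrightarrow> r \<in> string_alg i \<Longrightarrow> p + r \<in> string_alg i"
| string_alg_mult: "j \<noteq> i \<Longrightarrow> p \<in> string_alg i \<Longrightarrow> (ad i ^^ m) (mon [j]) * p \<in> string_alg i"

lemma string_alg_0 [simp]: "0 \<in> string_alg i"
  using string_alg_cst [OF string_alg_1, of 0] by simp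

lemma ad_string_alg: "p \<in> string_alg i \<Longrightarrow> ad i p \<in> string_alg i"
proof (induction rule: string_alg.induct)
  case (string_alg_mult j p m)
  have "(ad i ^^ Suc m) (mon [j]) * p \<in> string_alg i" "(ad i ^^ m) (mon [j]) * ad i p \<in> string_alg i"
    using string_alg_mult by (auto intro: string_alg.intros simp del: funpow.simps)
  then show ?case
    by (auto simp: ad_mult sigma_adpow cst_cst_mult mult.assoc intro!: string_alg_add string_alg_cst)
qed (auto intro: string_alg.intros)

lemma DR_string_alg: "p \<in> string_alg i \<Longrightarrow> DR i p = 0"
  by (induction rule: string_alg.induct) (auto simp: DR_mult DR_adpow)

text \<open>Words are built from the left. A letter other than \<open>i\<close> preserves
  \<open>string_alg i\<close>, while \<open>mon [i] * x = ad i x + sigma i x * mon [i]\<close>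
  pushes \<open>i\<close> to the right end. The alternative \<open>y = 0\<close> covers degrees
  without \<open>i\<close>, where no \<open>L\<close> exists.\<close>

lemma string_alg_decomposition:
  assumes "homog M p"
  shows "\<exists>x y. p = x + y * mon [i] \<and> x \<in> string_alg i \<and> homog M x
    \<and> (y = 0 \<or> (\<exists>L. M = add_mset i L \<and> homog L y))"
  using assms
proof (induction rule: homog_induct)
  case zero
  show ?case by (intro exI [of _ 0]) simp
next
  case (mon c w)
  have "\<exists>x y. mon w = x + y * mon [i] \<and> x \<in> string_alg i \<and> homog (mset w) x
    \<and> (y = 0 \<or> (\<exists>L. mset w = add_mset i L \<and> homog L y))"
  proof (induction w)
    case Nil
    show ?case by (intro exI [of _ 1] exI [of _ 0]) (simp add: string_alg_1)
  next
    case (Cons j w)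
    then obtain x y where xy: "mon w = x + y * mon [i]" "x \<in> string_alg i" "homog (mset w) x"
      "y = 0 \<or> (\<exists>L. mset w = add_mset i L \<and> homog L y)" by blast
    have y: "mon [j] * y = 0 \<or> (\<exists>L. mset (j # w) = add_mset i L \<and> homog L (mon [j] * y))"
      using xy(4)
    proof (elim disjE exE conjE)
      fix L assume "mset w = add_mset i L" "homog L y"
      then show ?thesis
        using homog_mult [of "{#j#}" "mon [j]" L y] by auto
    qed simp
    have e: "mon (j # w) = mon [j] * x + (mon [j] * y) * mon [i]"
      by (simp add: mon_Cons [of j w] xy(1) distrib_left mult.assoc)
    show ?case
    proof (cases "j = i")
      case True
      have "mon (j # w) = ad i x + (sigma i x + mon [j] * y) * mon [i]"
        unfolding e by (simp add: True ad_def distrib_right)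
      moreover have "homog (mset w) (mon [j] * y)"
        using y True by auto
      ultimately show ?thesis
        using xy True ad_string_alg homog_ad [of _ x i] homog_sigma [of _ x i]
        by (intro exI [of _ "ad i x"] exI [of _ "sigma i x + mon [j] * y"])
          (auto intro: homog_add)
    next
      case False
      have "mon [j] * x \<in> string_alg i"
        using string_alg_mult [OF False xy(2), of 0] by simp
      moreover have "homog (mset (j # w)) (mon [j] * x)"
        using homog_mult [of "{#j#}" "mon [j]" "mset w" x] xy(3) by simp
      ultimately show ?thesis
        using e y by blast
    qed
  qed
  then obtain x y where "mon w = x + y * mon [i]" "x \<in> string_alg i" "homog (mset w) x"
    "y = 0 \<or> (\<exists>L. mset w = add_mset i L \<and> homog L y)" by blast
  then show ?case
    using mon by (intro exI [of _ "cst c * x"] exI [of _ "cst c * y"])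
      (auto simp: distrib_left mult.assoc homog_cst_mult intro: string_alg_cst)
next
  case (add p r)
  then obtain x y x' y' where *: "p = x + y * mon [i]" "x \<in> string_alg i" "homog M x"
    "y = 0 \<or> (\<exists>L. M = add_mset i L \<and> homog L y)"
    "r = x' + y' * mon [i]" "x' \<in> string_alg i" "homog M x'"
    "y' = 0 \<or> (\<exists>L. M = add_mset i L \<and> homog L y')" by blast
  then show ?case
    by (intro exI [of _ "x + x'"] exI [of _ "y + y'"])
      (auto simp: distrib_right homog_add intro: string_alg_add)
qed

lemma DR_homog_eq_0: "homog M p \<Longrightarrow> i \<notin># M \<Longrightarrow> DR i p = 0"
  by (rule homog_lin_eqI [of M p "DR i" "\<lambda>_. 0"]) (auto simp: DR_eq_0)

lemma radical_ideal: "two_sided_ideal radical"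
  by (simp add: two_sided_ideal_def radical_add radical_mult_left radical_mult_right)

end

section \<open>Cartan parameters and the ideal of Serre elements\<close>

locale cartan_braiding = braiding q for q :: "'i \<Rightarrow> 'i \<Rightarrow> 'k :: field" +
  fixes a :: "'i \<Rightarrow> 'i \<Rightarrow> int"
  assumes q_nonzero: "q i j \<noteq> 0"
    and q_cartan: "q i j * q j i = q i i powi a i j"
    and q_not_root: "m > 0 \<Longrightarrow> q i i ^ m \<noteq> 1"
    and cartan: "generalized_cartan_matrix a"
    and symm: "symmetrizable a"
begin

lemma q_diag_neq_1: "q i i \<noteq> 1"
  using q_not_root [where m = 1 and i = i] by simp

lemma cartan_entries: "i \<noteq> j \<Longrightarrow> a i j \<le> 0" "a i i = 2" "a i j = 0 \<longleftrightarrow> a j i = 0"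
  using cartan by (auto simp: generalized_cartan_matrix_def)

text \<open>The adjoint form of the Serre relation; \<open>adpow_letter\<close> recovers the
  coefficients of the defining relations.\<close>

definition serre :: "'i \<Rightarrow> 'i \<Rightarrow> 'i word \<Rightarrow>\<^sub>0 'k" where
  "serre i j = (ad i ^^ nat (1 - a i j)) (mon [j])"

inductive_set serre_ideal :: "('i word \<Rightarrow>\<^sub>0 'k) set" where
  serre_0: "0 \<in> serre_ideal"
| serre_gen: "i \<noteq> j \<Longrightarrow> u * serre i j * v \<in> serre_ideal"
| serre_add: "p \<in> serre_ideal \<Longrightarrow> r \<in> serre_ideal \<Longrightarrow> p + r \<in> serre_ideal"

lemma serre_ideal_ideal: "two_sided_ideal serre_ideal"
proof -
  have "u * p \<in> serre_ideal \<and> p * u \<in> serre_ideal" if "p \<in> serre_ideal" for p u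
    using that
  proof (induction rule: serre_ideal.induct)
    case (serre_gen i j u' v)
    then show ?case
      using serre_ideal.serre_gen [of i j "u * u'" v] serre_ideal.serre_gen [of i j u' "v * u"]
      by (simp add: mult.assoc)
  qed (auto simp: distrib_left distrib_right intro: serre_ideal.intros)
  then show ?thesis
    unfolding two_sided_ideal_def by (auto intro: serre_ideal.intros)
qed

lemmas serre_ideal_closed = two_sided_idealD [OF serre_ideal_ideal]

lemma serre_mem: "i \<noteq> j \<Longrightarrow> serre i j \<in> serre_ideal"
  using serre_gen [of i j 1 1] by simp

lemma homog_serre: "homog (add_mset j (replicate_mset (nat (1 - a i j)) i)) (serre i j)"
  using homog_adpow [of "{#j#}" "mon [j]" "nat (1 - a i j)" i] by (simp add: serre_def)

text \<open>For \<open>k = i\<close> the starting weight is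
  \<open>q i j * q j i = q i i powi a i j\<close>, and \<open>1 - a i j\<close> is the length at
  which the factor \<open>v - t * v ^ n\<close> in \<open>string_coeff_mult\<close> vanishes. For
  other \<open>k\<close> the derivative is an adjoint power of a constant.\<close>

lemma DL_serre:
  assumes "i \<noteq> j"
  shows "DL k (serre i j) = 0"
proof (cases "k = i")
  case False
  have "nat (1 - a i j) > 0" using cartan_entries(1) [OF assms] by simp
  then show ?thesis
    using False by (simp add: serre_def DL_adpow_other adpow_1)
next
  case True
  let ?n = "nat (1 - a i j)"
  have "q i i powi a i j * q i i ^ ?n = q i i powi (a i j + int ?n)"
    by (simp only: power_int_add q_nonzero power_int_of_nat simp_thms)
  also have "a i j + int ?n = 1" using cartan_entries(1) [OF assms] by simp
  finally have "(q i i - 1) * q i i * string_coeff (q i j * q j i) (q i i) ?n = 0"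
    by (simp add: string_coeff_mult q_cartan)
  then have "string_coeff (q i j * q j i) (q i i) ?n = 0"
    using q_diag_neq_1 q_nonzero by simp
  then show ?thesis
    using True assms DL_adpow_same [of "{#j#}" "mon [j]" i ?n] by (simp add: serre_def)
qed

lemma DL_serre_ideal: "p \<in> serre_ideal \<Longrightarrow> DL k p \<in> serre_ideal"
proof (induction rule: serre_ideal.induct)
  case (serre_gen i j u v)
  let ?s = "serre i j"
  have "DL k (u * ?s * v) = DL k u * ?s * v + cst (chr (add_mset j (replicate_mset (nat (1 - a i j)) i)) k)
      * tau k u * ?s * DL k v"
    by (simp add: DL_mult tau_mult DL_serre [OF serre_gen] tau_homog [OF homog_serre]
        cst_left_commute mult.assoc)
  then show ?case
    using serre_gen by (auto intro: serre_ideal.intros)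
qed (auto intro: serre_ideal.intros)

lemma serre_ideal_radical: "p \<in> serre_ideal \<Longrightarrow> p \<in> radical"
proof (erule radical_coinduct)
  show "eps p = 0" if "p \<in> serre_ideal" for p
    using that
    by (induction rule: serre_ideal.induct) (auto simp: eps_homog [OF homog_serre])
qed (rule DL_serre_ideal)

lemma ad_serre_ideal: "p \<in> serre_ideal \<Longrightarrow> ad i p \<in> serre_ideal"
proof (induction rule: serre_ideal.induct)
  case (serre_gen k j u v)
  let ?s = "serre k j"
  have s: "?s \<in> serre_ideal" by (rule serre_mem [OF serre_gen])
  have "sigma i ?s \<in> serre_ideal"
    by (simp add: sigma_homog [OF homog_serre] serre_ideal_closed(3) s)
  then show ?case
    using s by (auto simp: ad_def sigma_mult mult.assoc intro: serre_ideal_closed(3,4,6))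
qed (auto intro: serre_ideal.intros)

lemma adpow_serre_ideal: "p \<in> serre_ideal \<Longrightarrow> (ad i ^^ n) p \<in> serre_ideal"
  by (induction n) (auto simp: ad_serre_ideal)

lemma sigma_serre_ideal: "p \<in> serre_ideal \<Longrightarrow> sigma i p \<in> serre_ideal"
proof (induction rule: serre_ideal.induct)
  case (serre_gen k j u v)
  then show ?case
    by (auto simp: sigma_mult sigma_homog [OF homog_serre] mult.assoc
        intro: serre_ideal_closed(3,4) serre_mem)
qed (auto intro: serre_ideal.intros)

section \<open>Local nilpotency of the adjoint action\<close>

text \<open>Induction on \<open>m + n\<close> with one step of the skew product rule replaces a
  q-binomial expansion. Moving \<open>sigma i\<close> past the power costs only an invertible
  scalar.\<close>

lemma adpow_mult_mem:
  assumes "(ad i ^^ m) p \<in> serre_ideal" "(ad i ^^ n) r \<in> serre_ideal"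
  shows "(ad i ^^ (m + n)) (p * r) \<in> serre_ideal"
  using assms
proof (induction "m + n" arbitrary: m n p r)
  case 0
  then show ?case by (auto intro: serre_ideal_closed)
next
  case (Suc l)
  show ?case
  proof (cases "m = 0 \<or> n = 0")
    case True
    then show ?thesis
      using Suc.prems serre_ideal_closed(3) [of "(ad i ^^ 0) r" p] serre_ideal_closed(4) [of "(ad i ^^ 0) p" r]
      by (auto intro!: adpow_serre_ideal)
  next
    case False
    then obtain m' n' where mn: "m = Suc m'" "n = Suc n'"
      by (metis not0_implies_Suc)
    have l: "l = m' + n" "l = m + n'" using Suc.hyps(2) mn by auto
    have "(ad i ^^ l) (ad i p * r) \<in> serre_ideal"
      unfolding l(1) using Suc.prems mn
      by (intro Suc.hyps(1) l(1)) (auto simp: funpow_Suc_right simp del: funpow.simps)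
    moreover have "(ad i ^^ l) (sigma i p * ad i r) \<in> serre_ideal"
      unfolding l(2)
    proof (intro Suc.hyps(1) l(2))
      have "cst (q i i ^ m) * (ad i ^^ m) (sigma i p) \<in> serre_ideal"
        using sigma_serre_ideal [OF Suc.prems(1), of i] by (simp add: sigma_adpow)
      then show "(ad i ^^ m) (sigma i p) \<in> serre_ideal"
        by (rule two_sided_ideal_cst_cancel [OF serre_ideal_ideal]) (simp add: q_nonzero)
      show "(ad i ^^ n') (ad i r) \<in> serre_ideal"
        using Suc.prems mn by (auto simp: funpow_Suc_right simp del: funpow.simps)
    qed
    ultimately show ?thesis
      unfolding Suc.hyps(2) [symmetric]
      by (auto simp: funpow_Suc_right ad_mult serre_add simp del: funpow.simps)
  qed
qed

text \<open>On a generator, \<open>1 - a i j\<close> further applications of \<open>ad i\<close>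
  reach an adjoint power of a Serre element; products are handled by
  \<open>adpow_mult_mem\<close>.\<close>

lemma string_alg_nilpotent: "p \<in> string_alg i \<Longrightarrow> \<exists>n. (ad i ^^ n) p \<in> serre_ideal"
proof (induction rule: string_alg.induct)
  case string_alg_1
  show ?case by (intro exI [of _ 1]) (simp add: serre_0)
next
  case (string_alg_cst p c)
  then show ?case by (auto intro: serre_ideal_closed(3))
next
  case (string_alg_add p r)
  then obtain m n where mn: "(ad i ^^ m) p \<in> serre_ideal" "(ad i ^^ n) r \<in> serre_ideal"
    by blast
  have "(ad i ^^ (n + m)) p \<in> serre_ideal" "(ad i ^^ (m + n)) r \<in> serre_ideal"
    using adpow_serre_ideal [OF mn(1), of n i] adpow_serre_ideal [OF mn(2), of m i]
    by (simp_all add: funpow_add)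
  then have "(ad i ^^ (m + n)) (p + r) \<in> serre_ideal"
    by (simp add: serre_add add.commute)
  then show ?case by blast
next
  case (string_alg_mult j p m)
  then obtain n where n: "(ad i ^^ n) p \<in> serre_ideal" by blast
  have "(ad i ^^ nat (1 - a i j)) ((ad i ^^ m) (mon [j])) = (ad i ^^ m) (serre i j)"
    by (metis add.commute comp_apply funpow_add serre_def)
  then have "(ad i ^^ nat (1 - a i j)) ((ad i ^^ m) (mon [j])) \<in> serre_ideal"
    using string_alg_mult.hyps by (auto intro!: adpow_serre_ideal serre_mem)
  from adpow_mult_mem [OF this n] show ?case by blast
qed

lemma geometric_sum_nonzero: "n > 0 \<Longrightarrow> (\<Sum>k<n. q i i ^ k) \<noteq> 0"
  using q_not_root [where m = n and i = i] power_diff_1_eq [where x = "q i i" and n = n] by auto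

text \<open>Applying \<open>DR i\<close> turns the hypothesis for \<open>n\<close> and \<open>y\<close> into the one for \<open>Suc n\<close> and
  \<open>DR i y\<close>, which has smaller degree.\<close>

lemma radical_of_DR:
  assumes "homog M y" "n > 0"
    "cst (\<Sum>k<n. q i i ^ k) * y + cst (q i i ^ n) * (DR i y * mon [i]) \<in> radical"
  shows "y \<in> radical"
  using assms
proof (induction "size M" arbitrary: M y n)
  case 0
  then have y: "y = cst (eps y)" by (auto intro: cst_eps)
  then have "DR i y = 0" by (metis ops_cst(4))
  then show ?case
    using 0 two_sided_ideal_cst_cancel [OF radical_ideal] geometric_sum_nonzero by auto
next
  case (Suc l)
  let ?c = "\<lambda>n. \<Sum>k<n. q i i ^ k"
  have "DR i y \<in> radical"
  proof (cases "i \<in># M")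
    case True
    then obtain L where L: "M = add_mset i L" by (metis mset_add)
    have collect: "cst b * z + cst c * (z + cst d * t) = cst (b + c) * z + cst (c * d) * t"
      for b c d and z t :: "'i word \<Rightarrow>\<^sub>0 'k"
      by (simp add: cst_add distrib_left distrib_right cst_cst_mult)
    have DR_y_mon: "DR i (DR i y * mon [i]) = DR i y + cst (q i i) * (DR i (DR i y) * mon [i])"
      by (simp add: DR_mult cst_left_commute [of "DR i (DR i y)"])
    \<comment> \<open>Both summands contribute a multiple of \<open>DR i y\<close>, with scalars
      \<open>?c n\<close> and \<open>q i i ^ n\<close>; this is how the geometric sum grows to
      \<open>?c (Suc n)\<close>.\<close>
    have "DR i (cst (?c n) * y + cst (q i i ^ n) * (DR i y * mon [i])) =
        cst (?c (Suc n)) * DR i y + cst (q i i ^ Suc n) * (DR i (DR i y) * mon [i])"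
      using collect [of "?c n" "DR i y" "q i i ^ n" "q i i" "DR i (DR i y) * mon [i]"]
      by (simp only: ops_linear DR_y_mon sum.lessThan_Suc power_Suc2)
    then have "cst (?c (Suc n)) * DR i y + cst (q i i ^ Suc n) * (DR i (DR i y) * mon [i]) \<in> radical"
      using radical_DR [OF Suc.prems(3), of i] by (simp only:)
    moreover have "l = size L" "homog L (DR i y)"
      using Suc.hyps(2) Suc.prems(1) L by (simp_all add: homog_DR)
    ultimately show ?thesis
      using Suc.hyps(1) by blast
  next
    case False
    then show ?thesis using Suc.prems(1) by (simp add: DR_homog_eq_0)
  qed
  \<comment> \<open>With \<open>DR i y\<close> in the radical the second summand of the hypothesis
    can be subtracted, and the geometric sum is an invertible scalar.\<close>
  then have "cst (?c n) * y + cst (q i i ^ n) * (DR i y * mon [i]) -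
      cst (q i i ^ n) * (DR i y * mon [i]) \<in> radical"
    by (intro radical_diff Suc.prems(3) radical_cst_mult radical_mult_right)
  then show ?case
    using two_sided_ideal_cst_cancel [OF radical_ideal] geometric_sum_nonzero Suc.prems(2) by auto
qed

text \<open>In \<open>x = x0 + y * mon [i]\<close> the part \<open>x0\<close> is killed by
  \<open>DR i\<close>, so \<open>DR i x\<close> involves only \<open>y\<close> and puts it in the
  radical. By minimality \<open>y\<close> lies in the Serre ideal, and \<open>x\<close> inherits
  nilpotency from \<open>x0\<close>.\<close>

lemma adpow_nilpotent:
  assumes x: "homog M x" "x \<in> radical"
    and IH: "\<And>N p. size N < size M \<Longrightarrow> homog N p \<Longrightarrow> p \<in> radical \<Longrightarrow> p \<in> serre_ideal"
  shows "\<exists>n. (ad i ^^ n) x \<in> serre_ideal"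
proof -
  obtain x0 y where xy: "x = x0 + y * mon [i]" "x0 \<in> string_alg i"
    "y = 0 \<or> (\<exists>L. M = add_mset i L \<and> homog L y)"
    using string_alg_decomposition [OF x(1), of i] by blast
  have "DR i x = cst (\<Sum>k<1. q i i ^ k) * y + cst (q i i ^ 1) * (DR i y * mon [i])"
    by (simp add: xy(1) DR_string_alg [OF xy(2)] DR_mult cst_left_commute)
  then have "cst (\<Sum>k<1. q i i ^ k) * y + cst (q i i ^ 1) * (DR i y * mon [i]) \<in> radical"
    using radical_DR [OF x(2), of i] by simp
  then have "y \<in> serre_ideal"
    using xy(3) radical_of_DR [of _ y 1 i] IH [of _ y] serre_0 by force
  then have "y * mon [i] \<in> serre_ideal"
    by (rule serre_ideal_closed(4))
  moreover obtain n where "(ad i ^^ n) x0 \<in> serre_ideal"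
    using string_alg_nilpotent [OF xy(2)] by blast
  ultimately have "(ad i ^^ n) x \<in> serre_ideal"
    by (simp add: xy(1) serre_add adpow_serre_ideal)
  then show ?thesis ..
qed

text \<open>Take the least \<open>n\<close> with \<open>(ad i ^^ n) x\<close> in the Serre ideal. By
  minimality of the degree \<open>DL i x\<close> is in the ideal, so \<open>DL i\<close> brings that
  vector back to \<open>string_coeff\<close> times the previous power, which is outside. The
  coefficient vanishes, and since \<open>q i i\<close> is no root of unity the weight is
  \<open>q i i\<close> to the power \<open>1 - n\<close>.\<close>

lemma lowest_weight:
  assumes x: "homog M x" "x \<in> radical" "x \<notin> serre_ideal"
    and IH: "\<And>N p. size N < size M \<Longrightarrow> homog N p \<Longrightarrow> p \<in> radical \<Longrightarrow> p \<in> serre_ideal"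
  shows "\<exists>m. chi i M * chr M i * q i i ^ m = 1"
proof -
  define n where "n = (LEAST n. (ad i ^^ n) x \<in> serre_ideal)"
  have n: "(ad i ^^ n) x \<in> serre_ideal"
    using adpow_nilpotent [OF x(1,2) IH] unfolding n_def by (rule LeastI_ex)
  then have "n \<noteq> 0" using x(3) by (cases n) auto
  then have "(ad i ^^ (n - 1)) x \<notin> serre_ideal"
    unfolding n_def by (intro not_less_Least) simp
  let ?t = "chi i M * chr M i"
  have "DL i x \<in> serre_ideal"
  proof (cases "i \<in># M")
    case True
    then obtain L where "M = add_mset i L" by (metis mset_add)
    then show ?thesis using x by (intro IH [of L]) (auto simp: homog_DL radical_DL)
  next
    case False
    then show ?thesis using x(1) by (simp add: DL_homog_eq_0 serre_0)
  qed
  then have "cst (q i i ^ n) * (ad i ^^ n) (DL i x) \<in> serre_ideal"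
    by (intro serre_ideal_closed(3) adpow_serre_ideal)
  moreover have "DL i ((ad i ^^ n) x) \<in> serre_ideal"
    by (rule DL_serre_ideal [OF n])
  ultimately have "cst (string_coeff ?t (q i i) n) * (ad i ^^ (n - 1)) x \<in> serre_ideal"
    using serre_ideal_closed(6) [of "DL i ((ad i ^^ n) x)" "cst (q i i ^ n) * (ad i ^^ n) (DL i x)"]
    by (simp add: DL_adpow_same [OF x(1)])
  then have "string_coeff ?t (q i i) n = 0"
    using two_sided_ideal_cst_cancel [OF serre_ideal_ideal] \<open>(ad i ^^ (n - 1)) x \<notin> serre_ideal\<close>
    by blast
  then have "(q i i ^ n - 1) * (q i i - ?t * q i i ^ n) = 0"
    using string_coeff_mult [of "q i i" ?t n] by simp
  then have "q i i = ?t * q i i ^ n"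
    using q_not_root [where m = n and i = i] \<open>n \<noteq> 0\<close> by simp
  moreover obtain m where "n = Suc m" using \<open>n \<noteq> 0\<close> by (metis not0_implies_Suc)
  ultimately have "q i i * 1 = q i i * (?t * q i i ^ m)" by (simp add: mult_ac)
  then have "?t * q i i ^ m = 1" using q_nonzero by (metis mult_left_cancel)
  then show ?thesis ..
qed

end

context cartan_braiding
begin

section \<open>Radical elements with orthogonally decomposed support\<close>

lemma serre_commute:
  assumes "i \<noteq> j" "a i j = 0"
  shows "mon [i] * mon [j] - cst (q i j) * (mon [j] * mon [i]) \<in> serre_ideal"
  using serre_mem [OF assms(1)] assms(2) by (simp add: serre_def ad_def mult.assoc)

lemma letter_past_word:
  assumes "\<And>i. i \<in> set w \<Longrightarrow> i \<noteq> j \<and> a j i = 0"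
  shows "\<exists>c. mon [j] * mon w - cst c * (mon w * mon [j]) \<in> serre_ideal"
  using assms
proof (induction w)
  case Nil
  show ?case by (intro exI [of _ 1]) (simp add: serre_0)
next
  case (Cons i w)
  then obtain c where c: "mon [j] * mon w - cst c * (mon w * mon [j]) \<in> serre_ideal"
    by auto
  have "(mon [j] * mon [i] - cst (q j i) * (mon [i] * mon [j])) * mon w
      + cst (q j i) * mon [i] * (mon [j] * mon w - cst c * (mon w * mon [j])) \<in> serre_ideal"
    using Cons.prems [of i] c by (intro serre_add serre_ideal_closed(3,4) serre_commute) auto
  then have "mon [j] * mon (i # w) - cst (q j i * c) * (mon (i # w) * mon [j]) \<in> serre_ideal"
    by (simp add: mon_Cons [of i w] left_diff_distrib right_diff_distrib cst_simps)
  then show ?case by blast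
qed

text \<open>For orthogonal letters the Serre element is a q-commutator, so letters outside
  \<open>C\<close> can be moved to the right of those in \<open>C\<close> up to a scalar.\<close>

lemma word_partition:
  assumes orth: "\<And>i j. i \<in> C \<Longrightarrow> j \<notin> C \<Longrightarrow> a i j = 0"
  shows "\<exists>c. mon w - cst c * (mon (filter (\<lambda>i. i \<in> C) w) * mon (filter (\<lambda>i. i \<notin> C) w)) \<in> serre_ideal"
proof (induction w)
  case Nil
  show ?case by (intro exI [of _ 1]) (simp add: serre_0)
next
  case (Cons j w)
  let ?u = "mon (filter (\<lambda>i. i \<in> C) w)" and ?v = "mon (filter (\<lambda>i. i \<notin> C) w)"
  obtain c where c: "mon w - cst c * (?u * ?v) \<in> serre_ideal"
    using Cons by blast
  have 1: "mon [j] * mon w - cst c * (mon [j] * ?u * ?v) \<in> serre_ideal"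
    using serre_ideal_closed(3) [OF c, of "mon [j]"]
    by (simp add: right_diff_distrib cst_simps)
  show ?case
  proof (cases "j \<in> C")
    case True
    then show ?thesis
      using 1 by (auto simp: mon_Cons [of j w] mon_Cons [of j "filter _ w"])
  next
    case False
    have "i \<noteq> j \<and> a j i = 0" if "i \<in> set (filter (\<lambda>i. i \<in> C) w)" for i
      using that False orth [of i j] cartan_entries(3) [of i j] by auto
    then obtain d where d: "mon [j] * ?u - cst d * (?u * mon [j]) \<in> serre_ideal"
      using letter_past_word by blast
    have "(mon [j] * mon w - cst c * (mon [j] * ?u * ?v)) +
        cst c * ((mon [j] * ?u - cst d * (?u * mon [j])) * ?v) \<in> serre_ideal"
      by (intro serre_add 1 serre_ideal_closed(3,4) d)
    then have "mon (j # w) - cst (c * d) * (?u * mon (j # filter (\<lambda>i. i \<notin> C) w)) \<in> serre_ideal"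
      by (simp add: mon_Cons [of j w] mon_Cons [of j "filter _ w"] left_diff_distrib
          right_diff_distrib cst_simps)
    then show ?thesis
      using False by auto
  qed
qed

lemma DL_mult_right_orth: "i \<notin> set v \<Longrightarrow> DL i (p * mon v) = DL i p * mon v"
  by (simp add: DL_mult DL_eq_0)

lemma DW_mult_right_orth: "set w \<inter> set v = {} \<Longrightarrow> DW w (p * mon v) = DW w p * mon v"
  by (induction w arbitrary: p) (auto simp: DL_mult_right_orth)

text \<open>Sorting gives products of a word in \<open>C\<close> of degree \<open>M1\<close> and a
  word outside of degree \<open>M2\<close>. Derivations along words of degree \<open>M1\<close> see
  only the first factors. Expanding those along \<open>h\<close> is exact modulo the Serre ideal,
  because \<open>M1\<close> is smaller than \<open>M\<close>, and leaves the factors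
  \<open>DW w (P x)\<close>, which are radical of the smaller degree \<open>M2\<close>.\<close>

lemma radical_decomposable_mem:
  assumes orth: "\<And>i j. i \<in> C \<Longrightarrow> j \<notin> C \<Longrightarrow> a i j = 0"
    and ij: "i \<in># M" "i \<in> C" "j \<in># M" "j \<notin> C"
    and x: "homog M x" "x \<in> radical"
    and IH: "\<And>N p. size N < size M \<Longrightarrow> homog N p \<Longrightarrow> p \<in> radical \<Longrightarrow> p \<in> serre_ideal"
  shows "x \<in> serre_ideal"
proof -
  let ?f = "filter (\<lambda>i. i \<in> C)" and ?g = "filter (\<lambda>i. i \<notin> C)"
  obtain c where c: "\<And>w. mon w - cst (c w) * (mon (?f w) * mon (?g w)) \<in> serre_ideal"
    using word_partition [OF orth] by metis
  define P where "P = lift (\<lambda>w. cst (c w) * (mon (?f w) * mon (?g w)))"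
  have lin_P: "lin P" by (simp add: P_def)
  have P_diff: "p - P p \<in> serre_ideal" for p
  proof (induction p rule: falg_induct)
    case (mon d w)
    then show ?case
      using serre_ideal_closed(3) [OF c, of "cst d" w]
      by (simp add: P_def linD [OF lin_lift] right_diff_distrib)
  next
    case (add p r)
    then show ?case
      using serre_add [OF add] lin_P by (simp add: linD algebra_simps)
  qed
  obtain h where h: "\<And>w. homog (mset w) (h w)"
    "\<And>u. mon u - (\<Sum>w | mset w = mset u. cst (gram w u) * h w) \<in> radical"
    by (rule radical_projection) blast
  define M1 where "M1 = filter_mset (\<lambda>i. i \<in> C) M"
  define M2 where "M2 = filter_mset (\<lambda>i. i \<notin> C) M"
  have M: "M = M1 + M2" unfolding M1_def M2_def by simp
  have ne: "M1 \<noteq> {#}" "M2 \<noteq> {#}"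
    using ij by (auto simp: M1_def M2_def filter_mset_eq_conv)
  define A where "A = (\<lambda>p. P p - (\<Sum>w | mset w = M1. h w * DW w (P p)))"
  have lin_A: "lin A"
    unfolding A_def using lin_P by (intro lin_intros(4) lin_sum_fun) (auto simp: P_def)
  have A_mon: "A (mon v) \<in> serre_ideal" if v: "mset v = M" for v
  proof -
    let ?u = "?f v" and ?z = "?g v"
    have u: "mset ?u = M1" unfolding M1_def v [symmetric] by simp
    have "DW w (mon ?u * mon ?z) = cst (gram w ?u) * mon ?z" if w: "mset w = M1" for w
    proof -
      have "set w = set ?u" using w u by (metis set_mset_mset)
      then have "DW w (mon ?u * mon ?z) = DW w (mon ?u) * mon ?z"
        by (intro DW_mult_right_orth) auto
      moreover have "homog {#} (DW w (mon ?u))"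
        by (rule homog_DW) (simp only: homog_mon u w add_0_right)
      ultimately show ?thesis
        unfolding gram_def using cst_eps by metis
    qed
    then have "A (mon v) = cst (c v) * ((mon ?u - (\<Sum>w | mset w = M1. cst (gram w ?u) * h w)) * mon ?z)"
      by (simp add: A_def P_def left_diff_distrib right_diff_distrib sum_distrib_right
          sum_distrib_left cst_simps cst_left_commute [of "h w" for w] mult_ac)
    moreover have "mon ?u - (\<Sum>w | mset w = M1. cst (gram w ?u) * h w) \<in> serre_ideal"
    proof (rule IH)
      show "size M1 < size M" using ne by (simp add: M nonempty_has_size)
      show "homog M1 (mon ?u - (\<Sum>w | mset w = M1. cst (gram w ?u) * h w))"
        by (intro homog_diff homog_sum homog_cst_mult) (simp_all only: homog_mon u, metis h(1) mem_Collect_eq)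
      show "mon ?u - (\<Sum>w | mset w = M1. cst (gram w ?u) * h w) \<in> radical"
        using h(2) [of ?u] u by simp
    qed
    ultimately show ?thesis
      by (simp add: serre_ideal_closed(3,4))
  qed
  have "A x \<in> serre_ideal"
    using x(1)
  proof (induction rule: homog_induct)
    case zero
    then show ?case using lin_A by (simp add: lin_0 serre_0)
  next
    case (mon c w)
    then show ?case using A_mon lin_A by (simp add: linD serre_ideal_closed(3))
  next
    case (add p r)
    then show ?case using lin_A by (simp add: linD serre_add)
  qed
  moreover have "(\<Sum>w | mset w = M1. h w * DW w (P x)) \<in> serre_ideal"
  proof (intro two_sided_ideal_sum [OF serre_ideal_ideal] serre_ideal_closed(3))
    fix w assume "w \<in> {w. mset w = M1}"
    then have w: "mset w = M1" by simp
    have "x - (x - P x) \<in> radical"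
      by (intro radical_diff x serre_ideal_radical P_diff)
    then have Px: "P x \<in> radical" by simp
    have "homog M (P x)"
    proof (rule homog_lin [OF x(1) lin_P])
      fix v assume v: "mset v = M"
      have "mset (?f v @ ?g v) = M"
        using v by (metis mset_append mset_filter multiset_partition)
      then show "homog M (P (mon v))"
        by (simp add: P_def homog_cst_mult flip: mon_append)
    qed
    then have "homog M2 (DW w (P x))"
      by (intro homog_DW) (simp add: w M)
    then show "DW w (P x) \<in> serre_ideal"
      using ne by (intro IH [of M2] radical_DW Px) (auto simp: M nonempty_has_size)
  qed
  ultimately have "A x + (\<Sum>w | mset w = M1. h w * DW w (P x)) \<in> serre_ideal"
    by (rule serre_add)
  then have "P x \<in> serre_ideal"
    by (simp add: A_def)
  then show ?thesis
    using serre_add [OF P_diff [of x], of "P x"] by simp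
qed

section \<open>The radical is the Serre ideal\<close>

lemma weight_powi:
  "chi i M * chr M i = q i i powi (\<Sum>j\<in>#M. a i j)"
  by (induction M) (simp_all add: power_int_add q_nonzero q_cartan [symmetric] mult_ac)

section \<open>Comparing powers of the \<open>q i i\<close>\<close>

definition symmetrizer :: "'i \<Rightarrow> nat" where
  "symmetrizer = (SOME d. (\<forall>i. d i > 0) \<and> (\<forall>i j. int (d i) * a i j = int (d j) * a j i))"

lemma symmetrizer: "symmetrizer i > 0" "int (symmetrizer i) * a i j = int (symmetrizer j) * a j i"
proof -
  obtain d :: "'i \<Rightarrow> int" where "\<forall>i. d i > 0" "\<forall>i j. d i * a i j = d j * a j i"
    using symm by (auto simp: symmetrizable_def)
  then have "\<exists>d. (\<forall>i. d i > (0 :: nat)) \<and> (\<forall>i j. int (d i) * a i j = int (d j) * a j i)"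
    by (intro exI [of _ "\<lambda>i. nat (d i)"]) (auto simp: less_imp_le)
  from someI_ex [OF this] show "symmetrizer i > 0"
    "int (symmetrizer i) * a i j = int (symmetrizer j) * a j i"
    unfolding symmetrizer_def by blast+
qed

text \<open>Along a connected component of the Cartan matrix, \<open>q i i\<close> is up to a root of unity
  the power \<open>symmetrizer i\<close> of a common element.\<close>

definition commensurable :: "'i \<Rightarrow> 'i set" where
  "commensurable k = {j. \<exists>m>0. q j j ^ (m * symmetrizer k) = q k k ^ (m * symmetrizer j)}"

text \<open>Closure under adjacency: \<open>q i i powi a i j\<close> and
  \<open>q j j powi a j i\<close> both equal \<open>q i j * q j i\<close>, and the symmetrizer
  matches these exponents. The relation to \<open>q k k\<close> thus passes from \<open>i\<close> to
  a neighbour \<open>j\<close>, at the price of a factor in the exponent.\<close>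

lemma commensurable_orth:
  assumes i: "i \<in> commensurable k" and j: "j \<notin> commensurable k"
  shows "a i j = 0"
proof (rule ccontr)
  assume nz: "a i j \<noteq> 0"
  have "i \<noteq> j" using i j by auto
  then have neg: "a i j < 0" "a j i < 0"
    using nz cartan_entries(1,3) [of i j] cartan_entries(1) [of j i] by auto
  define m n where "m = nat (- a i j)" and "n = nat (- a j i)"
  have mn: "m > 0" "n > 0" "a i j = - int m" "a j i = - int n"
    using neg by (auto simp: m_def n_def)
  have "q i i powi a i j = q j j powi a j i"
    using q_cartan [of i j] q_cartan [of j i] by (simp add: mult.commute)
  then have 1: "q i i ^ m = q j j ^ n"
    by (simp add: mn power_int_minus)
  have "int (symmetrizer i * m) = int (symmetrizer j * n)"
    using symmetrizer(2) [of i j] mn by simp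
  then have 2: "symmetrizer i * m = symmetrizer j * n" by linarith
  obtain l where l: "l > 0" "q i i ^ (l * symmetrizer k) = q k k ^ (l * symmetrizer i)"
    using i by (auto simp: commensurable_def)
  have "q j j ^ (l * n * symmetrizer k) = (q j j ^ n) ^ (l * symmetrizer k)"
    by (simp add: power_mult [symmetric] mult_ac)
  also have "\<dots> = (q i i ^ (l * symmetrizer k)) ^ m"
    unfolding 1 [symmetric] by (simp add: power_mult [symmetric] mult_ac)
  also have "\<dots> = q k k ^ (l * (symmetrizer i * m))"
    unfolding l(2) by (simp add: power_mult [symmetric] mult_ac)
  also have "\<dots> = q k k ^ (l * n * symmetrizer j)"
    unfolding 2 by (simp add: mult_ac)
  finally have "j \<in> commensurable k"
    using l(1) mn(2) by (auto simp: commensurable_def intro!: exI [of _ "l * n"])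
  then show False using j by simp
qed

theorem radical_subset_serre_ideal:
  assumes "homog M x" "x \<in> radical"
  shows "x \<in> serre_ideal"
  using assms
proof (induction "size M" arbitrary: M x rule: less_induct)
  case less
  have IH: "p \<in> serre_ideal" if "size N < size M" "homog N p" "p \<in> radical" for N p
    using less.hyps that by blast
  show ?case
  proof (rule ccontr)
    assume x: "x \<notin> serre_ideal"
    have "M \<noteq> {#}"
      using less.prems x cst_eps [of x] radical_eps [of x] serre_0 by auto
    then obtain k where k: "k \<in># M" by blast
    obtain v where v: "mset v = M" by (metis ex_mset)
    let ?D = symmetrizer
    \<comment> \<open>\<open>m i\<close> takes the place of \<open>- n_i\<close> and keeps the later
      exponents natural numbers.\<close>
    have "\<exists>m. q i i powi (\<Sum>j\<in>#M. a i j) * q i i ^ m = 1" for i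
      using lowest_weight [OF less.prems x IH, where i = i] by (simp add: weight_powi)
    then obtain m where m: "\<And>i. q i i powi (\<Sum>j\<in>#M. a i j) * q i i ^ m i = 1"
      by metis
    have "full_twist v = 1"
      using less.prems x \<open>M \<noteq> {#}\<close> v q_nonzero IH
      by (intro full_twist_eq_1 [OF serre_ideal_ideal]) auto
    \<comment> \<open>This is \<open>full_twist_square\<close> with twist 1. Multiplication by the
      powers \<open>m i\<close> then cancels all weights on the right.\<close>
    then have "(\<Prod>j\<in>#M. q j j) ^ 2 = (\<Prod>i\<in>#M. q i i powi (\<Sum>j\<in>#M. a i j))"
      using full_twist_square [of v] v by (simp add: weight_powi)
    then have "(\<Prod>i\<in>#M. q i i ^ (2 + m i)) =
        (\<Prod>i\<in>#M. q i i powi (\<Sum>j\<in>#M. a i j) * q i i ^ m i)"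
      by (simp add: power_add prod_mset.distrib power2_eq_square)
    then have prod1: "(\<Prod>i\<in>#M. q i i ^ (2 + m i)) = 1"
      by (simp add: m)
    have kk: "k \<in> commensurable k"
      by (auto simp: commensurable_def)
    \<comment> \<open>Otherwise the support splits into two nonempty orthogonal pieces, one of them
      inside \<open>commensurable k\<close>.\<close>
    have "j \<in> commensurable k" if j: "j \<in># M" for j
    proof (rule ccontr)
      assume "j \<notin> commensurable k"
      from radical_decomposable_mem [OF commensurable_orth k kk j this less.prems IH]
      show False using x by simp
    qed
    then obtain e where e: "\<And>j. j \<in># M \<Longrightarrow> e j > 0"
      "\<And>j. j \<in># M \<Longrightarrow> q j j ^ (e j * ?D k) = q k k ^ (e j * ?D j)"
      unfolding commensurable_def by simp metis
    \<comment> \<open>A common multiple of the exponents \<open>e j\<close>, so that one power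
      serves all letters of \<open>M\<close>.\<close>
    define P where "P = (\<Prod>j\<in>set_mset M. e j)"
    have P: "P > 0" using e(1) by (simp add: P_def prod_pos)
    have qP: "q j j ^ (P * ?D k) = q k k ^ (P * ?D j)" if j: "j \<in># M" for j
    proof -
      obtain r where r: "P = e j * r"
        using dvd_prodI [of "set_mset M" j e] j unfolding P_def by (auto elim: dvdE)
      have "q j j ^ (P * ?D k) = (q j j ^ (e j * ?D k)) ^ r"
        by (simp add: r power_mult [symmetric] mult_ac)
      also have "\<dots> = q k k ^ (P * ?D j)"
        unfolding e(2) [OF j] by (simp add: r power_mult [symmetric] mult_ac)
      finally show ?thesis .
    qed
    \<comment> \<open>Raising to \<open>P * ?D k\<close> turns every factor into a power of
      \<open>q k k\<close>; the occurrence of \<open>k\<close> in \<open>M\<close> makes the total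
      exponent positive.\<close>
    have "1 = (\<Prod>i\<in>#M. q i i ^ (2 + m i)) ^ (P * ?D k)"
      by (simp only: prod1 power_one)
    also have "\<dots> = (\<Prod>i\<in>#M. (q i i ^ (P * ?D k)) ^ (2 + m i))"
      by (induction M) (simp_all only: image_mset_empty image_mset_add_mset prod_mset.empty
          prod_mset.add_mset power_mult_distrib power_one power_mult [symmetric] mult_ac)
    also have "\<dots> = (\<Prod>i\<in>#M. q k k ^ (P * ?D i * (2 + m i)))"
      by (intro arg_cong [of _ _ prod_mset] image_mset_cong) (simp only: qP power_mult [symmetric])
    also have "\<dots> = q k k ^ (\<Sum>i\<in>#M. P * ?D i * (2 + m i))"
      by (induction M) (simp_all add: power_add)
    finally have "q k k ^ (\<Sum>i\<in>#M. P * ?D i * (2 + m i)) = 1" ..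
    moreover have "(\<Sum>i\<in>#M. P * ?D i * (2 + m i)) > 0"
      using k P symmetrizer(1) [of k] by (auto dest!: multi_member_split)
    ultimately show False
      using q_not_root by blast
  qed
qed

section \<open>The Serre elements in coordinates\<close>

lemma qint_nonzero: "n > 0 \<Longrightarrow> qint (q i i) n \<noteq> 0"
  using q_not_root [where m = n and i = i] q_diag_neq_1 [of i] by (simp add: qint_def)

lemma qfact_nonzero: "qfact (q i i) n \<noteq> 0"
  by (auto simp: qfact_def qint_nonzero)

lemma qbinom_0: "qbinom (q i i) n 0 = 1" and qbinom_self: "qbinom (q i i) n n = 1"
  using qfact_nonzero [of i n] by (simp_all add: qbinom_def) (simp_all add: qfact_def)

lemma qfact_Suc: "qfact v (Suc n) = qint v (Suc n) * qfact v n"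
  by (simp add: qfact_def mult.commute)

text \<open>One of the two q-Pascal rules. The case \<open>k = n\<close> is excluded because
  truncated subtraction makes \<open>qbinom v n (Suc n)\<close> nonzero;
  \<open>serre_term_top\<close> treats that end separately.\<close>

lemma qbinom_Suc:
  assumes "k < n"
  shows "qbinom (q i i) (Suc n) (Suc k) =
    qbinom (q i i) n (Suc k) + q i i ^ (n - k) * qbinom (q i i) n k"
proof -
  let ?v = "q i i"
  obtain l where l: "n = k + Suc l" using assms by (metis less_imp_Suc_add add_Suc_right)
  have nz: "qfact ?v k \<noteq> 0" "qfact ?v l \<noteq> 0" "qint ?v (Suc k) \<noteq> 0" "qint ?v (Suc l) \<noteq> 0"
    by (simp_all add: qfact_nonzero qint_nonzero)
  have int: "qint ?v (Suc n) = qint ?v (Suc l) + ?v ^ Suc l * qint ?v (Suc k)"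
  proof -
    have "?v ^ Suc n - 1 = (?v ^ Suc l - 1) + ?v ^ Suc l * (?v ^ Suc k - 1)"
      by (simp add: l power_add algebra_simps)
    then show ?thesis
      unfolding qint_def by (simp only: add_divide_distrib times_divide_eq_right)
  qed
  have "qbinom ?v (Suc n) (Suc k) = qint ?v (Suc n) * qfact ?v n /
      (qint ?v (Suc k) * qfact ?v k * (qint ?v (Suc l) * qfact ?v l))"
    by (simp add: qbinom_def l qfact_Suc)
  also have "\<dots> = qfact ?v n / (qint ?v (Suc k) * qfact ?v k * qfact ?v l) +
      ?v ^ Suc l * (qfact ?v n / (qfact ?v k * (qint ?v (Suc l) * qfact ?v l)))"
    unfolding int using nz by (simp add: field_simps del: power_Suc)
  also have "\<dots> = qbinom ?v n (Suc k) + ?v ^ (n - k) * qbinom ?v n k"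
    by (simp add: qbinom_def l qfact_Suc del: power_Suc)
  finally show ?thesis .
qed

lemma qbinom_sym: "k \<le> n \<Longrightarrow> qbinom v n (n - k) = qbinom v n k"
  by (simp add: qbinom_def mult.commute)

text \<open>The coefficients of the defining relations with the length \<open>n\<close> set free, so
  that an induction on \<open>n\<close> is possible.\<close>

definition serre_term :: "'i \<Rightarrow> 'i \<Rightarrow> nat \<Rightarrow> nat \<Rightarrow> 'k" where
  "serre_term i j n k = (- 1) ^ k * qbinom (q i i) n k * q i i ^ (k * (k - 1) div 2) * q i j ^ k"

lemma triangular_Suc: "Suc k * (Suc k - 1) div 2 = k * (k - 1) div 2 + k"
proof -
  have "Suc k * (Suc k - 1) = k * (k - 1) + k * 2" by (cases k) simp_all
  then show ?thesis by simp
qed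

lemma serre_term_Suc:
  assumes "k < n"
  shows "serre_term i j (Suc n) (Suc k) =
    serre_term i j n (Suc k) - q i i ^ n * q i j * serre_term i j n k"
proof -
  have "q i i ^ n = q i i ^ (n - k) * q i i ^ k"
    using assms by (simp flip: power_add)
  then show ?thesis
    unfolding serre_term_def triangular_Suc qbinom_Suc [OF assms]
    by (simp add: power_add algebra_simps)
qed

lemma serre_term_0: "serre_term i j n 0 = 1"
  by (simp add: serre_term_def qbinom_0)

lemma serre_term_top: "serre_term i j (Suc n) (Suc n) = - (q i i ^ n * q i j * serre_term i j n n)"
  unfolding serre_term_def triangular_Suc qbinom_self by (simp add: power_add algebra_simps)

text \<open>Each \<open>ad i\<close> adds a letter at the left or, with scalar
  \<open>- q i i ^ n * q i j\<close>, at the right; collecting terms gives the recursion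
  \<open>serre_term_Suc\<close>.\<close>

lemma adpow_letter:
  "(ad i ^^ n) (mon [j]) =
    (\<Sum>k\<le>n. cst (serre_term i j n k) * (mon (replicate (n - k) i) * mon [j] * mon (replicate k i)))"
proof (induction n)
  case 0
  then show ?case by (simp add: serre_term_0)
next
  case (Suc n)
  let ?w = "\<lambda>n k. mon (replicate (n - k) i) * mon [j] * mon (replicate k i) :: 'i word \<Rightarrow>\<^sub>0 'k"
  have rep: "mon (replicate (Suc m) i) = mon [i] * mon (replicate m i)"
    "mon (replicate m i) * mon [i] = mon (replicate (Suc m) i)" for m
    by (simp_all flip: mon_append add: replicate_append_same)
  have chi_rep: "chi i (replicate_mset m i) = q i i ^ m" for m
    by (induction m) simp_all
  have ad_w: "ad i (?w n k) = ?w (Suc n) k - cst (q i i ^ n * q i j) * ?w (Suc n) (Suc k)"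
    if "k \<le> n" for k
  proof -
    have "sigma i (?w n k) = cst (q i i ^ n * q i j) * ?w n k"
      by (simp add: that sigma_mon chi_rep mult_ac flip: mon_append power_add)
    moreover have "mon [i] * ?w n k = ?w (Suc n) k"
      using that by (simp add: rep(1) Suc_diff_le mult.assoc del: replicate_Suc)
    moreover have "?w n k * mon [i] = ?w (Suc n) (Suc k)"
      by (simp add: rep(2) mult.assoc del: replicate_Suc)
    ultimately show ?thesis
      by (simp add: ad_def mult.assoc)
  qed
  have "(ad i ^^ Suc n) (mon [j]) = (\<Sum>k\<le>n. cst (serre_term i j n k) * ad i (?w n k))"
    by (simp add: Suc lin_sum)
  also have "\<dots> = (\<Sum>k\<le>n. cst (serre_term i j n k) * ?w (Suc n) k) -
      (\<Sum>k\<le>n. cst (q i i ^ n * q i j * serre_term i j n k) * ?w (Suc n) (Suc k))"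
    by (simp add: ad_w right_diff_distrib sum_subtractf cst_cst_mult mult.commute [of "serre_term i j n k" for k]
        cong: sum.cong_simp)
  also have "(\<Sum>k\<le>n. cst (serre_term i j n k) * ?w (Suc n) k) = ?w (Suc n) 0 +
      (\<Sum>k<n. cst (serre_term i j n (Suc k)) * ?w (Suc n) (Suc k))"
    by (cases n) (simp_all add: sum.atMost_Suc_shift serre_term_0 lessThan_Suc_atMost
        del: sum.atMost_Suc replicate_Suc diff_Suc_Suc)
  also have "(\<Sum>k\<le>n. cst (q i i ^ n * q i j * serre_term i j n k) * ?w (Suc n) (Suc k)) =
      (\<Sum>k<n. cst (q i i ^ n * q i j * serre_term i j n k) * ?w (Suc n) (Suc k)) -
      cst (serre_term i j (Suc n) (Suc n)) * ?w (Suc n) (Suc n)"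
    by (simp add: serre_term_top cst_uminus lessThan_Suc_atMost [symmetric] del: replicate_Suc)
  also have "?w (Suc n) 0 + (\<Sum>k<n. cst (serre_term i j n (Suc k)) * ?w (Suc n) (Suc k)) -
      ((\<Sum>k<n. cst (q i i ^ n * q i j * serre_term i j n k) * ?w (Suc n) (Suc k)) -
        cst (serre_term i j (Suc n) (Suc n)) * ?w (Suc n) (Suc n)) =
      ?w (Suc n) 0 + (\<Sum>k<n. cst (serre_term i j (Suc n) (Suc k)) * ?w (Suc n) (Suc k)) +
      cst (serre_term i j (Suc n) (Suc n)) * ?w (Suc n) (Suc n)"
    by (simp add: serre_term_Suc cst_diff left_diff_distrib sum_subtractf cong: sum.cong_simp
        del: replicate_Suc diff_Suc_Suc)
  also have "\<dots> = (\<Sum>k\<le>Suc n. cst (serre_term i j (Suc n) k) * ?w (Suc n) k)"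
    by (subst sum.atMost_Suc_shift)
      (simp add: serre_term_0 lessThan_Suc_atMost [symmetric] add.assoc
        del: replicate_Suc diff_Suc_Suc sum.atMost_Suc)
  finally show ?case .
qed

text \<open>Reversing the Serre element of the transposed parameters gives a multiple of the
  Serre element, which relates the two families of Serre relations.\<close>

lemma serre_term_transpose:
  assumes "i \<noteq> j" and n: "n = nat (1 - a i j)" and k: "k \<le> n"
  shows "serre_term i j n (n - k) =
    serre_term i j n n * ((- 1) ^ k * qbinom (q i i) n k * q i i ^ (k * (k - 1) div 2) * q j i ^ k)"
proof -
  let ?C = "\<lambda>m :: nat. m * (m - 1) div 2"
  obtain l where l: "n = k + l" using k by (metis le_iff_add)
  have C2: "2 * ?C m = m * (m - 1)" for m by (cases m) auto
  have "k * (k - 1) + n * (n - 1) = l * (l - 1) + 2 * ((n - 1) * k)"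
    unfolding l by (cases k; cases l) (simp_all add: algebra_simps)
  then have C: "?C n + ?C k = ?C l + (n - 1) * k"
    using C2 [of n] C2 [of k] C2 [of l] by linarith
  have "n > 0" "int (n - 1) = - a i j"
    using cartan_entries(1) [OF assms(1)] by (auto simp: n)
  then have "q i i ^ (n - 1) * (q i j * q j i) = 1"
    unfolding q_cartan power_int_of_nat [symmetric]
    by (simp add: q_nonzero power_int_add [symmetric] del: power_int_of_nat)
  \<comment> \<open>The inserted factor is a power of 1, as \<open>n - 1 = - a i j\<close>; by
    \<open>C\<close> the triangular exponents then match.\<close>
  then have "q i i ^ ?C l = q i i ^ ?C l * (q i i ^ (n - 1) * (q i j * q j i)) ^ k"
    by simp
  also have "\<dots> = q i i ^ (?C l + (n - 1) * k) * (q i j ^ k * q j i ^ k)"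
    by (simp add: power_mult_distrib power_add mult_ac flip: power_mult)
  also have "\<dots> = q i i ^ ?C n * q i i ^ ?C k * (q i j ^ k * q j i ^ k)"
    unfolding C [symmetric] power_add ..
  finally have q: "q i i ^ ?C l = q i i ^ ?C n * q i i ^ ?C k * (q i j ^ k * q j i ^ k)" .
  have b: "qbinom (q i i) n (n - k) = qbinom (q i i) n k" by (rule qbinom_sym [OF k])
  have sgn: "(- 1 :: 'k) ^ n * (- 1) ^ k = (- 1) ^ (n - k)"
    by (simp add: l power_add mult_ac flip: power_mult_distrib)
  have nk: "n - k = l" by (simp add: l)
  have "q i j ^ n = q i j ^ k * q i j ^ l" by (simp add: l power_add)
  then show ?thesis
    unfolding serre_term_def qbinom_self b sgn [symmetric] unfolding nk q
    by (simp add: mult_ac)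
qed

end

section \<open>Quotients of type rings\<close>

abbreviation type_ring :: "'b :: ring_1 ring" where
  "type_ring \<equiv> ring_of_type_algebra"

lemma type_ring_simps [simp]:
  "carrier type_ring = UNIV" "x \<oplus>\<^bsub>type_ring\<^esub> y = x + y" "x \<otimes>\<^bsub>type_ring\<^esub> y = x * y"
  "\<one>\<^bsub>type_ring\<^esub> = 1" "\<zero>\<^bsub>type_ring\<^esub> = 0"
  by (simp_all add: ring_of_type_algebra_def)

lemma type_ring_a_inv [simp]: "\<ominus>\<^bsub>type_ring\<^esub> x = - x"
proof -
  interpret ring "type_ring :: 'a ring" by (rule ring_type_algebra)
  show ?thesis by (rule minus_equality) auto
qed

lemma type_ring_minus [simp]: "x \<ominus>\<^bsub>type_ring\<^esub> y = x - y"
  by (simp add: a_minus_def)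

lemma type_ring_idealD:
  assumes "ideal I type_ring"
  shows "0 \<in> I" "p \<in> I \<Longrightarrow> r \<in> I \<Longrightarrow> p + r \<in> I" "p \<in> I \<Longrightarrow> u * p \<in> I" "p \<in> I \<Longrightarrow> p * u \<in> I"
proof -
  interpret ideal I type_ring by (rule assms)
  show "0 \<in> I" using additive_subgroup.zero_closed [OF ideal.axioms(1) [OF assms]] by simp
  show "p \<in> I \<Longrightarrow> r \<in> I \<Longrightarrow> p + r \<in> I"
    using additive_subgroup.a_closed [OF ideal.axioms(1) [OF assms]] by simp
  show "p \<in> I \<Longrightarrow> u * p \<in> I" using I_l_closed [of p u] by simp
  show "p \<in> I \<Longrightarrow> p * u \<in> I" using I_r_closed [of p u] by simp
qed

lemma ideal_genideal_type_ring: "ideal (genideal type_ring G) type_ring"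
  by (intro ring.genideal_ideal ring_type_algebra) simp

lemma genideal_superset: "G \<subseteq> genideal type_ring G"
  by (intro ring.genideal_self ring_type_algebra) simp

lemma coset_simps:
  assumes "ideal I type_ring"
  shows "(I +>\<^bsub>type_ring\<^esub> p) \<oplus>\<^bsub>type_ring Quot I\<^esub> (I +>\<^bsub>type_ring\<^esub> r) = I +>\<^bsub>type_ring\<^esub> (p + r)"
    "(I +>\<^bsub>type_ring\<^esub> p) \<otimes>\<^bsub>type_ring Quot I\<^esub> (I +>\<^bsub>type_ring\<^esub> r) = I +>\<^bsub>type_ring\<^esub> (p * r)"
    "\<one>\<^bsub>type_ring Quot I\<^esub> = I +>\<^bsub>type_ring\<^esub> 1"
    "\<zero>\<^bsub>type_ring Quot I\<^esub> = I +>\<^bsub>type_ring\<^esub> 0"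
    "I +>\<^bsub>type_ring\<^esub> p \<in> carrier (type_ring Quot I)"
    "I +>\<^bsub>type_ring\<^esub> p = I +>\<^bsub>type_ring\<^esub> r \<longleftrightarrow> p - r \<in> I"
proof -
  interpret I: ideal I type_ring by (rule assms)
  interpret h: ring_hom_ring type_ring "type_ring Quot I" "(+>\<^bsub>type_ring\<^esub>) I"
    by (rule I.rcos_ring_hom_ring)
  show "(I +>\<^bsub>type_ring\<^esub> p) \<oplus>\<^bsub>type_ring Quot I\<^esub> (I +>\<^bsub>type_ring\<^esub> r) = I +>\<^bsub>type_ring\<^esub> (p + r)"
    using h.hom_add [of p r] by simp
  show "(I +>\<^bsub>type_ring\<^esub> p) \<otimes>\<^bsub>type_ring Quot I\<^esub> (I +>\<^bsub>type_ring\<^esub> r) = I +>\<^bsub>type_ring\<^esub> (p * r)"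
    using h.hom_mult [of p r] by simp
  show "\<one>\<^bsub>type_ring Quot I\<^esub> = I +>\<^bsub>type_ring\<^esub> 1"
    using h.hom_one by simp
  show "\<zero>\<^bsub>type_ring Quot I\<^esub> = I +>\<^bsub>type_ring\<^esub> 0"
    using h.hom_zero by simp
  show "I +>\<^bsub>type_ring\<^esub> p \<in> carrier (type_ring Quot I)"
    using h.hom_closed by simp
  show "I +>\<^bsub>type_ring\<^esub> p = I +>\<^bsub>type_ring\<^esub> r \<longleftrightarrow> p - r \<in> I"
    using I.quotient_eq_iff_same_a_r_cos [OF assms, of p r] by simp
qed

section \<open>The quantum group as a quotient\<close>

context
  fixes a :: "'i \<Rightarrow> 'i \<Rightarrow> int" and q :: "'i \<Rightarrow> 'i \<Rightarrow> 'k :: field"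
begin

abbreviation "cls \<equiv> Uq_class a q"

definition "cls2 p = Uq2_ideal a q +>\<^bsub>type_ring\<^esub> p"

lemma Uq_ideal_ideal: "ideal (Uq_ideal a q) type_ring"
  unfolding Uq_ideal_def by (rule ideal_genideal_type_ring)

lemma Uq2_ideal_ideal: "ideal (Uq2_ideal a q) type_ring"
  unfolding Uq2_ideal_def by (rule ideal_genideal_type_ring)

lemmas cls_add = coset_simps(1) [OF Uq_ideal_ideal, folded Uq_def Uq_class_def]
  and cls_mult = coset_simps(2) [OF Uq_ideal_ideal, folded Uq_def Uq_class_def]
  and cls_one = coset_simps(3) [OF Uq_ideal_ideal, folded Uq_def Uq_class_def]
  and cls_zero = coset_simps(4) [OF Uq_ideal_ideal, folded Uq_def Uq_class_def]
  and cls_closed = coset_simps(5) [OF Uq_ideal_ideal, folded Uq_def Uq_class_def]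
  and cls_eq_iff = coset_simps(6) [OF Uq_ideal_ideal, folded Uq_class_def]

lemmas cls2_add = coset_simps(1) [OF Uq2_ideal_ideal, folded Uq2_def cls2_def]
  and cls2_mult = coset_simps(2) [OF Uq2_ideal_ideal, folded Uq2_def cls2_def]
  and cls2_one = coset_simps(3) [OF Uq2_ideal_ideal, folded Uq2_def cls2_def]
  and cls2_zero = coset_simps(4) [OF Uq2_ideal_ideal, folded Uq2_def cls2_def]
  and cls2_closed = coset_simps(5) [OF Uq2_ideal_ideal, folded Uq2_def cls2_def]
  and cls2_eq_iff = coset_simps(6) [OF Uq2_ideal_ideal, folded cls2_def]

lemma fgen_mon: "fgen g = mon [g]"
  by (simp add: fgen_def mon_def)

lemma fconst_cst: "fconst c = cst c"
  by (simp add: fconst_def cst_def)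

lemma ugen_cls: "ugen a q g = cls (mon [g])"
  by (simp add: ugen_def fgen_mon)

lemma uconst_cls: "uconst a q c = cls (cst c)"
  by (simp add: uconst_def fconst_cst)

lemma cls_finsum: "finite A \<Longrightarrow> (\<Oplus>\<^bsub>Uq a q\<^esub>x\<in>A. cls (f x)) = cls (\<Sum>x\<in>A. f x)"
proof (induction A rule: finite_induct)
  case empty
  interpret ring "Uq a q" by (rule Uq_ring)
  show ?case by (simp add: cls_zero)
next
  case (insert x A)
  interpret ring "Uq a q" by (rule Uq_ring)
  show ?case
    using insert by (simp add: finsum_insert cls_closed cls_add)
qed

lemma cls2_finsum: "finite A \<Longrightarrow> (\<Oplus>\<^bsub>Uq2 a q\<^esub>x\<in>A. cls2 (f x)) = cls2 (\<Sum>x\<in>A. f x)"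
proof (induction A rule: finite_induct)
  case empty
  interpret ring "Uq2 a q" by (rule Uq2_ring)
  show ?case by (simp add: cls2_zero)
next
  case (insert x A)
  interpret ring "Uq2 a q" by (rule Uq2_ring)
  show ?case
    using insert by (simp add: finsum_insert cls2_closed cls2_add)
qed

section \<open>Pure tensors and the coproduct of a word\<close>

lemma ftensor_superset:
  assumes "finite V" "finite W" "Poly_Mapping.keys p \<subseteq> V" "Poly_Mapping.keys r \<subseteq> W"
  shows "ftensor p r = (\<Sum>u\<in>V. \<Sum>v\<in>W. Poly_Mapping.single (u, v)
    (Poly_Mapping.lookup p u * Poly_Mapping.lookup r v :: 'k))"
proof -
  have "ftensor p r = (\<Sum>u\<in>Poly_Mapping.keys p. \<Sum>v\<in>W. Poly_Mapping.single (u, v)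
      (Poly_Mapping.lookup p u * Poly_Mapping.lookup r v))"
    unfolding ftensor_def
    by (intro sum.cong refl sum.mono_neutral_left) (use assms in \<open>auto simp: in_keys_iff\<close>)
  also have "\<dots> = (\<Sum>u\<in>V. \<Sum>v\<in>W. Poly_Mapping.single (u, v)
      (Poly_Mapping.lookup p u * Poly_Mapping.lookup r v))"
    by (intro sum.mono_neutral_left) (use assms in \<open>auto simp: in_keys_iff\<close>)
  finally show ?thesis .
qed

lemma ftensor_diff_left: "ftensor (p - p') (r :: ('i, 'k) free_alg) = ftensor p r - ftensor p' r"
proof -
  let ?V = "Poly_Mapping.keys p \<union> Poly_Mapping.keys p'"
  have "Poly_Mapping.keys (p - p') \<subseteq> ?V" by (auto simp: in_keys_iff lookup_minus)
  then show ?thesis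
    by (subst (1 2 3) ftensor_superset [where V = ?V and W = "Poly_Mapping.keys r"])
      (auto simp: lookup_minus left_diff_distrib single_diff sum_subtractf)
qed

lemma ftensor_diff_right: "ftensor (p :: ('i, 'k) free_alg) (r - r') = ftensor p r - ftensor p r'"
proof -
  let ?V = "Poly_Mapping.keys r \<union> Poly_Mapping.keys r'"
  have "Poly_Mapping.keys (r - r') \<subseteq> ?V" by (auto simp: in_keys_iff lookup_minus)
  then show ?thesis
    by (subst (1 2 3) ftensor_superset [where V = "Poly_Mapping.keys p" and W = ?V])
      (auto simp: lookup_minus right_diff_distrib single_diff sum_subtractf)
qed

lemma ftensor_mon:
  "ftensor (mon U) (mon Z :: ('i, 'k) free_alg) = Poly_Mapping.single (Word U, Word Z) 1"
  by (simp add: ftensor_def lookup_mon)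

lemma cls_self: "r \<in> cls p \<longleftrightarrow> r - p \<in> Uq_ideal a q"
proof -
  have "r \<in> cls p \<longleftrightarrow> (\<exists>x\<in>Uq_ideal a q. r = x + p)"
    by (simp add: Uq_class_def a_r_coset_def')
  also have "\<dots> \<longleftrightarrow> r - p \<in> Uq_ideal a q"
    by (metis add_diff_cancel_right' diff_add_cancel)
  finally show ?thesis .
qed

text \<open>Representatives do not matter: \<open>p' \<otimes> r' - p \<otimes> r\<close> is the sum
  of \<open>(p' - p) \<otimes> r'\<close> and \<open>p \<otimes> (r' - r)\<close>.\<close>

lemma utensor_cls: "utensor a q (cls p) (cls r) = cls2 (ftensor p r)"
proof -
  have "cls2 (ftensor p' r') = cls2 (ftensor p r)" if "p' \<in> cls p" "r' \<in> cls r" for p' r'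
  proof -
    have "ftensor (p' - p) r' \<in> Uq2_ideal a q" "ftensor p (r' - r) \<in> Uq2_ideal a q"
      unfolding Uq2_ideal_def using that
      by (auto simp: cls_self intro!: subsetD [OF genideal_superset])
    then have "ftensor (p' - p) r' + ftensor p (r' - r) \<in> Uq2_ideal a q"
      by (rule type_ring_idealD [OF Uq2_ideal_ideal])
    then show ?thesis
      by (simp add: cls2_eq_iff ftensor_diff_left ftensor_diff_right)
  qed
  moreover have "p \<in> cls p" "r \<in> cls r"
    using type_ring_idealD(1) [OF Uq_ideal_ideal] by (simp_all add: cls_self)
  ultimately show ?thesis
    unfolding utensor_def cls2_def [symmetric] by blast
qed

definition pure2 :: "'i gen list \<Rightarrow> 'i gen list \<Rightarrow> ('i, 'k) free_alg2" where
  "pure2 U Z = Poly_Mapping.single (Word U, Word Z) 1"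

lemma pure2_mult: "pure2 U Z * pure2 U' Z' = pure2 (U @ U') (Z @ Z')"
  by (simp add: pure2_def mult_single plus_prod_def plus_word_def)

lemma pure2_Nil: "pure2 [] [] = 1"
  by (simp add: pure2_def zero_word_def [symmetric] flip: single_one zero_prod_def)

lemma utensor_mon: "utensor a q (cls (mon U)) (cls (mon Z)) = cls2 (pure2 U Z)"
  by (simp add: utensor_cls ftensor_mon pure2_def)

text \<open>The expanded coproduct of e_v. Torus letters stay where they arise, so all coefficients
  are 1 and every factor is a word in \<open>ge0_gens\<close>, a shape that the Hopf conditions on
  the pairing accept.\<close>

primrec E_coproduct :: "'i list \<Rightarrow> ('i gen list \<times> 'i gen list) list" where
  "E_coproduct [] = [([], [])]"
| "E_coproduct (j # v) = map (\<lambda>(U, Z). (E j # U, Z)) (E_coproduct v) @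
     map (\<lambda>(U, Z). (Om j # U, E j # Z)) (E_coproduct v)"

definition ge0_gens :: "'i gen set" where
  "ge0_gens = range E \<union> range Om \<union> range OmI"

definition le0_gens :: "'i gen set" where
  "le0_gens = range F \<union> range Om' \<union> range OmI'"

lemma gens_mem [simp]: "E i \<in> ge0_gens" "Om i \<in> ge0_gens" "F i \<in> le0_gens" "Om' i \<in> le0_gens"
  by (simp_all add: ge0_gens_def le0_gens_def)

lemma E_coproduct_gens:
  "(U, Z) \<in> set (E_coproduct v) \<Longrightarrow> set U \<subseteq> ge0_gens \<and> set Z \<subseteq> ge0_gens"
  by (induction v arbitrary: U Z) (auto, blast+)

lemma subalgebra_gen_mon: "set U \<subseteq> G \<Longrightarrow> cls (mon U) \<in> subalgebra_gen a q G"
proof (induction U)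
  case Nil
  show ?case
    using generate_ring.one [of "Uq a q"] by (simp add: subalgebra_gen_def cls_one)
next
  case (Cons g U)
  have "cls (mon [g]) \<in> subalgebra_gen a q G"
    unfolding subalgebra_gen_def using Cons.prems
    by (intro generate_ring.incl) (auto simp: ugen_cls)
  then have "cls (mon [g]) \<otimes>\<^bsub>Uq a q\<^esub> cls (mon U) \<in> subalgebra_gen a q G"
    using Cons unfolding subalgebra_gen_def by (intro generate_ring.eng_mult) auto
  then show ?case
    by (simp add: cls_mult mon_Cons [of g U])
qed

lemma subalgebra_gen_add:
  "cls p \<in> subalgebra_gen a q G \<Longrightarrow> cls r \<in> subalgebra_gen a q G \<Longrightarrow> cls (p + r) \<in> subalgebra_gen a q G"
  unfolding subalgebra_gen_def using generate_ring.eng_add by (metis cls_add)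

lemma subalgebra_gen_cst:
  "cls p \<in> subalgebra_gen a q G \<Longrightarrow> cls (cst c * p) \<in> subalgebra_gen a q G"
  unfolding subalgebra_gen_def cls_mult [symmetric] uconst_cls [symmetric]
  by (rule generate_ring.eng_mult) (auto intro: generate_ring.incl)

lemma ge0_mon: "set U \<subseteq> ge0_gens \<Longrightarrow> cls (mon U) \<in> Uq_ge0 a q"
  and le0_mon: "set U \<subseteq> le0_gens \<Longrightarrow> cls (mon U) \<in> Uq_le0 a q"
  by (simp_all add: Uq_ge0_def Uq_le0_def ge0_gens_def le0_gens_def subalgebra_gen_mon)

section \<open>Torus monomials\<close>

lemma subalgebra_gen_carrier: "subalgebra_gen a q G \<subseteq> carrier (Uq a q)"
  unfolding subalgebra_gen_def
  by (rule subsetI, rule ring.generate_ring_in_carrier [OF Uq_ring])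
    (auto simp: uconst_cls ugen_cls cls_closed)

text \<open>What commutes with all generators commutes with everything they generate; this is used
  once for each argument. It makes \<open>finprod\<close> in \<open>torus_monomial\<close>
  computable.\<close>

lemma subalgebra_gen_commute:
  assumes gens: "\<And>g h. g \<in> G \<Longrightarrow> h \<in> G \<Longrightarrow> cls (mon [g] * mon [h]) = cls (mon [h] * mon [g])"
    and x: "x \<in> subalgebra_gen a q G" and y: "y \<in> subalgebra_gen a q G"
  shows "x \<otimes>\<^bsub>Uq a q\<^esub> y = y \<otimes>\<^bsub>Uq a q\<^esub> x"
proof -
  interpret ring "Uq a q" by (rule Uq_ring)
  let ?H = "range (uconst a q) \<union> ugen a q ` G"
  have sub: "generate_ring (Uq a q) ?H \<subseteq> carrier (Uq a q)"
    using subalgebra_gen_carrier [of G] by (simp add: subalgebra_gen_def)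
  have *: "x \<otimes>\<^bsub>Uq a q\<^esub> y = y \<otimes>\<^bsub>Uq a q\<^esub> x"
    if x: "x \<in> generate_ring (Uq a q) ?H" and y: "y \<in> carrier (Uq a q)"
      and xy: "\<And>h. h \<in> ?H \<Longrightarrow> h \<otimes>\<^bsub>Uq a q\<^esub> y = y \<otimes>\<^bsub>Uq a q\<^esub> h" for x y
    using x
  proof (induction rule: generate_ring.induct)
    case one
    then show ?case using y by simp
  next
    case (incl h)
    then show ?case by (rule xy)
  next
    case (a_inv h)
    then have "h \<in> carrier (Uq a q)" using sub by blast
    then show ?case using y a_inv by (simp add: l_minus r_minus)
  next
    case (eng_add h h')
    then have "h \<in> carrier (Uq a q)" "h' \<in> carrier (Uq a q)" using sub by blast+
    then show ?case using y eng_add by (simp add: l_distr r_distr)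
  next
    case (eng_mult h h')
    then have "h \<in> carrier (Uq a q)" "h' \<in> carrier (Uq a q)" using sub by blast+
    then show ?case using y eng_mult by (metis m_assoc)
  qed
  have 1: "h \<otimes>\<^bsub>Uq a q\<^esub> h' = h' \<otimes>\<^bsub>Uq a q\<^esub> h" if "h \<in> ?H" "h' \<in> ?H" for h h'
    using that gens by (auto simp: uconst_cls ugen_cls cls_mult cst_commute [of "mon w" for w]
        cst_commute [of "cst c" for c])
  have H: "?H \<subseteq> carrier (Uq a q)"
    by (auto simp: uconst_cls ugen_cls cls_closed)
  have 2: "h \<otimes>\<^bsub>Uq a q\<^esub> y = y \<otimes>\<^bsub>Uq a q\<^esub> h" if "h \<in> ?H" "y \<in> generate_ring (Uq a q) ?H" for h y
  proof -
    have "y \<otimes>\<^bsub>Uq a q\<^esub> h = h \<otimes>\<^bsub>Uq a q\<^esub> y"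
      by (rule * [OF that(2) subsetD [OF H that(1)]]) (rule 1 [OF _ that(1)])
    then show ?thesis ..
  qed
  show ?thesis
    by (rule * [OF x [unfolded subalgebra_gen_def] subsetD [OF sub y [unfolded subalgebra_gen_def]]])
      (rule 2 [OF _ y [unfolded subalgebra_gen_def]])
qed

lemma torus_commute:
  "g \<in> torus_gens \<Longrightarrow> h \<in> torus_gens \<Longrightarrow> cls (mon [g] * mon [h]) = cls (mon [h] * mon [g])"
  unfolding cls_eq_iff Uq_ideal_def
  by (rule subsetD [OF genideal_superset]) (use Uq_relations.torus_comm [of g h a q] in \<open>simp add: fgen_mon\<close>)

lemma torus_comm_monoid: "comm_monoid (Uq a q \<lparr> carrier := subalgebra_gen a q torus_gens \<rparr>)"
proof -
  interpret ring "Uq a q" by (rule Uq_ring)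
  have sub: "x \<in> carrier (Uq a q)" if "x \<in> subalgebra_gen a q torus_gens" for x
    using that subalgebra_gen_carrier by blast
  show ?thesis
  proof (rule comm_monoidI)
    fix x y assume *: "x \<in> carrier (Uq a q \<lparr> carrier := subalgebra_gen a q torus_gens \<rparr>)"
      "y \<in> carrier (Uq a q \<lparr> carrier := subalgebra_gen a q torus_gens \<rparr>)"
    then show "x \<otimes>\<^bsub>Uq a q \<lparr> carrier := subalgebra_gen a q torus_gens \<rparr>\<^esub> y
        \<in> carrier (Uq a q \<lparr> carrier := subalgebra_gen a q torus_gens \<rparr>)"
      by (auto simp: subalgebra_gen_def intro: generate_ring.eng_mult)
    show "x \<otimes>\<^bsub>Uq a q \<lparr> carrier := subalgebra_gen a q torus_gens \<rparr>\<^esub> y =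
        y \<otimes>\<^bsub>Uq a q \<lparr> carrier := subalgebra_gen a q torus_gens \<rparr>\<^esub> x"
      using * subalgebra_gen_commute [of torus_gens x y] torus_commute by auto
  next
    show "\<one>\<^bsub>Uq a q \<lparr> carrier := subalgebra_gen a q torus_gens \<rparr>\<^esub>
        \<in> carrier (Uq a q \<lparr> carrier := subalgebra_gen a q torus_gens \<rparr>)"
      by (auto simp: subalgebra_gen_def intro: generate_ring.one)
  qed (auto simp: sub m_assoc)
qed

end

lemma torus_monomial_0:
  fixes q :: "'i :: finite \<Rightarrow> 'i \<Rightarrow> 'k :: field"
  shows "torus_monomial a q x (\<lambda>_. 0) = Uq_class a q 1"
proof -
  interpret C: comm_monoid "Uq a q \<lparr> carrier := subalgebra_gen a q torus_gens \<rparr>"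
    by (rule torus_comm_monoid)
  show ?thesis
    unfolding torus_monomial_def
    by (subst C.finprod_one_eqI) (auto simp: int_pow_def2 cls_one)
qed

lemma torus_monomial_single:
  fixes q :: "'i :: finite \<Rightarrow> 'i \<Rightarrow> 'k :: field"
  assumes "\<And>j. x j \<in> torus_gens"
  shows "torus_monomial a q x (\<lambda>j. if j = i then 1 else 0) = Uq_class a q (mon [x i])"
proof -
  interpret ring "Uq a q" by (rule Uq_ring)
  interpret C: comm_monoid "Uq a q \<lparr> carrier := subalgebra_gen a q torus_gens \<rparr>"
    by (rule torus_comm_monoid)
  have mem: "Uq_class a q (mon [x j]) \<in> subalgebra_gen a q torus_gens" for j
    by (rule subalgebra_gen_mon) (use assms in auto)
  have one: "\<one>\<^bsub>Uq a q \<lparr> carrier := subalgebra_gen a q torus_gens \<rparr>\<^esub> = \<one>\<^bsub>Uq a q\<^esub>"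
    by simp
  have pow: "ugen a q (x j) [^]\<^bsub>Uq a q\<^esub> (if j = i then 1 else 0 :: int) =
      (if j = i then Uq_class a q (mon [x j]) else \<one>\<^bsub>Uq a q\<^esub>)" for j
    by (simp add: int_pow_def2 ugen_cls cls_closed)
  show ?thesis
    unfolding torus_monomial_def pow one [symmetric]
    using C.finprod_singleton_swap [of i UNIV "\<lambda>j. Uq_class a q (mon [x j])"] mem by simp
qed

section \<open>The pairing on words\<close>

text \<open>The linear functional with values \<open>L\<close> on words, routed through
  \<open>lift\<close> and \<open>eps\<close> to inherit their linearity.\<close>

definition evl :: "('i list \<Rightarrow> 'k) \<Rightarrow> ('i word \<Rightarrow>\<^sub>0 'k :: field) \<Rightarrow> 'k" where
  "evl L p = eps (lift (\<lambda>w. cst (L w)) p :: 'i word \<Rightarrow>\<^sub>0 'k)"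

lemma evl_simps [simp]:
  "evl L 0 = 0" "evl L (p + r) = evl L p + evl L r" "evl L (cst c * p) = c * evl L p"
  "evl L (mon w) = L w"
  by (simp_all add: evl_def linD [OF lin_lift] lin_0)

lemma evl_letter_mult: "evl L (mon [j] * p) = evl (\<lambda>w. L (j # w)) p"
  for p :: "'i word \<Rightarrow>\<^sub>0 'k :: field"
proof -
  have "lift (\<lambda>w. cst (L w)) (mon [j] * p) = (lift (\<lambda>w. cst (L (j # w))) p :: 'i word \<Rightarrow>\<^sub>0 'k)"
    by (rule lin_eqI [of "\<lambda>p. lift (\<lambda>w. cst (L w)) (mon [j] * p)"]) (auto simp flip: mon_Cons)
  then show ?thesis by (simp add: evl_def)
qed

lemma evl_mult_fun: "evl (\<lambda>w. c * L w) p = c * evl L p"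
  by (simp add: evl_def lift_def eps_sum sum_distrib_left mult_ac)

lemma eps_lin_evl: "lin A \<Longrightarrow> eps (A p) = evl (\<lambda>w. eps (A (mon w))) p"
proof -
  assume "lin A"
  then have "eps (A p) = eps (lift (\<lambda>w. A (mon w)) p)"
    by (intro arg_cong [of _ _ eps] lin_eq_lift)
  also have "\<dots> = evl (\<lambda>w. eps (A (mon w))) p"
    unfolding evl_def lift_def eps_sum eps_mult eps_simps(6) ..
  finally show ?thesis .
qed

lemma (in braiding) gram_Cons: "gram (i # w) v = evl (gram w) (DLw i v)"
  using eps_lin_evl [of "DW w" "DLw i v"] by (simp add: gram_def [abs_def] DL_mon)

lemma qbichar_0 [simp]: "qbichar q (\<lambda>_. 0) \<mu> = 1" "qbichar q \<mu> (\<lambda>_. 0) = 1"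
  by (simp_all add: qbichar_def)

lemma qbichar_single:
  "qbichar q (\<lambda>k. if k = j then 1 else 0) (\<lambda>k. if k = i then 1 else 0) = q j i"
proof -
  have "(\<Prod>l\<in>UNIV. q k l powi ((if k = j then 1 else 0) * (if l = i then 1 else 0))) =
      (if k = j then q j i else 1)" for k
  proof -
    have "(\<Prod>l\<in>UNIV. q k l powi ((if k = j then 1 else 0) * (if l = i then 1 else 0))) =
        (\<Prod>l\<in>UNIV. if l = i then (if k = j then q j i else 1) else 1)"
      by (intro prod.cong) auto
    then show ?thesis by simp
  qed
  then show ?thesis by (simp add: qbichar_def)
qed

locale uq_pairing = cartan_braiding q a
  for q :: "'i :: finite \<Rightarrow> 'i \<Rightarrow> 'k :: field_char_0" and a :: "'i \<Rightarrow> 'i \<Rightarrow> int" +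
  fixes \<Delta> :: "('i, 'k) free_alg set \<Rightarrow> ('i, 'k) free_alg2 set"
    and B :: "('i, 'k) free_alg set \<Rightarrow> ('i, 'k) free_alg set \<Rightarrow> 'k"
  assumes comult: "is_comultiplication a q \<Delta>"
    and pairing: "is_hopf_pairing a q \<Delta> B"
begin

abbreviation cl :: "('i, 'k) free_alg \<Rightarrow> ('i, 'k) free_alg set" where
  "cl \<equiv> Uq_class a q"

lemma comult_1: "\<Delta> (cl 1) = cls2 a q 1"
  and comult_mult: "\<Delta> (cl (p * r)) = \<Delta> (cl p) \<otimes>\<^bsub>Uq2 a q\<^esub> \<Delta> (cl r)"
  using comult ring_hom_one [of \<Delta> "Uq a q" "Uq2 a q"]
    ring_hom_mult [of \<Delta> "Uq a q" "Uq2 a q" "cl p" "cl r"]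
  by (simp_all add: is_comultiplication_def cls_one cls2_one cls_mult cls_closed)

lemma utensor_right_1: "utensor a q (cl (mon U)) (cl 1) = cls2 a q (pure2 U [])"
  and utensor_left_1: "utensor a q (cl 1) (cl (mon U)) = cls2 a q (pure2 [] U)"
  and utensor_1: "utensor a q (cl 1) (cl 1) = cls2 a q 1"
  using utensor_mon [of a q U "[]"] utensor_mon [of a q "[]" U] utensor_mon [of a q "[]" "[]"]
  by (simp_all add: pure2_Nil)

lemma comult_E: "\<Delta> (cl (mon [E j])) = cls2 a q (pure2 [E j] [] + pure2 [Om j] [E j])"
  and comult_F: "\<Delta> (cl (mon [F j])) = cls2 a q (pure2 [] [F j] + pure2 [F j] [Om' j])"
  using comult
  by (simp_all add: is_comultiplication_def ugen_cls cls_one utensor_right_1 utensor_left_1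
      utensor_mon cls2_add)

lemma comult_E_word:
  "\<Delta> (cl (mon (map E v))) = cls2 a q (\<Sum>(U, Z)\<leftarrow>E_coproduct v. pure2 U Z)"
proof (induction v)
  case Nil
  then show ?case by (simp add: comult_1 pure2_Nil)
next
  case (Cons j v)
  have "(\<Sum>(U, Z)\<leftarrow>E_coproduct (j # v). pure2 U Z :: ('i, 'k) free_alg2) =
      (pure2 [E j] [] + pure2 [Om j] [E j]) * (\<Sum>(U, Z)\<leftarrow>E_coproduct v. pure2 U Z)"
    by (simp add: distrib_right sum_list_const_mult [symmetric] pure2_mult case_prod_unfold
        comp_def sum_list_addf)
  then show ?case
    using Cons by (simp add: mon_Cons [of "E j" "map E v"] comult_mult comult_E cls2_mult)
qed

lemmas pairing_conditions =
  pairing [unfolded is_hopf_pairing_def, THEN conjunct1]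
  pairing [unfolded is_hopf_pairing_def, THEN conjunct2, THEN conjunct1]
  pairing [unfolded is_hopf_pairing_def, THEN conjunct2, THEN conjunct2, THEN conjunct1]
  pairing [unfolded is_hopf_pairing_def, THEN conjunct2, THEN conjunct2, THEN conjunct2, THEN conjunct1]
  pairing [unfolded is_hopf_pairing_def, THEN conjunct2, THEN conjunct2, THEN conjunct2, THEN conjunct2, THEN conjunct1]
  pairing [unfolded is_hopf_pairing_def, THEN conjunct2, THEN conjunct2, THEN conjunct2, THEN conjunct2, THEN conjunct2, THEN conjunct1]
  pairing [unfolded is_hopf_pairing_def, THEN conjunct2, THEN conjunct2, THEN conjunct2, THEN conjunct2, THEN conjunct2, THEN conjunct2, THEN conjunct1]
  pairing [unfolded is_hopf_pairing_def, THEN conjunct2, THEN conjunct2, THEN conjunct2, THEN conjunct2, THEN conjunct2, THEN conjunct2, THEN conjunct2, THEN conjunct1]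
  pairing [unfolded is_hopf_pairing_def, THEN conjunct2, THEN conjunct2, THEN conjunct2, THEN conjunct2, THEN conjunct2, THEN conjunct2, THEN conjunct2, THEN conjunct2, THEN conjunct1]
  pairing [unfolded is_hopf_pairing_def, THEN conjunct2, THEN conjunct2, THEN conjunct2, THEN conjunct2, THEN conjunct2, THEN conjunct2, THEN conjunct2, THEN conjunct2, THEN conjunct2]

lemma pair_add_left: "y \<in> Uq_le0 a q \<Longrightarrow> y' \<in> Uq_le0 a q \<Longrightarrow> x \<in> Uq_ge0 a q \<Longrightarrow>
    B (y \<oplus>\<^bsub>Uq a q\<^esub> y') x = B y x + B y' x"
  and pair_add_right: "y \<in> Uq_le0 a q \<Longrightarrow> x \<in> Uq_ge0 a q \<Longrightarrow> x' \<in> Uq_ge0 a q \<Longrightarrow>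
    B y (x \<oplus>\<^bsub>Uq a q\<^esub> x') = B y x + B y x'"
  and pair_cst_left: "y \<in> Uq_le0 a q \<Longrightarrow> x \<in> Uq_ge0 a q \<Longrightarrow>
    B (uconst a q c \<otimes>\<^bsub>Uq a q\<^esub> y) x = c * B y x"
  and pair_cst_right: "y \<in> Uq_le0 a q \<Longrightarrow> x \<in> Uq_ge0 a q \<Longrightarrow>
    B y (uconst a q c \<otimes>\<^bsub>Uq a q\<^esub> x) = c * B y x"
  using pairing_conditions(1-4) by blast+

lemma pair_mult_right:
  assumes "y \<in> Uq_le0 a q" "x \<in> Uq_ge0 a q" "x' \<in> Uq_ge0 a q"
    "\<And>k. k < n \<Longrightarrow> u k \<in> Uq_le0 a q \<and> v k \<in> Uq_le0 a q"
    "\<Delta> y = (\<Oplus>\<^bsub>Uq2 a q\<^esub>k\<in>{..<n :: nat}. utensor a q (u k) (v k))"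
  shows "B y (x \<otimes>\<^bsub>Uq a q\<^esub> x') = (\<Sum>k<n. B (u k) x' * B (v k) x)"
  using pairing_conditions(5) assms by blast

lemma pair_mult_left:
  assumes "y \<in> Uq_le0 a q" "y' \<in> Uq_le0 a q" "x \<in> Uq_ge0 a q"
    "\<And>k. k < n \<Longrightarrow> u k \<in> Uq_ge0 a q \<and> v k \<in> Uq_ge0 a q"
    "\<Delta> x = (\<Oplus>\<^bsub>Uq2 a q\<^esub>k\<in>{..<n :: nat}. utensor a q (u k) (v k))"
  shows "B (y \<otimes>\<^bsub>Uq a q\<^esub> y') x = (\<Sum>k<n. B y (u k) * B y' (v k))"
  using pairing_conditions(6) assms by blast

lemma pair_generators:
  "B (ugen a q (F i)) (ugen a q (E j)) = (if i = j then q i i / (1 - q i i) else 0)"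
  "B (torus_monomial a q Om' \<mu>) (torus_monomial a q Om \<nu>) = qbichar q \<nu> \<mu>"
  "B (torus_monomial a q Om' \<mu>) (ugen a q (E i)) = 0"
  "B (ugen a q (F i)) (torus_monomial a q Om \<nu>) = 0"
  using pairing_conditions(7-10) by blast+

lemma torus_Om [simp]: "torus_monomial a q Om (\<lambda>j. if j = i then 1 else 0) = cl (mon [Om i])"
  and torus_Om' [simp]: "torus_monomial a q Om' (\<lambda>j. if j = i then 1 else 0) = cl (mon [Om' i])"
  by (simp_all add: torus_monomial_single torus_gens_def)

text \<open>The values at 1 and at single torus letters are the torus conditions for the exponent
  vectors 0 and \<alpha>_i.\<close>

lemma pair_letters:
  "B (cl (mon [F i])) (cl (mon [E j])) = (if i = j then q i i / (1 - q i i) else 0)"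
  "B (cl (mon [F i])) (cl 1) = 0" "B (cl (mon [F i])) (cl (mon [Om j])) = 0"
  "B (cl (mon [Om' i])) (cl (mon [E j])) = 0" "B (cl (mon [Om' i])) (cl (mon [Om j])) = q j i"
  "B (cl 1) (cl 1) = 1" "B (cl 1) (cl (mon [E j])) = 0" "B (cl 1) (cl (mon [Om j])) = 1"
  using pair_generators(1) [of i j] pair_generators(4) [of i "\<lambda>_. 0"]
    pair_generators(4) [of i "\<lambda>l. if l = j then 1 else 0"]
    pair_generators(3) [of "\<lambda>l. if l = i then 1 else 0" j]
    pair_generators(2) [of "\<lambda>l. if l = i then 1 else 0" "\<lambda>l. if l = j then 1 else 0"]
    pair_generators(2) [of "\<lambda>_. 0" "\<lambda>_. 0"] pair_generators(3) [of "\<lambda>_. 0" j]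
    pair_generators(2) [of "\<lambda>_. 0" "\<lambda>l. if l = j then 1 else 0"]
  by (simp_all add: ugen_cls torus_monomial_0 qbichar_single)

lemma one_mem: "cl 1 \<in> Uq_ge0 a q" "cl 1 \<in> Uq_le0 a q"
  using ge0_mon [of "[]" a q] le0_mon [of "[]" a q] by simp_all

lemma letter_mem: "g \<in> ge0_gens \<Longrightarrow> cl (mon [g]) \<in> Uq_ge0 a q"
  "g \<in> le0_gens \<Longrightarrow> cl (mon [g]) \<in> Uq_le0 a q"
  by (simp_all add: ge0_mon le0_mon)

lemma pair_1_mult:
  assumes "cl x \<in> Uq_ge0 a q" "cl x' \<in> Uq_ge0 a q"
  shows "B (cl 1) (cl (x * x')) = B (cl 1) (cl x') * B (cl 1) (cl x)"
proof -
  have "\<Delta> (cl 1) = (\<Oplus>\<^bsub>Uq2 a q\<^esub>k\<in>{..<Suc 0}. utensor a q (cl 1) (cl 1))"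
    by (simp add: utensor_1 cls2_finsum comult_1)
  from pair_mult_right [OF one_mem(2) assms _ this] one_mem show ?thesis
    by (simp add: cls_mult)
qed

text \<open>The crossed order on the right is that of the Hopf condition, which pairs the first
  factor of the coproduct with the second factor of the product.\<close>

lemma pair_F_mult:
  assumes "cl x \<in> Uq_ge0 a q" "cl x' \<in> Uq_ge0 a q"
  shows "B (cl (mon [F i])) (cl (x * x')) =
    B (cl 1) (cl x') * B (cl (mon [F i])) (cl x) + B (cl (mon [F i])) (cl x') * B (cl (mon [Om' i])) (cl x)"
proof -
  let ?u = "\<lambda>k :: nat. if k = 0 then [] else [F i]" and ?v = "\<lambda>k :: nat. if k = 0 then [F i] else [Om' i]"
  have "\<Delta> (cl (mon [F i])) = (\<Oplus>\<^bsub>Uq2 a q\<^esub>k\<in>{..<2 :: nat}. utensor a q (cl (mon (?u k))) (cl (mon (?v k))))"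
    by (simp only: utensor_mon cls2_finsum finite_lessThan comult_F)
      (simp add: numeral_2_eq_2)
  from pair_mult_right [OF letter_mem(2) assms _ this] show ?thesis
    by (simp add: cls_mult numeral_2_eq_2 le0_mon letter_mem one_mem)
qed

lemma pair_1_Cons:
  assumes "cl (mon U) \<in> Uq_ge0 a q"
  shows "B (cl 1) (cl (mon (E j # U))) = 0"
    "B (cl 1) (cl (mon (Om j # U))) = B (cl 1) (cl (mon U))"
  using assms
  by (simp_all add: mon_Cons [of "E j" U] mon_Cons [of "Om j" U] pair_1_mult letter_mem pair_letters)

lemma pair_F_Cons:
  assumes "cl (mon U) \<in> Uq_ge0 a q"
  shows "B (cl (mon [F i])) (cl (mon (E j # U))) =
      (if i = j then q i i / (1 - q i i) else 0) * B (cl 1) (cl (mon U))"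
    "B (cl (mon [F i])) (cl (mon (Om j # U))) = q j i * B (cl (mon [F i])) (cl (mon U))"
  using assms
  by (simp_all add: mon_Cons [of "E j" U] mon_Cons [of "Om j" U] pair_F_mult letter_mem pair_letters)

abbreviation unit_coeff :: "'i \<Rightarrow> 'k" where
  "unit_coeff i \<equiv> q i i / (1 - q i i)"

text \<open>Pairing with 1 kills each \<open>E j\<close> and sends each \<open>Om j\<close> to 1, so
  only the term with all of \<open>v\<close> in the second factor survives. The arbitrary
  \<open>L\<close> lets the induction extend that factor.\<close>

lemma pair_1_coproduct:
  "(\<Sum>(U, Z)\<leftarrow>E_coproduct v. B (cl 1) (cl (mon U)) * L Z) = L (map E v)"
proof (induction v arbitrary: L)
  case Nil
  then show ?case by (simp add: pair_letters)
next
  case (Cons j v)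
  have U: "cl (mon U) \<in> Uq_ge0 a q" if "(U, Z) \<in> set (E_coproduct v)" for U Z
    using E_coproduct_gens [OF that] by (simp add: ge0_mon)
  have "(\<Sum>(U, Z)\<leftarrow>E_coproduct (j # v). B (cl 1) (cl (mon U)) * L Z) =
      (\<Sum>(U, Z)\<leftarrow>E_coproduct v. B (cl 1) (cl (mon (E j # U))) * L Z) +
      (\<Sum>(U, Z)\<leftarrow>E_coproduct v. B (cl 1) (cl (mon (Om j # U))) * L (E j # Z))"
    by (simp add: case_prod_unfold comp_def)
  also have "(\<Sum>(U, Z)\<leftarrow>E_coproduct v. B (cl 1) (cl (mon (E j # U))) * L Z) =
      (\<Sum>(U, Z)\<leftarrow>E_coproduct v. 0)"
    using U by (intro arg_cong [of _ _ sum_list] map_cong)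
      (auto simp: pair_1_Cons)
  also have "(\<Sum>(U, Z)\<leftarrow>E_coproduct v. B (cl 1) (cl (mon (Om j # U))) * L (E j # Z)) =
      (\<Sum>(U, Z)\<leftarrow>E_coproduct v. B (cl 1) (cl (mon U)) * L (E j # Z))"
    using U by (intro arg_cong [of _ _ sum_list] map_cong)
      (auto simp: pair_1_Cons)
  finally show ?case
    using Cons [of "\<lambda>Z. L (E j # Z)"] by (simp add: case_prod_unfold)
qed

text \<open>Only first factors with a single \<open>E i\<close> among torus letters survive. Each
  \<open>Om j\<close> in front of it yields \<open>q j i\<close> and each one behind it yields 1,
  which is the recursion of \<open>DLw\<close>.\<close>

lemma pair_F_coproduct:
  "(\<Sum>(U, Z)\<leftarrow>E_coproduct v. B (cl (mon [F i])) (cl (mon U)) * L Z) =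
    unit_coeff i * evl (\<lambda>w. L (map E w)) (DLw i v)"
proof (induction v arbitrary: L)
  case Nil
  then show ?case by (simp add: pair_letters)
next
  case (Cons j v)
  have U: "cl (mon U) \<in> Uq_ge0 a q" if "(U, Z) \<in> set (E_coproduct v)" for U Z
    using E_coproduct_gens [OF that] by (simp add: ge0_mon)
  have "(\<Sum>(U, Z)\<leftarrow>E_coproduct (j # v). B (cl (mon [F i])) (cl (mon U)) * L Z) =
      (\<Sum>(U, Z)\<leftarrow>E_coproduct v. B (cl (mon [F i])) (cl (mon (E j # U))) * L Z) +
      (\<Sum>(U, Z)\<leftarrow>E_coproduct v. B (cl (mon [F i])) (cl (mon (Om j # U))) * L (E j # Z))"
    by (simp add: case_prod_unfold comp_def)
  also have "(\<Sum>(U, Z)\<leftarrow>E_coproduct v. B (cl (mon [F i])) (cl (mon (E j # U))) * L Z) =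
      (\<Sum>(U, Z)\<leftarrow>E_coproduct v. (if i = j then unit_coeff i else 0) * (B (cl 1) (cl (mon U)) * L Z))"
    using U by (intro arg_cong [of _ _ sum_list] map_cong)
      (auto simp: pair_F_Cons)
  also have "\<dots> = (if i = j then unit_coeff i else 0) * L (map E v)"
    using pair_1_coproduct [of L v] sum_list_const_mult [of "if i = j then unit_coeff i else 0"
        "\<lambda>p. B (cl 1) (cl (mon (fst p))) * L (snd p)" "E_coproduct v"]
    by (simp add: case_prod_unfold)
  also have "(\<Sum>(U, Z)\<leftarrow>E_coproduct v. B (cl (mon [F i])) (cl (mon (Om j # U))) * L (E j # Z)) =
      (\<Sum>(U, Z)\<leftarrow>E_coproduct v. q j i * (B (cl (mon [F i])) (cl (mon U)) * L (E j # Z)))"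
    using U by (intro arg_cong [of _ _ sum_list] map_cong)
      (auto simp: pair_F_Cons)
  also have "\<dots> = q j i * (unit_coeff i * evl (\<lambda>w. L (E j # map E w)) (DLw i v))"
    using Cons [of "\<lambda>Z. L (E j # Z)"] sum_list_const_mult [of "q j i"
        "\<lambda>p. B (cl (mon [F i])) (cl (mon (fst p))) * L (E j # snd p)" "E_coproduct v"]
    by (simp add: case_prod_unfold)
  finally show ?case
    by (simp add: evl_letter_mult algebra_simps)
qed

lemma pair_F_left:
  assumes "cl y \<in> Uq_le0 a q"
  shows "B (cl (mon [F i] * y)) (cl (mon (map E v))) =
    unit_coeff i * evl (\<lambda>w. B (cl y) (cl (mon (map E w)))) (DLw i v)"
proof -
  let ?l = "E_coproduct v"
  let ?u = "\<lambda>k. cl (mon (fst (?l ! k)))" and ?v = "\<lambda>k. cl (mon (snd (?l ! k)))"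
  have mem: "?u k \<in> Uq_ge0 a q \<and> ?v k \<in> Uq_ge0 a q" if "k < length ?l" for k
    using E_coproduct_gens [of "fst (?l ! k)" "snd (?l ! k)" v] that by (simp add: ge0_mon)
  have "(\<Sum>(U, Z)\<leftarrow>?l. pure2 U Z :: ('i, 'k) free_alg2) =
      (\<Sum>k<length ?l. pure2 (fst (?l ! k)) (snd (?l ! k)))"
    by (simp add: sum_list_sum_nth case_prod_unfold lessThan_atLeast0)
  then have "\<Delta> (cl (mon (map E v))) = (\<Oplus>\<^bsub>Uq2 a q\<^esub>k\<in>{..<length ?l}. utensor a q (?u k) (?v k))"
    by (simp add: comult_E_word utensor_mon cls2_finsum)
  from pair_mult_left [OF letter_mem(2) assms _ mem this]
  have "B (cl (mon [F i] * y)) (cl (mon (map E v))) =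
      (\<Sum>k<length ?l. B (cl (mon [F i])) (?u k) * B (cl y) (?v k))"
    by (simp add: cls_mult ge0_mon image_subset_iff)
  also have "\<dots> = (\<Sum>(U, Z)\<leftarrow>?l. B (cl (mon [F i])) (cl (mon U)) * B (cl y) (cl (mon Z)))"
    by (simp add: sum_list_sum_nth case_prod_unfold lessThan_atLeast0)
  finally show ?thesis
    by (simp add: pair_F_coproduct)
qed

lemma F_word_mem: "cl (mon (map F w)) \<in> Uq_le0 a q"
  and E_word_mem: "cl (mon (map E w)) \<in> Uq_ge0 a q"
  by (simp_all add: le0_mon ge0_mon image_subset_iff)

lemma pair_words:
  "B (cl (mon (map F w))) (cl (mon (map E v))) = (\<Prod>i\<leftarrow>w. unit_coeff i) * gram w v"
proof (induction w arbitrary: v)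
  case Nil
  show ?case
  proof (cases v)
    case (Cons j v')
    have "B (cl 1) (cl (mon [E j] * mon (map E v'))) = 0"
      using pair_1_mult [OF letter_mem(1) E_word_mem, of "E j" v'] by (simp add: pair_letters)
    then show ?thesis
      by (simp add: Cons gram_def mon_Cons [of "E j" "map E v'"])
  qed (simp add: gram_def pair_letters)
next
  case (Cons i w)
  have "B (cl (mon (map F (i # w)))) (cl (mon (map E v))) =
      unit_coeff i * evl (\<lambda>v. B (cl (mon (map F w))) (cl (mon (map E v)))) (DLw i v)"
    using pair_F_left [OF F_word_mem, of i w v] by (simp add: mon_Cons [of "F i" "map F w"])
  also have "\<dots> = unit_coeff i * ((\<Prod>i\<leftarrow>w. unit_coeff i) * gram (i # w) v)"
    by (simp add: Cons evl_mult_fun gram_Cons)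
  finally show ?case by (simp add: mult.assoc)
qed

lemma unit_coeff_prod_nonzero: "(\<Prod>i\<leftarrow>w. unit_coeff i) \<noteq> 0"
  by (induction w) (use q_nonzero q_diag_neq_1 in auto)

end

section \<open>Nondegeneracy\<close>

definition emb :: "('i \<Rightarrow> 'g) \<Rightarrow> ('i word \<Rightarrow>\<^sub>0 'k :: field) \<Rightarrow> 'g word \<Rightarrow>\<^sub>0 'k" where
  "emb x = lift (\<lambda>w. mon (map x w))"

lemma lin_emb [simp]: "lin (emb x)"
  by (simp add: emb_def)

lemma lin_emb_intro [simp, intro]: "lin A \<Longrightarrow> lin (\<lambda>p. emb x (A p))"
  by (rule lin_comp) simp_all

lemmas emb_linear [simp] = linD [OF lin_emb] lin_0 [OF lin_emb]

lemma emb_mon [simp]: "emb x (mon w) = mon (map x w)"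
  by (simp add: emb_def)

lemma emb_1 [simp]: "emb x 1 = 1"
  by (simp add: emb_def)

lemma emb_cst [simp]: "emb x (cst c) = cst c"
  using linD(2) [OF lin_emb, of x c 1] by simp

lemma emb_mult: "emb x (p * r) = emb x p * emb x r"
proof (rule lin_eqI [of "\<lambda>p. emb x (p * r)"])
  fix w
  show "emb x (mon w * r) = emb x (mon w) * emb x r"
    by (rule lin_eqI [of "\<lambda>r. emb x (mon w * r)"])
      (auto simp flip: mon_append)
qed auto

section \<open>Serre elements in the defining ideal of the quantum group\<close>

lemma (in cartan_braiding) emb_serre_ideal:
  assumes "p \<in> serre_ideal" "ideal I type_ring" "\<And>i j. i \<noteq> j \<Longrightarrow> emb x (serre i j) \<in> I"
  shows "emb x p \<in> I"
  using assms(1)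
proof (induction rule: serre_ideal.induct)
  case (serre_gen i j u v)
  show ?case
    unfolding emb_mult by (intro type_ring_idealD(3,4) [OF assms(2)] assms(3) serre_gen)
qed (simp_all add: type_ring_idealD [OF assms(2)])

lemma mon_power: "mon [g] ^ n = mon (replicate n g)"
  by (induction n) (simp_all add: mon_Cons [of g "replicate n g" for n])

lemma Uq_relations_subset_ideal: "Uq_relations a q \<subseteq> Uq_ideal a q"
  unfolding Uq_ideal_def by (rule genideal_superset)

lemma (in cartan_braiding) emb_E_serre:
  assumes "i \<noteq> j"
  shows "emb E (serre i j) \<in> Uq_ideal a q"
proof -
  have "emb E (serre i j) = (\<Sum>k\<le>nat (1 - a i j). fconst (serre_coeff a q i j k) *
      fgen (E i) ^ (nat (1 - a i j) - k) * fgen (E j) * fgen (E i) ^ k)"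
    unfolding serre_def adpow_letter
    by (simp add: lin_sum [OF lin_emb] emb_mult fgen_mon fconst_cst serre_term_def
        serre_coeff_def mon_power mult.assoc)
  then show ?thesis
    using Uq_relations.serre_E [OF assms, of a q] Uq_relations_subset_ideal [of a q] by auto
qed

lemma (in cartan_braiding) transpose: "cartan_braiding (\<lambda>i j. q j i) a"
  by unfold_locales
    (use q_nonzero q_cartan q_not_root cartan symm in \<open>auto simp: mult.commute\<close>)

text \<open>The relations among the \<open>F i\<close> have their powers in the opposite order.
  Substituting \<open>n - k\<close> for \<open>k\<close> matches the words, and
  \<open>serre_term_transpose\<close> matches the coefficients for transposed parameters.\<close>

lemma (in cartan_braiding) emb_F_serre:
  assumes "i \<noteq> j"
  shows "emb F (serre i j) \<in> Uq_ideal a (\<lambda>i j. q j i)"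
proof -
  let ?n = "nat (1 - a i j)" and ?q = "\<lambda>i j. q j i"
  let ?w = "\<lambda>k. mon (replicate (?n - k) (F i)) * mon [F j] * mon (replicate k (F i)) :: ('i, 'k) free_alg"
  have "emb F (serre i j) = (\<Sum>k\<le>?n. cst (serre_term i j ?n k) * ?w k)"
    unfolding serre_def adpow_letter by (simp add: lin_sum [OF lin_emb] emb_mult)
  also have "\<dots> = (\<Sum>k\<le>?n. cst (serre_term i j ?n (?n - k)) * ?w (?n - k))"
    by (rule sum.reindex_bij_witness [of _ "\<lambda>k. ?n - k" "\<lambda>k. ?n - k"]) auto
  also have "\<dots> = (\<Sum>k\<le>?n. cst (serre_term i j ?n ?n) * (fconst (serre_coeff a ?q i j k) *
      fgen (F i) ^ k * fgen (F j) * fgen (F i) ^ (?n - k)))"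
  proof (rule sum.cong)
    fix k assume "k \<in> {..?n}"
    then have k: "k \<le> ?n" by simp
    show "cst (serre_term i j ?n (?n - k)) * ?w (?n - k) =
        cst (serre_term i j ?n ?n) * (fconst (serre_coeff a ?q i j k) *
          fgen (F i) ^ k * fgen (F j) * fgen (F i) ^ (?n - k))"
      unfolding serre_term_transpose [OF assms refl k]
      by (simp add: fgen_mon fconst_cst serre_coeff_def mon_power mult.assoc cst_cst_mult
          diff_diff_cancel [OF k])
  qed simp
  also have "\<dots> = cst (serre_term i j ?n ?n) * (\<Sum>k\<le>?n. fconst (serre_coeff a ?q i j k) *
      fgen (F i) ^ k * fgen (F j) * fgen (F i) ^ (?n - k))"
    by (rule sum_distrib_left [symmetric])
  also have "\<dots> \<in> Uq_ideal a ?q"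
    using Uq_relations.serre_F [OF assms, of a ?q] Uq_relations_subset_ideal [of a ?q]
    by (intro type_ring_idealD(3) [OF Uq_ideal_ideal]) auto
  finally show ?thesis .
qed

section \<open>Graded components as images of homogeneous elements\<close>

lemma words_of_degree_mset:
  fixes \<beta> :: "'i :: finite \<Rightarrow> nat"
  shows "\<exists>M. words_of_degree \<beta> = {w. mset w = M}"
proof (intro exI)
  have "count (\<Sum>i\<in>UNIV. replicate_mset (\<beta> i) i) j = \<beta> j" for j
    by (simp add: count_sum)
  then show "words_of_degree \<beta> = {w. mset w = (\<Sum>i\<in>UNIV. replicate_mset (\<beta> i) i)}"
    by (auto simp: words_of_degree_def multiset_eq_iff count_mset)
qed

lemma graded_component_eq:
  assumes W: "words_of_degree \<beta> = {w. mset w = M}"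
  shows "graded_component a q x \<beta> = {Uq_class a q (emb x p) | p. homog M p}"
proof -
  have foldr: "foldr (\<lambda>i u. ugen a q (x i) \<otimes>\<^bsub>Uq a q\<^esub> u) w \<one>\<^bsub>Uq a q\<^esub> = Uq_class a q (mon (map x w))" for w
    by (induction w) (simp_all add: cls_one ugen_cls cls_mult mon_Cons [of "x i" "map x w" for i w])
  have sum: "(\<Oplus>\<^bsub>Uq a q\<^esub>w \<in> words_of_degree \<beta>. uconst a q (c w) \<otimes>\<^bsub>Uq a q\<^esub>
      foldr (\<lambda>i u. ugen a q (x i) \<otimes>\<^bsub>Uq a q\<^esub> u) w \<one>\<^bsub>Uq a q\<^esub>) =
      Uq_class a q (emb x (\<Sum>w | mset w = M. cst (c w) * mon w))" for c
    unfolding foldr uconst_cls cls_mult W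
    by (simp add: cls_finsum [OF finite_mset_eq] lin_sum [OF lin_emb])
  have "\<exists>c. p = (\<Sum>w | mset w = M. cst (c w) * mon w)" if p: "homog M p" for p :: "'a word \<Rightarrow>\<^sub>0 'b"
  proof (intro exI)
    have "p = (\<Sum>w\<in>Poly_Mapping.keys p. cst (Poly_Mapping.lookup p w) * mon (letters w))"
      using lift_mon_self [of p] by (simp add: lift_def)
    also have "\<dots> = (\<Sum>w\<in>Word ` {w. mset w = M}. cst (Poly_Mapping.lookup p w) * mon (letters w))"
    proof (rule sum.mono_neutral_left)
      show "Poly_Mapping.keys p \<subseteq> Word ` {w. mset w = M}"
        using p unfolding homog_def by (metis (mono_tags, lifting) image_eqI mem_Collect_eq subsetI
            word.collapse)
    qed (auto simp: in_keys_iff finite_mset_eq)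
    also have "\<dots> = (\<Sum>w | mset w = M. cst (Poly_Mapping.lookup p (Word w)) * mon w)"
      by (subst sum.reindex) (auto simp: inj_on_def)
    finally show "p = (\<Sum>w | mset w = M. cst (Poly_Mapping.lookup p (Word w)) * mon w)" .
  qed
  moreover have "homog M (\<Sum>w | mset w = M. cst (c w) * mon w :: 'a word \<Rightarrow>\<^sub>0 'b)" for c
    by (intro homog_sum homog_cst_mult) simp
  ultimately show ?thesis
    unfolding graded_component_def sum by blast
qed

context uq_pairing
begin

lemma emb_mem: "cl (emb E p) \<in> Uq_ge0 a q" "cl (emb F p) \<in> Uq_le0 a q"
proof -
  show "cl (emb E p) \<in> Uq_ge0 a q"
    by (induction p rule: falg_induct)
      (use E_word_mem in \<open>auto simp: Uq_ge0_def intro: subalgebra_gen_add subalgebra_gen_cst\<close>)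
  show "cl (emb F p) \<in> Uq_le0 a q"
    by (induction p rule: falg_induct)
      (use F_word_mem in \<open>auto simp: Uq_le0_def intro: subalgebra_gen_add subalgebra_gen_cst\<close>)
qed

lemma pair_emb_right:
  assumes "y \<in> Uq_le0 a q"
  shows "B y (cl (emb E p)) = evl (\<lambda>w. B y (cl (mon (map E w)))) p"
proof (induction p rule: falg_induct)
  case (mon c w)
  then show ?case
    using pair_cst_right [OF assms E_word_mem] by (simp add: uconst_cls cls_mult)
next
  case (add p r)
  then show ?case
    using pair_add_right [OF assms emb_mem(1) emb_mem(1), of p r] by (simp add: cls_add)
qed

lemma pair_emb_left:
  assumes "x \<in> Uq_ge0 a q"
  shows "B (cl (emb F p)) x = evl (\<lambda>w. B (cl (mon (map F w))) x) p"
proof (induction p rule: falg_induct)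
  case (mon c w)
  then show ?case
    using pair_cst_left [OF F_word_mem assms] by (simp add: uconst_cls cls_mult)
next
  case (add p r)
  then show ?case
    using pair_add_left [OF emb_mem(2) emb_mem(2) assms, of p r] by (simp add: cls_add)
qed

lemma plus_radical_trivial:
  assumes p: "homog M p" and 0: "\<And>w. mset w = M \<Longrightarrow> B (cl (mon (map F w))) (cl (emb E p)) = 0"
  shows "cl (emb E p) = \<zero>\<^bsub>Uq a q\<^esub>"
proof -
  have "eps (DW w p) = 0" if w: "mset w = M" for w
  proof -
    have "0 = (\<Prod>i\<leftarrow>w. unit_coeff i) * evl (gram w) p"
      using 0 [OF w] by (simp add: pair_emb_right [OF F_word_mem] pair_words evl_mult_fun)
    then have "evl (gram w) p = 0"
      using unit_coeff_prod_nonzero [of w] by simp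
    then show ?thesis
      using eps_lin_evl [of "DW w" p] by (simp add: gram_def [abs_def])
  qed
  then have "p \<in> serre_ideal"
    by (intro radical_subset_serre_ideal [OF p] radicalI_homog [OF p])
  then have "emb E p \<in> Uq_ideal a q"
    by (rule emb_serre_ideal [OF _ Uq_ideal_ideal emb_E_serre])
  then show ?thesis
    by (simp add: cls_zero cls_eq_iff)
qed

text \<open>The right-kernel theorem is used for the transposed parameters:
  \<open>gram_transpose\<close> makes \<open>p\<close> radical there, and the corresponding Serre
  elements are relations among the \<open>F i\<close> for \<open>q\<close> itself.\<close>

lemma minus_radical_trivial:
  assumes p: "homog M p" and 0: "\<And>w. mset w = M \<Longrightarrow> B (cl (emb F p)) (cl (mon (map E w))) = 0"
  shows "cl (emb F p) = \<zero>\<^bsub>Uq a q\<^esub>"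
proof -
  interpret T: cartan_braiding "\<lambda>i j. q j i" a by (rule transpose)
  have "eps (T.DW v p) = 0" if v: "mset v = M" for v
  proof -
    \<comment> \<open>The scalar of \<open>w\<close> depends only on its degree, so it can be
      expressed by \<open>v\<close> whenever the Gram entry is nonzero.\<close>
    have *: "(\<Prod>i\<leftarrow>w. unit_coeff i) * gram w v = (\<Prod>i\<leftarrow>v. unit_coeff i) * T.gram v w" for w
    proof (cases "mset w = mset v")
      case True
      then have "mset (map unit_coeff w) = mset (map unit_coeff v)"
        by (simp only: mset_map)
      then have "(\<Prod>i\<leftarrow>w. unit_coeff i) = (\<Prod>i\<leftarrow>v. unit_coeff i)"
        using prod_mset_prod_list [of "map unit_coeff w"] prod_mset_prod_list [of "map unit_coeff v"]
        by (simp only:)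
      then show ?thesis by (simp only: gram_transpose [of w v])
    next
      case False
      then have "gram w v = 0" by (rule gram_eq_0)
      then show ?thesis using gram_transpose [of w v] by simp
    qed
    have "0 = (\<Prod>i\<leftarrow>v. unit_coeff i) * evl (T.gram v) p"
      using 0 [OF v] by (simp add: pair_emb_left [OF E_word_mem] pair_words * evl_mult_fun)
    then have "evl (T.gram v) p = 0"
      using unit_coeff_prod_nonzero [of v] by simp
    then show ?thesis
      using eps_lin_evl [of "T.DW v" p] by (simp add: T.gram_def [abs_def])
  qed
  then have "p \<in> T.serre_ideal"
    by (intro T.radical_subset_serre_ideal [OF p] T.radicalI_homog [OF p])
  then have "emb F p \<in> Uq_ideal a q"
    by (rule T.emb_serre_ideal [OF _ Uq_ideal_ideal]) (use T.emb_F_serre in simp)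
  then show ?thesis
    by (simp add: cls_zero cls_eq_iff)
qed

theorem nondegenerate: "nondegenerate_on (Uq a q) B (Uq_minus a q \<beta>) (Uq_plus a q \<beta>)"
proof -
  obtain M where W: "words_of_degree \<beta> = {w. mset w = M}"
    using words_of_degree_mset by blast
  have word_mem: "cl (mon (map x w)) \<in> {cl (emb x p) | p. homog M p}" if "mset w = M" for x w
    using that by (intro CollectI exI [of _ "mon w"]) simp
  show ?thesis
    unfolding nondegenerate_on_def Uq_minus_def Uq_plus_def graded_component_eq [OF W]
    using minus_radical_trivial [of M] plus_radical_trivial [of M] word_mem [of _ F] word_mem [of _ E]
    by (auto 0 3)
qed

end

theorem proposition44:
  fixes a :: "'i :: finite \<Rightarrow> 'i \<Rightarrow> int"
    and q :: "'i \<Rightarrow> 'i \<Rightarrow> 'k :: field_char_0"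
    and \<Delta> :: "('i, 'k) free_alg set \<Rightarrow> ('i, 'k) free_alg2 set"
    and B :: "('i, 'k) free_alg set \<Rightarrow> ('i, 'k) free_alg set \<Rightarrow> 'k"
    and \<beta> :: "'i \<Rightarrow> nat"
  assumes "generalized_cartan_matrix a"
    and "symmetrizable a"
    and "indeterminates_subject_to_cartan a q"
    and "\<And>i m. m > 0 \<Longrightarrow> q i i ^ m \<noteq> 1"
    and "\<And>i m. m > 0 \<Longrightarrow> \<exists>r. r ^ m = q i i"
    and "is_comultiplication a q \<Delta>"
    and "is_hopf_pairing a q \<Delta> B"
  shows "nondegenerate_on (Uq a q) B (Uq_minus a q \<beta>) (Uq_plus a q \<beta>)"
proof -
  interpret uq_pairing q a \<Delta> B
    using assms by unfold_locales (auto simp: indeterminates_subject_to_cartan_def)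
  show ?thesis by (rule nondegenerate)
qed

end
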